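(* Let $m=2l$ be even, $G_{2l}$ the dihedral group of order $4l$, $\mu_0,\mu_1,\tau_0,\tau_1\in\mathbb{C}$, and let $(\Lambda,M,C,* )$ be a cellular structure on $\mathbb{C}G_{2l}$ with $*$ the linear extension of $w\mapsto w^{-1}$. Define $(\bar\Lambda,\bar M,\bar C,* )$ as follows. - $\bar\Lambda=\Lambda\amalg\{\lambda_{Kr^0},\lambda_{Kr^1},\lambda_{K^0},\lambda_{K^1}\}$, keeping the partial order of $\Lambda$, with $\lambda_{Kr^i}\prec\lambda$ for all $\lambda\in\Lambda$ and $i\in\{0,1\}$, and $\lambda_{K^i}\prec\lambda_{Kr^j}$ for all $i,j\in\{0,1\}$ (and the relations implied by transitivity). - $\bar M(\lambda)=M(\lambda)$ for $\lambda\in\Lambda$; $\bar M(\lambda_{Kr^0})=\bar M(\lambda_{K^0})=\{0,2,\dots,2l-2\}$; $\bar M(\lambda_{Kr^1})=\bar M(\lambda_{K^1})=\{1,3,\dots,2l-1\}$. - $*$ is the linear anti-involution of $B_{G_{2l}}(\Upsilon)$ with $s_i\mapsto s_i$, $e_i\mapsto e_i$ for $0\le i\le2l-1$. - For $\lambda\in\Lambda$, $\bar C^\lambda_{S,T}=C^\lambda_{S,T}$ via $\mathbb{C}G_{2l}\subset B_{G_{2l}}(\Upsilon)$. - For $0\le i,j\le l-1$: $\bar C^{\lambda_{K^0}}_{2i,0}=[\cdots s_0s_1]_i(s_le_0-e_0)$, $\bar C^{\lambda_{K^0}}_{0,2i}=*(\bar C^{\lambda_{K^0}}_{2i,0})$,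 $\bar C^{\lambda_{K^0}}_{2j,2i}=[\cdots s_0s_1]_j\,\bar C^{\lambda_{K^0}}_{0,2i}$. - For $0\le i,j\le l-1$: $\bar C^{\lambda_{K^1}}_{2i+1,1}=[\cdots s_1s_0]_i(s_{l+1}e_1-e_1)$, $\bar C^{\lambda_{K^1}}_{1,2i+1}=*(\bar C^{\lambda_{K^1}}_{2i+1,1})$, $\bar C^{\lambda_{K^1}}_{2j+1,2i+1}=[\cdots s_1s_0]_j\,\bar C^{\lambda_{K^1}}_{1,2i+1}$. - For $a,b$ both even (case $Kr^0$) or both odd (case $Kr^1$) in $\{0,\dots,2l-1\}$, $\bar C^{\lambda_{Kr^0}}_{a,b}$, respectively $\bar C^{\lambda_{Kr^1}}_{a,b}$, equals $\frac12(w_1+w_2)e_b$, where $w_1,w_2\in G_{2l}$ are representatives of the two cosets in $G_{2l}/\{1,s_b\}$ whose elements $w$ satisfy $we_bw^{-1}=e_a$ (equivalently $ws_bw^{-1}=s_a$). Then $(\bar\Lambda,\bar M,\bar C,* )$ is a cellular structure on $B_{G_{2l}}(\Upsilon)$.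
   Context: Indices of $s,e,\mu,\tau$ are read modulo $m=2l$; $[k]\in\{0,\dots,m-1\}$ is the residue of $k$ mod $m$. $G_m$ acts on $\mathbb{R}^2$; $s_i\in G_m$ ($0\le i\le m-1$) is the reflection in the line through the origin at angle $\pi i/m$ to the $x$-axis; $G_m$ is generated by $s_0,s_1$. $[\cdots s_0s_1]_i$ is the alternating word in $s_0,s_1$ of length $i$ ending in $s_1$ and $[\cdots s_1s_0]_i$ the one ending in $s_0$ (the empty word is $1$). Put $\mu_i=\mu_0$, $\tau_i=\tau_0$ for $i$ even and $\mu_i=\mu_1$, $\tau_i=\tau_1$ for $i$ odd. $B_{G_m}(\Upsilon)$: unital $\mathbb{C}$-algebra generated by $s_0,s_1,e_0,\dots,e_{m-1}$ with relations $s_0^2=s_1^2=(s_0s_1)^m=1$; $s_ie_i=e_is_i=e_i$; $we_iw^{-1}=e_j$ if $w\in G_m$ and $ws_iw^{-1}=s_j$; $e_i^2=\tau_ie_i$; $e_ie_j=0$ if $i-j$ is odd; $e_ie_j=(\mu_ks_k+\mu_{k'}s_{k'})e_j$ with $k=(i+j)/2$, $k'=[(i+j)/2+l]$ if $i\neq j$ and $i-j$ is even. It contains $\mathbb{C}G_m$. Cellular structure (Graham–Lehrer) on a $\mathbb{C}$-algebra $A$: data $(\Lambda,M,C,* )$ where (C1) $\Lambda$ is a partially ordered set, each $M(\lambda)$ is a finite set, and $C:\coprod_{\lambda}M(\lambda)\times M(\lambda)\to A$, $(S,T)\mapsto C^\lambda_{S,T}$, is injective with image a basis of $A$; (C2)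 $*$ is a linear anti-involution with $*(C^\lambda_{S,T})=C^\lambda_{T,S}$; (C3) for $a\in A$, $aC^\lambda_{S,T}\equiv\sum_{S'\in M(\lambda)}r_a(S',S)C^\lambda_{S',T}$ modulo $A(<\lambda)$, with $r_a(S',S)\in\mathbb{C}$ independent of $T$ and $A(<\lambda)$ the span of all $C^\mu_{S'',T''}$ with $\mu<\lambda$. *)

theory Defs
  imports
    "HOL-Analysis.Analysis"
    "HOL-Library.Poly_Mapping"
    "HOL-Algebra.Bij"
    "HOL-Algebra.Generated_Groups"
    "HOL-Algebra.QuotRing"
    "HOL-Algebra.Algebraic_Closure_Type"
    "Jordan_Normal_Form.Missing_VectorSpace"
begin

section \<open>Complex algebras and cellular structures\<close>

text \<open>
  A possibly non-commutative unital \<open>\<complex>\<close>-algebra is a HOL-Algebra record with carrier whose ring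
  part and whose scalar multiplication are compatible (\<open>algebra\<close> of HOL-Algebra is commutative).
\<close>

abbreviation complex_field :: "complex ring"
  where "complex_field \<equiv> ring_of_type_algebra"

definition complex_algebra :: "(complex, 'a) module \<Rightarrow> bool"
  where "complex_algebra A \<longleftrightarrow>
    ring A \<and> vectorspace complex_field A \<and>
    (\<forall>c. \<forall>x\<in>carrier A. \<forall>y\<in>carrier A.
      (c \<odot>\<^bsub>A\<^esub> x) \<otimes>\<^bsub>A\<^esub> y = c \<odot>\<^bsub>A\<^esub> (x \<otimes>\<^bsub>A\<^esub> y) \<and>
      x \<otimes>\<^bsub>A\<^esub> (c \<odot>\<^bsub>A\<^esub> y) = c \<odot>\<^bsub>A\<^esub> (x \<otimes>\<^bsub>A\<^esub> y))"

definition linear_anti_involution :: "(complex, 'a) module \<Rightarrow> ('a \<Rightarrow> 'a) \<Rightarrow> bool"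
  where "linear_anti_involution A f \<longleftrightarrow>
    f \<in> module_hom complex_field A A \<and>
    (\<forall>x\<in>carrier A. \<forall>y\<in>carrier A. f (x \<otimes>\<^bsub>A\<^esub> y) = f y \<otimes>\<^bsub>A\<^esub> f x) \<and>
    (\<forall>x\<in>carrier A. f (f x) = x)"

definition cell_lower ::
    "(complex, 'a) module \<Rightarrow> 'i set \<Rightarrow> 'i rel \<Rightarrow> ('i \<Rightarrow> 'm set) \<Rightarrow> ('i \<Rightarrow> 'm \<Rightarrow> 'm \<Rightarrow> 'a) \<Rightarrow> 'i \<Rightarrow> 'a set"
  where "cell_lower A \<Lambda> ord M C \<kappa> =
    LinearCombinations.module.span complex_field A
      {C \<nu> S T | \<nu> S T. \<nu> \<in> \<Lambda> \<and> (\<nu>, \<kappa>) \<in> ord \<and> \<nu> \<noteq> \<kappa> \<and> S \<in> M \<nu> \<and> T \<in> M \<nu>}"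

text \<open>
  The partial order on \<open>\<Lambda>\<close> is the reflexive relation \<open>ord\<close>. The sets \<open>M \<kappa>\<close> live in one common
  type; their coproduct is taken by the dependent sum over \<open>\<Lambda>\<close>.
\<close>

definition cellular_structure ::
    "(complex, 'a) module \<Rightarrow> 'i set \<Rightarrow> 'i rel \<Rightarrow> ('i \<Rightarrow> 'm set) \<Rightarrow> ('i \<Rightarrow> 'm \<Rightarrow> 'm \<Rightarrow> 'a)
      \<Rightarrow> ('a \<Rightarrow> 'a) \<Rightarrow> bool"
  where "cellular_structure A \<Lambda> ord M C star \<longleftrightarrow>
    complex_algebra A \<and>
    \<comment> \<open>(C1)\<close>
    partial_order_on \<Lambda> ord \<and>
    (\<forall>\<kappa>\<in>\<Lambda>. finite (M \<kappa>)) \<and>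
    inj_on (\<lambda>(\<kappa>, S, T). C \<kappa> S T) (SIGMA \<kappa>:\<Lambda>. M \<kappa> \<times> M \<kappa>) \<and>
    vectorspace.basis complex_field A
      ((\<lambda>(\<kappa>, S, T). C \<kappa> S T) ` (SIGMA \<kappa>:\<Lambda>. M \<kappa> \<times> M \<kappa>)) \<and>
    \<comment> \<open>(C2)\<close>
    linear_anti_involution A star \<and>
    (\<forall>\<kappa>\<in>\<Lambda>. \<forall>S\<in>M \<kappa>. \<forall>T\<in>M \<kappa>. star (C \<kappa> S T) = C \<kappa> T S) \<and>
    \<comment> \<open>(C3)\<close>
    (\<forall>a\<in>carrier A. \<forall>\<kappa>\<in>\<Lambda>. \<exists>r :: 'm \<Rightarrow> 'm \<Rightarrow> complex. \<forall>S\<in>M \<kappa>. \<forall>T\<in>M \<kappa>.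
      (a \<otimes>\<^bsub>A\<^esub> C \<kappa> S T) \<ominus>\<^bsub>A\<^esub> (\<Oplus>\<^bsub>A\<^esub>S'\<in>M \<kappa>. r S' S \<odot>\<^bsub>A\<^esub> C \<kappa> S' T)
        \<in> cell_lower A \<Lambda> ord M C \<kappa>)"


section \<open>Monoid algebras and quotients\<close>

definition monoid_algebra :: "'g monoid \<Rightarrow> (complex, 'g \<Rightarrow>\<^sub>0 complex) module"
  where "monoid_algebra G =
    \<lparr>carrier = {f. Poly_Mapping.keys f \<subseteq> carrier G},
     monoid.mult = (\<lambda>f g. \<Sum>x\<in>Poly_Mapping.keys f. \<Sum>y\<in>Poly_Mapping.keys g.
       Poly_Mapping.single (x \<otimes>\<^bsub>G\<^esub> y) (Poly_Mapping.lookup f x * Poly_Mapping.lookup g y)),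
     monoid.one = Poly_Mapping.single \<one>\<^bsub>G\<^esub> 1,
     ring.zero = 0,
     ring.add = (+),
     module.smult = (\<lambda>c. Poly_Mapping.map ((*) c))\<rparr>"

definition inversion_star :: "'g monoid \<Rightarrow> ('g \<Rightarrow>\<^sub>0 complex) \<Rightarrow> ('g \<Rightarrow>\<^sub>0 complex)"
  where "inversion_star G f =
    (\<Sum>w\<in>Poly_Mapping.keys f. Poly_Mapping.single (inv\<^bsub>G\<^esub> w) (Poly_Mapping.lookup f w))"

definition free_monoid :: "'x set \<Rightarrow> 'x list monoid"
  where "free_monoid Y = \<lparr>partial_object.carrier = lists Y, monoid.mult = append, monoid.one = []\<rparr>"

definition quotient_algebra :: "(complex, 'a) module \<Rightarrow> 'a set \<Rightarrow> (complex, 'a set) module"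
  where "quotient_algebra A I =
    \<lparr>carrier = partial_object.carrier (A Quot I),
     monoid.mult = monoid.mult (A Quot I),
     monoid.one = monoid.one (A Quot I),
     ring.zero = ring.zero (A Quot I),
     ring.add = ring.add (A Quot I),
     module.smult = (\<lambda>c Y. \<Union>x\<in>Y. I +>\<^bsub>A\<^esub> (c \<odot>\<^bsub>A\<^esub> x))\<rparr>"


section \<open>The dihedral group\<close>

text \<open>The reflection in the line through the origin at angle \<open>\<pi> i / m\<close>; it only depends on
  \<open>i\<close> modulo \<open>m\<close>.\<close>

definition plane_refl :: "nat \<Rightarrow> nat \<Rightarrow> real^2 \<Rightarrow> real^2"
  where "plane_refl m i x =
    (let v = vector [cos (pi * real i / real m), sin (pi * real i / real m)]
     in (2 * (x \<bullet> v)) *\<^sub>R v - x)"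

definition dihedral :: "nat \<Rightarrow> (real^2 \<Rightarrow> real^2) monoid"
  where "dihedral m =
    (BijGroup UNIV)\<lparr>carrier := generate (BijGroup UNIV) {plane_refl m 0, plane_refl m 1}\<rparr>"

text \<open>A word in \<open>s\<^sub>0, s\<^sub>1\<close> is a list over \<open>{0, 1}\<close>.\<close>

definition word_value :: "nat \<Rightarrow> nat list \<Rightarrow> real^2 \<Rightarrow> real^2"
  where "word_value m u = foldr (\<lambda>i f. plane_refl m i \<circ> f) u id"

definition word_of :: "nat \<Rightarrow> (real^2 \<Rightarrow> real^2) \<Rightarrow> nat list"
  where "word_of m w = (SOME u. set u \<subseteq> {0, 1} \<and> word_value m u = w)"

text \<open>\<open>alt_word x y n\<close> is the alternating word of length \<open>n\<close> in \<open>x, y\<close> ending in \<open>y\<close>.\<close>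

fun alt_word :: "nat \<Rightarrow> nat \<Rightarrow> nat \<Rightarrow> nat list"
  where
    "alt_word x y 0 = []"
  | "alt_word x y (Suc n) = alt_word y x n @ [y]"


section \<open>The algebra \<open>B\<close> of the dihedral group of order \<open>4 l\<close>\<close>

text \<open>
  The algebra is the free algebra on \<open>s\<^sub>0, s\<^sub>1, e\<^sub>0, \<dots>, e\<^bsub>2l-1\<^esub>\<close> modulo the two-sided ideal
  generated by the differences of the two sides of the relations. A group element \<open>w\<close> occurring
  in a relation is written as the word \<open>word_of (2 * l) w\<close> in \<open>s\<^sub>0, s\<^sub>1\<close>; modulo the relations
  \<open>s\<^sub>0\<^sup>2 = s\<^sub>1\<^sup>2 = (s\<^sub>0 s\<^sub>1)\<^bsup>2l\<^esup> = 1\<close>, which present the group, the choice of the word is immaterial.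
  The parameters are families \<open>\<mu>, \<tau>\<close> of which only the values at residues \<open>i < 2 * l\<close> are used.
\<close>

datatype gen = Gen_s nat | Gen_e nat

definition gens :: "nat \<Rightarrow> gen set"
  where "gens l = {Gen_s 0, Gen_s 1} \<union> Gen_e ` {..<2 * l}"

type_synonym free_elem = "gen list \<Rightarrow>\<^sub>0 complex"

definition free_alg :: "nat \<Rightarrow> (complex, free_elem) module"
  where "free_alg l = monoid_algebra (free_monoid (gens l))"

definition free_word :: "nat list \<Rightarrow> free_elem"
  where "free_word u = Poly_Mapping.single (map Gen_s u) 1"

definition free_grp :: "nat \<Rightarrow> (real^2 \<Rightarrow> real^2) \<Rightarrow> free_elem"
  where "free_grp l w = free_word (word_of (2 * l) w)"

definition free_refl :: "nat \<Rightarrow> nat \<Rightarrow> free_elem"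
  where "free_refl l i = free_grp l (plane_refl (2 * l) i)"

definition free_e :: "nat \<Rightarrow> free_elem"
  where "free_e i = Poly_Mapping.single [Gen_e i] 1"

inductive_set rels :: "nat \<Rightarrow> (nat \<Rightarrow> complex) \<Rightarrow> (nat \<Rightarrow> complex) \<Rightarrow> (free_elem \<times> free_elem) set"
  for l :: nat and \<mu> \<tau> :: "nat \<Rightarrow> complex"
  where
    s0_sq: "(free_word [0] \<otimes>\<^bsub>free_alg l\<^esub> free_word [0], \<one>\<^bsub>free_alg l\<^esub>) \<in> rels l \<mu> \<tau>"
  | s1_sq: "(free_word [1] \<otimes>\<^bsub>free_alg l\<^esub> free_word [1], \<one>\<^bsub>free_alg l\<^esub>) \<in> rels l \<mu> \<tau>"
  | braid: "((free_word [0] \<otimes>\<^bsub>free_alg l\<^esub> free_word [1]) [^]\<^bsub>free_alg l\<^esub> (2 * l), \<one>\<^bsub>free_alg l\<^esub>)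
      \<in> rels l \<mu> \<tau>"
  | s_e: "i < 2 * l \<Longrightarrow> (free_refl l i \<otimes>\<^bsub>free_alg l\<^esub> free_e i, free_e i) \<in> rels l \<mu> \<tau>"
  | e_s: "i < 2 * l \<Longrightarrow> (free_e i \<otimes>\<^bsub>free_alg l\<^esub> free_refl l i, free_e i) \<in> rels l \<mu> \<tau>"
  | conj_e: "\<lbrakk>i < 2 * l; j < 2 * l; w \<in> carrier (dihedral (2 * l));
      w \<otimes>\<^bsub>dihedral (2 * l)\<^esub> plane_refl (2 * l) i \<otimes>\<^bsub>dihedral (2 * l)\<^esub> inv\<^bsub>dihedral (2 * l)\<^esub> w
        = plane_refl (2 * l) j\<rbrakk> \<Longrightarrow>
      (free_grp l w \<otimes>\<^bsub>free_alg l\<^esub> free_e i \<otimes>\<^bsub>free_alg l\<^esub> free_grp l (inv\<^bsub>dihedral (2 * l)\<^esub> w), free_e j)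
        \<in> rels l \<mu> \<tau>"
  | e_sq: "i < 2 * l \<Longrightarrow>
      (free_e i \<otimes>\<^bsub>free_alg l\<^esub> free_e i, \<tau> i \<odot>\<^bsub>free_alg l\<^esub> free_e i) \<in> rels l \<mu> \<tau>"
  | e_e_odd: "\<lbrakk>i < 2 * l; j < 2 * l; odd (int i - int j)\<rbrakk> \<Longrightarrow>
      (free_e i \<otimes>\<^bsub>free_alg l\<^esub> free_e j, \<zero>\<^bsub>free_alg l\<^esub>) \<in> rels l \<mu> \<tau>"
  | e_e_even: "\<lbrakk>i < 2 * l; j < 2 * l; i \<noteq> j; even (int i - int j);
      k = (i + j) div 2; k' = (k + l) mod (2 * l)\<rbrakk> \<Longrightarrow>
      (free_e i \<otimes>\<^bsub>free_alg l\<^esub> free_e j,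
       (\<mu> k \<odot>\<^bsub>free_alg l\<^esub> free_refl l k \<oplus>\<^bsub>free_alg l\<^esub> \<mu> k' \<odot>\<^bsub>free_alg l\<^esub> free_refl l k')
         \<otimes>\<^bsub>free_alg l\<^esub> free_e j) \<in> rels l \<mu> \<tau>"

definition rel_ideal :: "nat \<Rightarrow> (nat \<Rightarrow> complex) \<Rightarrow> (nat \<Rightarrow> complex) \<Rightarrow> free_elem set"
  where "rel_ideal l \<mu> \<tau> =
    genideal (free_alg l) {x \<ominus>\<^bsub>free_alg l\<^esub> y | x y. (x, y) \<in> rels l \<mu> \<tau>}"

definition B_alg :: "nat \<Rightarrow> (nat \<Rightarrow> complex) \<Rightarrow> (nat \<Rightarrow> complex) \<Rightarrow> (complex, free_elem set) module"
  where "B_alg l \<mu> \<tau> = quotient_algebra (free_alg l) (rel_ideal l \<mu> \<tau>)"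

definition B_class :: "nat \<Rightarrow> (nat \<Rightarrow> complex) \<Rightarrow> (nat \<Rightarrow> complex) \<Rightarrow> free_elem \<Rightarrow> free_elem set"
  where "B_class l \<mu> \<tau> x = rel_ideal l \<mu> \<tau> +>\<^bsub>free_alg l\<^esub> x"

definition B_word :: "nat \<Rightarrow> (nat \<Rightarrow> complex) \<Rightarrow> (nat \<Rightarrow> complex) \<Rightarrow> nat list \<Rightarrow> free_elem set"
  where "B_word l \<mu> \<tau> u = B_class l \<mu> \<tau> (free_word u)"

definition B_grp ::
    "nat \<Rightarrow> (nat \<Rightarrow> complex) \<Rightarrow> (nat \<Rightarrow> complex) \<Rightarrow> (real^2 \<Rightarrow> real^2) \<Rightarrow> free_elem set"
  where "B_grp l \<mu> \<tau> w = B_class l \<mu> \<tau> (free_grp l w)"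

definition B_s :: "nat \<Rightarrow> (nat \<Rightarrow> complex) \<Rightarrow> (nat \<Rightarrow> complex) \<Rightarrow> nat \<Rightarrow> free_elem set"
  where "B_s l \<mu> \<tau> i = B_grp l \<mu> \<tau> (plane_refl (2 * l) i)"

definition B_e :: "nat \<Rightarrow> (nat \<Rightarrow> complex) \<Rightarrow> (nat \<Rightarrow> complex) \<Rightarrow> nat \<Rightarrow> free_elem set"
  where "B_e l \<mu> \<tau> i = B_class l \<mu> \<tau> (free_e i)"

text \<open>The linear extension of \<open>w \<mapsto> B_grp l \<mu> \<tau> w\<close>; it is the inclusion of the group algebra.\<close>

definition B_incl :: "nat \<Rightarrow> (nat \<Rightarrow> complex) \<Rightarrow> (nat \<Rightarrow> complex)
    \<Rightarrow> ((real^2 \<Rightarrow> real^2) \<Rightarrow>\<^sub>0 complex) \<Rightarrow> free_elem set"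
  where "B_incl l \<mu> \<tau> f =
    (\<Oplus>\<^bsub>B_alg l \<mu> \<tau>\<^esub>w\<in>Poly_Mapping.keys f. Poly_Mapping.lookup f w \<odot>\<^bsub>B_alg l \<mu> \<tau>\<^esub> B_grp l \<mu> \<tau> w)"

text \<open>Extensionality on the carrier makes the anti-involution unique as a HOL function.\<close>

definition B_star ::
    "nat \<Rightarrow> (nat \<Rightarrow> complex) \<Rightarrow> (nat \<Rightarrow> complex) \<Rightarrow> free_elem set \<Rightarrow> free_elem set"
  where "B_star l \<mu> \<tau> = (THE f.
    f \<in> extensional (carrier (B_alg l \<mu> \<tau>)) \<and>
    linear_anti_involution (B_alg l \<mu> \<tau>) f \<and>
    (\<forall>i<2 * l. f (B_s l \<mu> \<tau> i) = B_s l \<mu> \<tau> i \<and> f (B_e l \<mu> \<tau> i) = B_e l \<mu> \<tau> i))"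


section \<open>The extended cell datum\<close>

text \<open>\<open>LKr p\<close> and \<open>LK p\<close>, for \<open>p \<in> {0, 1}\<close>, stand for \<open>\<lambda>\<close> with index \<open>Kr\<^sup>p\<close> and \<open>K\<^sup>p\<close>.\<close>

datatype 'i bar = Old 'i | LKr nat | LK nat

definition bar_index :: "'i set \<Rightarrow> 'i bar set"
  where "bar_index \<Lambda> = Old ` \<Lambda> \<union> {LKr 0, LKr 1, LK 0, LK 1}"

definition bar_order :: "'i set \<Rightarrow> 'i rel \<Rightarrow> 'i bar rel"
  where "bar_order \<Lambda> ord =
    {(Old x, Old y) | x y. (x, y) \<in> ord} \<union>
    {(LKr p, Old x) | p x. p \<in> {0, 1} \<and> x \<in> \<Lambda>} \<union>
    {(LK p, LKr q) | p q. p \<in> {0, 1} \<and> q \<in> {0, 1}} \<union>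
    {(LK p, Old x) | p x. p \<in> {0, 1} \<and> x \<in> \<Lambda>} \<union>
    Id_on (bar_index \<Lambda>)"

definition parity_labels :: "nat \<Rightarrow> nat \<Rightarrow> nat set"
  where "parity_labels l p = {2 * i + p | i. i < l}"

primrec bar_M :: "nat \<Rightarrow> ('i \<Rightarrow> 'm set) \<Rightarrow> 'i bar \<Rightarrow> ('m + nat) set"
  where
    "bar_M l M (Old x) = Inl ` M x"
  | "bar_M l M (LKr p) = Inr ` parity_labels l p"
  | "bar_M l M (LK p) = Inr ` parity_labels l p"

text \<open>The case \<open>p = 0\<close> starts from \<open>s\<^sub>l e\<^sub>0 - e\<^sub>0\<close> with words ending in \<open>s\<^sub>1\<close>, the case \<open>p = 1\<close>
  from \<open>s\<^bsub>l+1\<^esub> e\<^sub>1 - e\<^sub>1\<close> with words ending in \<open>s\<^sub>0\<close>.\<close>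

definition K_col ::
    "nat \<Rightarrow> (nat \<Rightarrow> complex) \<Rightarrow> (nat \<Rightarrow> complex) \<Rightarrow> nat \<Rightarrow> nat \<Rightarrow> free_elem set"
  where "K_col l \<mu> \<tau> p i =
    B_word l \<mu> \<tau> (alt_word p (1 - p) i) \<otimes>\<^bsub>B_alg l \<mu> \<tau>\<^esub>
      (B_s l \<mu> \<tau> (l + p) \<otimes>\<^bsub>B_alg l \<mu> \<tau>\<^esub> B_e l \<mu> \<tau> p \<ominus>\<^bsub>B_alg l \<mu> \<tau>\<^esub> B_e l \<mu> \<tau> p)"

text \<open>For a label \<open>a = 2 * i + p\<close> the index \<open>i\<close> is \<open>a div 2\<close>. On the overlap \<open>b = p\<close> the last
  clause agrees with the first one because the anti-involution fixes \<open>K_col l \<mu> \<tau> p 0\<close>.\<close>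

definition C_K ::
    "nat \<Rightarrow> (nat \<Rightarrow> complex) \<Rightarrow> (nat \<Rightarrow> complex) \<Rightarrow> nat \<Rightarrow> nat \<Rightarrow> nat \<Rightarrow> free_elem set"
  where "C_K l \<mu> \<tau> p a b =
    (if b = p then K_col l \<mu> \<tau> p (a div 2)
     else if a = p then B_star l \<mu> \<tau> (K_col l \<mu> \<tau> p (b div 2))
     else B_word l \<mu> \<tau> (alt_word p (1 - p) (a div 2)) \<otimes>\<^bsub>B_alg l \<mu> \<tau>\<^esub>
       B_star l \<mu> \<tau> (K_col l \<mu> \<tau> p (b div 2)))"

text \<open>Any choice of \<open>w1, w2\<close> gives the same element, since \<open>s\<^sub>b e\<^sub>b = e\<^sub>b\<close>.\<close>

definition C_Kr ::
    "nat \<Rightarrow> (nat \<Rightarrow> complex) \<Rightarrow> (nat \<Rightarrow> complex) \<Rightarrow> nat \<Rightarrow> nat \<Rightarrow> free_elem set"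
  where "C_Kr l \<mu> \<tau> a b =
    (let G = dihedral (2 * l);
         s = plane_refl (2 * l);
         H = {\<one>\<^bsub>G\<^esub>, s b};
         (w1, w2) = (SOME (w1, w2). w1 \<in> carrier G \<and> w2 \<in> carrier G \<and>
           w1 <#\<^bsub>G\<^esub> H \<noteq> w2 <#\<^bsub>G\<^esub> H \<and>
           w1 \<otimes>\<^bsub>G\<^esub> s b \<otimes>\<^bsub>G\<^esub> inv\<^bsub>G\<^esub> w1 = s a \<and> w2 \<otimes>\<^bsub>G\<^esub> s b \<otimes>\<^bsub>G\<^esub> inv\<^bsub>G\<^esub> w2 = s a)
     in (1/2) \<odot>\<^bsub>B_alg l \<mu> \<tau>\<^esub>
       ((B_grp l \<mu> \<tau> w1 \<oplus>\<^bsub>B_alg l \<mu> \<tau>\<^esub> B_grp l \<mu> \<tau> w2) \<otimes>\<^bsub>B_alg l \<mu> \<tau>\<^esub> B_e l \<mu> \<tau> b))"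

text \<open>Only labels from \<^term>\<open>bar_M l M\<close> matter, so \<open>projl\<close> and \<open>projr\<close> are applied properly.\<close>

primrec bar_C ::
    "nat \<Rightarrow> (nat \<Rightarrow> complex) \<Rightarrow> (nat \<Rightarrow> complex)
      \<Rightarrow> ('i \<Rightarrow> 'm \<Rightarrow> 'm \<Rightarrow> ((real^2 \<Rightarrow> real^2) \<Rightarrow>\<^sub>0 complex))
      \<Rightarrow> 'i bar \<Rightarrow> 'm + nat \<Rightarrow> 'm + nat \<Rightarrow> free_elem set"
  where
    "bar_C l \<mu> \<tau> C (Old x) = (\<lambda>s t. B_incl l \<mu> \<tau> (C x (projl s) (projl t)))"
  | "bar_C l \<mu> \<tau> C (LKr p) = (\<lambda>s t. C_Kr l \<mu> \<tau> (projr s) (projr t))"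
  | "bar_C l \<mu> \<tau> C (LK p) = (\<lambda>s t. C_K l \<mu> \<tau> p (projr s) (projr t))"

end

theory Submission
  imports Defs "HOL-Library.Function_Algebras"
begin

text \<open>
  Every relation rewrites a product of generators into a combination of the elements \<open>g\<close> of the
  group and \<open>r\<^sup>k e\<^sub>j\<close>, where \<open>r\<close> is the rotation \<open>s\<^sub>1 s\<^sub>0\<close>. That these are linearly independent
  follows by writing down the left multiplications as operators on functions on this set of normal
  forms: the operators satisfy the relations, so evaluation at the unit identifies the algebra with
  the space of functions. The rotation \<open>r\<^sup>l\<close> is central, and its eigenvalues \<open>1\<close> and \<open>-1\<close> split the
  span of the \<open>r\<^sup>k e\<^sub>j\<close> into the cells \<open>Kr\<close> and \<open>K\<close>; in both the cell basis element with labels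
  \<open>a, b\<close> is a multiple of \<open>w\<^sub>a (1 \<plusminus> r\<^sup>l) e\<^sub>p w\<^sub>b\<inverse>\<close>. By the relations,
  \<open>s\<^sub>i\<close> and \<open>e\<^sub>i\<close> carry each \<open>(1 \<plusminus> r\<^sup>l) e\<^sub>j\<close> to a combination of elements \<open>g (1 \<plusminus> r\<^sup>l) e\<^sub>j\<close> with the same
  sign, and \<open>w\<^sub>b\<close>, which occurs on the right only, is not involved.
\<close>

text \<open>The four new cells come from halving modulo \<open>2 * l\<close>. For \<open>a\<close>,
  \<open>b\<close> of equal parity the rotations that conjugate \<open>s_b\<close> to
  \<open>s_a\<close> are \<open>r^k\<close> and \<open>r^(k + l)\<close> with
  \<open>2 * k = a - b\<close>. The pair thus accounts for a plane spanned by two normal forms, with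
  one dimension for either eigenvalue of \<open>r^l\<close>; four cells with \<open>l^2\<close>
  elements each exhaust the \<open>(2 * l)^2\<close> normal forms \<open>r^k e_j\<close>. The same
  ambiguity is behind the two terms \<open>k\<close> and \<open>k'\<close> in the relation for
  \<open>e_i e_j\<close>. With integer indices and periodic vectors a half is an exact equation, and
  congruences appear only when two halves are compared. Independence of the normal forms by a
  multiplication table would require its associativity; for operators this is automatic. Reversal of
  words preserves the ideal for a similar reason: it is enough that the reversed relations act
  equally on the unit. For (C3) the coefficients may not depend on the second label. They are
  therefore chosen before the vector: the factor \<open>(1 \<plusminus> r^l) e_p w_b^(-1)\<close> is
  replaced by an arbitrary \<open>e_p v\<close> in the eigenspace of \<open>r^l\<close>.\<close>

definition fscale :: "complex \<Rightarrow> ('x \<Rightarrow> complex) \<Rightarrow> 'x \<Rightarrow> complex"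
  where "fscale c f = (\<lambda>x. c * f x)"

lemma fscale_apply: "fscale c f x = c * f x"
  by (simp add: fscale_def)

global_interpretation fvs: vector_space fscale
  by unfold_locales (auto simp: fscale_def fun_eq_iff algebra_simps)

section \<open>Span, independence and bases read in coordinates\<close>

lemma complex_field_simps [simp]:
  "carrier complex_field = UNIV" "\<zero>\<^bsub>complex_field\<^esub> = 0" "\<one>\<^bsub>complex_field\<^esub> = 1"
  "x \<otimes>\<^bsub>complex_field\<^esub> y = x * y" "x \<oplus>\<^bsub>complex_field\<^esub> y = x + y"
  by (auto simp: ring_of_type_algebra_def)

text \<open>Linear algebra with explicit carriers is moved along an injective linear map into a
  space of functions. This is applied twice: to \<open>B\<close>, through the action on the unit
  vector, and to the group algebra.\<close>

locale coordinate_map =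
  fixes A :: "(complex, 'a) module" and h :: "'a \<Rightarrow> 'x \<Rightarrow> complex"
  assumes alg: "complex_algebra A"
    and inj: "inj_on h (carrier A)"
    and add: "\<And>x y. \<lbrakk>x \<in> carrier A; y \<in> carrier A\<rbrakk> \<Longrightarrow> h (x \<oplus>\<^bsub>A\<^esub> y) = h x + h y"
    and smult: "\<And>c x. x \<in> carrier A \<Longrightarrow> h (c \<odot>\<^bsub>A\<^esub> x) = fscale c (h x)"
begin

sublocale vectorspace complex_field A
  using alg by (simp add: complex_algebra_def)

lemma h_zero: "h \<zero>\<^bsub>A\<^esub> = 0"
  using add[of "\<zero>\<^bsub>A\<^esub>" "\<zero>\<^bsub>A\<^esub>"] by simp

lemma h_minus: "\<lbrakk>x \<in> carrier A; y \<in> carrier A\<rbrakk> \<Longrightarrow> h (x \<ominus>\<^bsub>A\<^esub> y) = h x - h y"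
proof -
  assume xy: "x \<in> carrier A" "y \<in> carrier A"
  have "h (x \<ominus>\<^bsub>A\<^esub> y) + h y = h ((x \<ominus>\<^bsub>A\<^esub> y) \<oplus>\<^bsub>A\<^esub> y)"
    using xy by (intro add[symmetric]) auto
  also have "(x \<ominus>\<^bsub>A\<^esub> y) \<oplus>\<^bsub>A\<^esub> y = x"
    using xy by (simp add: a_minus_def M.a_assoc M.l_neg)
  finally show ?thesis by (metis eq_diff_eq)
qed

lemma h_finsum:
  assumes "f \<in> I \<rightarrow> carrier A"
  shows "h (\<Oplus>\<^bsub>A\<^esub>i\<in>I. f i) = (\<Sum>i\<in>I. h (f i))"
proof (cases "finite I")
  case True
  then show ?thesis using assms
    by (induction I) (auto simp: h_zero add)
qed (simp add: h_zero M.finsum_infinite)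

lemma h_eq_zero: "x \<in> carrier A \<Longrightarrow> h x = 0 \<longleftrightarrow> x = \<zero>\<^bsub>A\<^esub>"
  using inj h_zero by (metis M.zero_closed inj_onD)

lemma h_lincomb:
  assumes "T \<subseteq> carrier A"
  shows "h (lincomb a T) = (\<Sum>v\<in>T. fscale (a v) (h v))"
  unfolding lincomb_def using assms by (subst h_finsum) (auto intro!: sum.cong simp: smult subset_iff)

lemma h_span:
  assumes S: "S \<subseteq> carrier A"
  shows "h ` span S = fvs.span (h ` S)"
proof (intro equalityI subsetI)
  fix y assume "y \<in> h ` span S"
  then obtain a T where T: "finite T" "T \<subseteq> S" "y = h (lincomb a T)"
    by (auto simp: span_def)
  then show "y \<in> fvs.span (h ` S)"
    using S by (subst T(3), subst h_lincomb)
      (auto intro!: fvs.span_sum fvs.span_scale intro: fvs.span_base)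
next
  fix y assume "y \<in> fvs.span (h ` S)"
  then obtain t r where t: "finite t" "t \<subseteq> h ` S" "y = (\<Sum>v\<in>t. fscale (r v) v)"
    by (auto simp: fvs.span_explicit)
  from t(2) obtain T where T: "T \<subseteq> S" "t = h ` T" "inj_on h T"
    by (metis subset_image_inj)
  have "finite T" using T t by (metis finite_imageD)
  moreover have "y = h (lincomb (\<lambda>x. r (h x)) T)"
    using T S t by (subst h_lincomb) (auto simp: sum.reindex)
  ultimately show "y \<in> h ` span S"
    using T by (auto simp: span_def)
qed

lemma mem_span_iff:
  assumes "S \<subseteq> carrier A" "x \<in> carrier A"
  shows "x \<in> span S \<longleftrightarrow> h x \<in> fvs.span (h ` S)"
proof -
  have "span S \<subseteq> carrier A"
    using assms by (auto simp: span_def)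
  then show ?thesis
    unfolding h_span[OF assms(1), symmetric] using inj assms(2) by (auto dest: inj_onD)
qed

lemma lin_indpt_iff:
  assumes S: "S \<subseteq> carrier A"
  shows "lin_indpt S \<longleftrightarrow> fvs.independent (h ` S)"
proof
  assume *: "lin_indpt S"
  show "fvs.independent (h ` S)"
    unfolding fvs.independent_explicit_module
  proof (intro allI impI)
    fix t u v assume t: "finite t" "t \<subseteq> h ` S" "(\<Sum>v\<in>t. fscale (u v) v) = 0" "v \<in> t"
    from t(2) obtain T where T: "T \<subseteq> S" "t = h ` T" "inj_on h T"
      by (metis subset_image_inj)
    have fin: "finite T" using T t by (metis finite_imageD)
    obtain x where x: "x \<in> T" "v = h x" using t T by auto
    have "h (lincomb (\<lambda>x. u (h x)) T) = 0"
      using T S t by (subst h_lincomb) (auto simp: sum.reindex)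
    then have "lincomb (\<lambda>x. u (h x)) T = \<zero>\<^bsub>A\<^esub>"
      using T S by (subst (asm) h_eq_zero) auto
    then show "u v = 0"
      using * lin_dep_crit[OF fin T(1) _ x(1), of "\<lambda>x. u (h x)"] x(2) by auto
  qed
next
  assume *: "fvs.independent (h ` S)"
  show "lin_indpt S"
  proof
    assume "lin_dep S"
    then obtain T a v where T: "finite T" "T \<subseteq> S" "lincomb a T = \<zero>\<^bsub>A\<^esub>" "v \<in> T" "a v \<noteq> 0"
      by (auto simp: lin_dep_def)
    have inj': "inj_on h T" using inj T S by (meson inj_on_subset subset_trans)
    have "h (lincomb a T) = 0" using T by (simp add: h_zero)
    then have "(\<Sum>v\<in>T. fscale (a v) (h v)) = 0"
      using T S by (subst (asm) h_lincomb) auto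
    then have "(\<Sum>w\<in>h ` T. fscale (a (the_inv_into T h w)) w) = 0"
      using inj' by (subst sum.reindex) (auto simp: the_inv_into_f_f)
    then have "a (the_inv_into T h (h v)) = 0"
      using T by (intro fvs.independentD[OF *, of "h ` T" "\<lambda>w. a (the_inv_into T h w)"]) auto
    then show False using T inj' by (simp add: the_inv_into_f_f)
  qed
qed

lemma basis_iff:
  assumes S: "S \<subseteq> carrier A"
  shows "basis S \<longleftrightarrow> fvs.independent (h ` S) \<and> fvs.span (h ` S) = h ` carrier A"
proof -
  have "span S \<subseteq> carrier A"
    using assms by (auto simp: span_def)
  then have "span S = carrier A \<longleftrightarrow> h ` span S = h ` carrier A"
    using inj by (simp add: inj_on_image_eq_iff)
  then show ?thesis
    using S by (simp add: basis_def lin_indpt_iff h_span)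
qed

end

text \<open>A vector cannot lie in the span of others if a linear form vanishes on them but not on
  it. Forms are asked for on \<open>T\<close> alone: later \<open>S\<close> comes from the given
  cellular basis of the group algebra, of which only independence is known.\<close>

lemma independent_Un_functionals:
  assumes S: "fvs.independent S" and T: "finite T"
    and phi: "\<And>t. t \<in> T \<Longrightarrow> \<exists>\<phi>. Modules.module_hom fscale (*) \<phi> \<and> \<phi> t \<noteq> 0 \<and> (\<forall>x\<in>S \<union> T - {t}. \<phi> x = 0)"
  shows "fvs.independent (S \<union> T)"
  using T phi
proof (induction T)
  case (insert t T)
  obtain \<phi> where \<phi>: "Modules.module_hom fscale (*) \<phi>" "\<phi> t \<noteq> 0"
    "\<And>x. x \<in> S \<union> insert t T \<Longrightarrow> x \<noteq> t \<Longrightarrow> \<phi> x = 0"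
    using insert.prems[of t] by blast
  have ind: "fvs.independent (S \<union> T)"
  proof (rule insert.IH)
    fix s assume s: "s \<in> T"
    show "\<exists>\<phi>. Modules.module_hom fscale (*) \<phi> \<and> \<phi> s \<noteq> 0 \<and> (\<forall>x\<in>S \<union> T - {s}. \<phi> x = 0)"
      using insert.prems[of s] s by blast
  qed
  show ?case
  proof (cases "t \<in> S \<union> T")
    case True
    then have "S \<union> insert t T = S \<union> T" by auto
    then show ?thesis using ind by simp
  next
    case False
    have "t \<notin> fvs.span (S \<union> T)"
    proof
      assume t: "t \<in> fvs.span (S \<union> T)"
      have "\<phi> t = 0"
      proof (rule Modules.module_hom.eq_0_on_span[OF \<phi>(1) _ t])
        show "\<phi> x = 0" if "x \<in> S \<union> T" for x
          using \<phi>(3)[of x] that False by auto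
      qed
      with \<phi>(2) show False by simp
    qed
    then show ?thesis using ind False by (simp add: fvs.independent_insert)
  qed
qed (use S in simp)

text \<open>With concatenation as addition of words, the free algebra is a subring of the
  type-class ring of finitely supported functions.\<close>

instantiation list :: (type) monoid_add
begin

definition zero_list :: "'a list" where "zero_list = []"
definition plus_list :: "'a list \<Rightarrow> 'a list \<Rightarrow> 'a list" where "plus_list = append"

instance
  by standard (simp_all add: zero_list_def plus_list_def)

end

lemma set_zero_list [simp]: "set 0 = {}"
  by (simp add: zero_list_def)

lemma poly_mapping_sum_single:
  "(\<Sum>x\<in>Poly_Mapping.keys f. Poly_Mapping.single x (Poly_Mapping.lookup f x)) = f"
  by (intro poly_mapping_eqI) (simp add: lookup_sum lookup_single when_def in_keys_iff)

text \<open>Scalars become multiples of the empty word, so that closure under scalars is a case of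
  closure under products.\<close>

lemma poly_mapping_map_times:
  "Poly_Mapping.map ((*) c) f = Poly_Mapping.single 0 c * (f :: 'a::monoid_add \<Rightarrow>\<^sub>0 complex)"
proof -
  have "Poly_Mapping.single 0 c * f =
    (\<Sum>x\<in>Poly_Mapping.keys f. Poly_Mapping.single x (c * Poly_Mapping.lookup f x))"
    by (subst (1) poly_mapping_sum_single[symmetric]) (simp add: sum_distrib_left mult_single)
  then show ?thesis
    by (intro poly_mapping_eqI)
      (simp add: lookup_sum lookup_single when_def in_keys_iff Poly_Mapping.map.rep_eq)
qed

lemma single_zero_commute:
  "Poly_Mapping.single 0 c * f = f * Poly_Mapping.single 0 (c :: complex)"
  for f :: "'a::monoid_add \<Rightarrow>\<^sub>0 complex"
  by (subst (1 2) poly_mapping_sum_single[of f, symmetric])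
    (simp add: sum_distrib_left sum_distrib_right mult_single mult.commute)

lemma sum_times_poly_mapping:
  fixes f g :: "'a::monoid_add \<Rightarrow>\<^sub>0 complex"
  shows "(\<Sum>x\<in>Poly_Mapping.keys f. \<Sum>y\<in>Poly_Mapping.keys g.
     Poly_Mapping.single (x + y) (Poly_Mapping.lookup f x * Poly_Mapping.lookup g y)) = f * g"
proof -
  have "f * g = (\<Sum>x\<in>Poly_Mapping.keys f. Poly_Mapping.single x (Poly_Mapping.lookup f x)) *
     (\<Sum>y\<in>Poly_Mapping.keys g. Poly_Mapping.single y (Poly_Mapping.lookup g y))"
    by (simp add: poly_mapping_sum_single)
  then show ?thesis by (simp add: sum_product mult_single)
qed

section \<open>The free algebra inside the ring of finitely supported functions\<close>

abbreviation scal :: "complex \<Rightarrow> free_elem" where "scal c \<equiv> Poly_Mapping.single 0 c"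

lemma free_alg_simps [simp]:
  "carrier (free_alg l) = {f. Poly_Mapping.keys f \<subseteq> lists (gens l)}"
  "f \<otimes>\<^bsub>free_alg l\<^esub> g = f * g"
  "\<one>\<^bsub>free_alg l\<^esub> = 1"
  "\<zero>\<^bsub>free_alg l\<^esub> = 0"
  "f \<oplus>\<^bsub>free_alg l\<^esub> g = f + g"
  "c \<odot>\<^bsub>free_alg l\<^esub> f = scal c * f"
  using sum_times_poly_mapping[of f g]
  by (simp_all add: free_alg_def monoid_algebra_def free_monoid_def plus_list_def zero_list_def
      poly_mapping_map_times flip: single_one)

text \<open>A separate name keeps membership a matter of closure rules; it is not unfolded into a
  statement on supports at every use.\<close>

definition free_carrier :: "nat \<Rightarrow> free_elem set"
  where "free_carrier l = {f. Poly_Mapping.keys f \<subseteq> lists (gens l)}"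

lemma carrier_free_alg: "carrier (free_alg l) = free_carrier l"
  by (simp add: free_carrier_def)

declare free_alg_simps(1) [simp del] carrier_free_alg [simp]

lemma free_carrier_closed [simp, intro]:
  "0 \<in> free_carrier l" "1 \<in> free_carrier l" "scal c \<in> free_carrier l"
  "\<lbrakk>f \<in> free_carrier l; g \<in> free_carrier l\<rbrakk> \<Longrightarrow> f + g \<in> free_carrier l"
  "\<lbrakk>f \<in> free_carrier l; g \<in> free_carrier l\<rbrakk> \<Longrightarrow> f - g \<in> free_carrier l"
  "f \<in> free_carrier l \<Longrightarrow> - f \<in> free_carrier l"
  "\<lbrakk>f \<in> free_carrier l; g \<in> free_carrier l\<rbrakk> \<Longrightarrow> f * g \<in> free_carrier l"
proof -
  show "\<lbrakk>f \<in> free_carrier l; g \<in> free_carrier l\<rbrakk> \<Longrightarrow> f + g \<in> free_carrier l"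
    using Poly_Mapping.keys_add[of f g] by (auto simp: free_carrier_def)
  show "\<lbrakk>f \<in> free_carrier l; g \<in> free_carrier l\<rbrakk> \<Longrightarrow> f - g \<in> free_carrier l"
    using keys_diff[of f g] by (auto simp: free_carrier_def)
  show "\<lbrakk>f \<in> free_carrier l; g \<in> free_carrier l\<rbrakk> \<Longrightarrow> f * g \<in> free_carrier l"
    using keys_mult[of f g] by (fastforce simp: free_carrier_def plus_list_def)
qed (auto simp: free_carrier_def zero_list_def simp flip: single_one)

lemma free_carrier_sum [intro]: "(\<And>i. i \<in> I \<Longrightarrow> f i \<in> free_carrier l) \<Longrightarrow> sum f I \<in> free_carrier l"
  by (induction I rule: infinite_finite_induct) auto

text \<open>Words grow by one letter on the left, and every element is a finite combination of its
  words. The one-sided product case fits the study of left multiplications.\<close>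

lemma free_carrier_induct [consumes 1, case_names gen one scal add mult]:
  assumes x: "x \<in> free_carrier l"
    and gen: "\<And>g. g \<in> gens l \<Longrightarrow> P (Poly_Mapping.single [g] 1)"
    and one: "P 1"
    and scal: "\<And>c x. \<lbrakk>x \<in> free_carrier l; P x\<rbrakk> \<Longrightarrow> P (scal c * x)"
    and add: "\<And>x y. \<lbrakk>x \<in> free_carrier l; y \<in> free_carrier l; P x; P y\<rbrakk> \<Longrightarrow> P (x + y)"
    and mult: "\<And>g x. \<lbrakk>g \<in> gens l; x \<in> free_carrier l; P x\<rbrakk> \<Longrightarrow> P (Poly_Mapping.single [g] 1 * x)"
  shows "P x"
proof -
  have word: "Poly_Mapping.single u 1 \<in> free_carrier l \<and> P (Poly_Mapping.single u 1)" if "set u \<subseteq> gens l" for u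
    using that
  proof (induction u)
    case Nil
    then show ?case using one free_carrier_closed(2)[of l] by (simp add: zero_list_def flip: single_one)
  next
    case (Cons g u)
    then have "P (Poly_Mapping.single [g] 1 * Poly_Mapping.single u 1)"
      by (intro mult) auto
    moreover have "Poly_Mapping.single [g] 1 * Poly_Mapping.single u 1 = (Poly_Mapping.single (g # u) 1 :: free_elem)"
      by (simp add: mult_single plus_list_def)
    ultimately show ?case using Cons.prems by (auto simp: free_carrier_def)
  qed
  have "(\<Sum>u\<in>U. Poly_Mapping.single u (Poly_Mapping.lookup x u)) \<in> free_carrier l \<and>
    P (\<Sum>u\<in>U. Poly_Mapping.single u (Poly_Mapping.lookup x u))" if "finite U" "U \<subseteq> lists (gens l)" for U
    using that
  proof (induction U)
    case empty
    \<comment> \<open>The empty sum is \<open>0\<close> times the unit.\<close>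
    then show ?case using scal[OF _ one, of 0] by simp
  next
    case (insert u U)
    have eq: "Poly_Mapping.single u (Poly_Mapping.lookup x u) = scal (Poly_Mapping.lookup x u) * Poly_Mapping.single u 1"
      by (simp add: mult_single)
    have "set u \<subseteq> gens l" using insert.prems by auto
    with word[of u] have "Poly_Mapping.single u (Poly_Mapping.lookup x u) \<in> free_carrier l \<and> P (Poly_Mapping.single u (Poly_Mapping.lookup x u))"
      unfolding eq by (auto intro!: scal)
    then show ?case using insert by (auto intro!: add)
  qed
  from this[of "Poly_Mapping.keys x"] x show ?thesis
    by (simp add: poly_mapping_sum_single free_carrier_def)
qed

lemma free_carrier_single [simp]: "Poly_Mapping.single u c \<in> free_carrier l \<longleftrightarrow> c = 0 \<or> set u \<subseteq> gens l"
  by (auto simp: free_carrier_def)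

lemma ring_free_alg: "ring (free_alg l)"
proof (intro ringI abelian_groupI monoidI)
  fix x assume "x \<in> carrier (free_alg l)"
  then show "\<exists>y\<in>carrier (free_alg l). y \<oplus>\<^bsub>free_alg l\<^esub> x = \<zero>\<^bsub>free_alg l\<^esub>"
    by (intro bexI[of _ "- x"]) auto
qed (auto simp: algebra_simps)

lemma free_alg_minus [simp]:
  assumes "x \<in> free_carrier l" "y \<in> free_carrier l"
  shows "x \<ominus>\<^bsub>free_alg l\<^esub> y = x - y"
proof -
  interpret ring "free_alg l" by (rule ring_free_alg)
  have "\<ominus>\<^bsub>free_alg l\<^esub> y = - y"
    using assms by (intro minus_equality) auto
  then show ?thesis using assms by (simp add: a_minus_def)
qed

section \<open>Quotients of the free algebra by an ideal\<close>

locale free_quotient =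
  fixes l :: nat and I :: "free_elem set"
  assumes ideal: "ideal I (free_alg l)"
begin

interpretation I: ideal I "free_alg l" by (rule ideal)

abbreviation Q where "Q \<equiv> quotient_algebra (free_alg l) I"

definition cls :: "free_elem \<Rightarrow> free_elem set" where "cls x = I +>\<^bsub>free_alg l\<^esub> x"

lemma I_closed:
  "0 \<in> I" "\<lbrakk>x \<in> I; y \<in> I\<rbrakk> \<Longrightarrow> x + y \<in> I"
  "\<lbrakk>x \<in> I; y \<in> free_carrier l\<rbrakk> \<Longrightarrow> x * y \<in> I" "\<lbrakk>x \<in> I; y \<in> free_carrier l\<rbrakk> \<Longrightarrow> y * x \<in> I"
  using additive_subgroup.zero_closed[OF I.additive_subgroup_axioms]
    additive_subgroup.a_closed[OF I.additive_subgroup_axioms, of x y] I.I_r_closed[of x y] I.I_l_closed[of x y]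
  by simp_all

lemma I_minus: "\<lbrakk>x \<in> I; y \<in> I\<rbrakk> \<Longrightarrow> x - y \<in> I"
  using I_closed(2)[of x "scal (-1) * y"] I_closed(4)[of y "scal (-1)"]
  by (simp add: single_uminus)

lemma cls_eq_iff:
  assumes "x \<in> free_carrier l" "y \<in> free_carrier l"
  shows "cls x = cls y \<longleftrightarrow> x - y \<in> I"
  using I.quotient_eq_iff_same_a_r_cos[OF ideal, of x y] assms by (simp add: cls_def)

lemma carrier_Q: "carrier Q = cls ` free_carrier l"
  by (auto simp: quotient_algebra_def FactRing_def A_RCOSETS_def' cls_def)

lemma cls_in_carrier [simp]: "x \<in> free_carrier l \<Longrightarrow> cls x \<in> carrier Q"
  by (simp add: carrier_Q)

lemma cls_add [simp]:
  "\<lbrakk>x \<in> free_carrier l; y \<in> free_carrier l\<rbrakk> \<Longrightarrow> cls x \<oplus>\<^bsub>Q\<^esub> cls y = cls (x + y)"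
  by (simp add: quotient_algebra_def FactRing_def cls_def I.a_rcos_sum)

lemma cls_mult [simp]:
  "\<lbrakk>x \<in> free_carrier l; y \<in> free_carrier l\<rbrakk> \<Longrightarrow> cls x \<otimes>\<^bsub>Q\<^esub> cls y = cls (x * y)"
  by (simp add: quotient_algebra_def FactRing_def cls_def I.rcoset_mult_add)

lemma cls_one: "\<one>\<^bsub>Q\<^esub> = cls 1"
  by (simp add: quotient_algebra_def FactRing_def cls_def)

lemma cls_zero: "\<zero>\<^bsub>Q\<^esub> = cls 0"
  using I.a_rcos_zero[OF ideal I_closed(1)] by (simp add: quotient_algebra_def FactRing_def cls_def)

text \<open>The quotient defines scaling as a union over all representatives. It is a single coset
  because the ideal absorbs multiplication by \<open>scal c\<close>.\<close>

lemma cls_smult [simp]: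
  assumes "x \<in> free_carrier l"
  shows "c \<odot>\<^bsub>Q\<^esub> cls x = cls (scal c * x)"
proof -
  have *: "cls (scal c * y) = cls (scal c * x)" if "y \<in> cls x" for y
  proof -
    have y: "y \<in> free_carrier l"
      using that assms I.a_r_coset_subset_G[OF I.a_subset, of x] by (auto simp: cls_def)
    have "cls y = cls x"
      using I.a_repr_independence'[of y x] that assms by (simp add: cls_def)
    then have "y - x \<in> I" using y assms by (simp add: cls_eq_iff)
    then have "scal c * (y - x) \<in> I" by (intro I_closed) auto
    then show ?thesis using y assms by (subst cls_eq_iff) (auto simp: algebra_simps)
  qed
  have "x \<in> cls x"
    unfolding cls_def using assms by (simp add: I.a_rcos_self)
  then have "(\<Union>y\<in>cls x. cls (scal c * y)) = cls (scal c * x)"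
    using * by blast
  then show ?thesis by (simp add: quotient_algebra_def cls_def)
qed

lemma carrier_Q_E:
  assumes "q \<in> carrier Q"
  obtains x where "x \<in> free_carrier l" "q = cls x"
  using assms by (auto simp: carrier_Q)

lemma ring_Q: "ring Q"
proof -
  interpret R: ring "free_alg l Quot I" by (rule I.quotient_is_ring)
  show ?thesis
    by (intro ringI abelian_groupI monoidI)
      (auto simp: quotient_algebra_def R.m_assoc R.a_assoc R.l_distr R.r_distr
        intro: R.add.l_inv_ex R.a_comm[THEN equalityD1, THEN subsetD] R.a_comm[THEN equalityD2, THEN subsetD])
qed

lemma complex_algebra_Q: "complex_algebra Q"
proof -
  have f: "field complex_field"
    by (rule field_from_type_algebra)
  then have c: "cring complex_field" by (simp add: domain_def field_def)
  interpret Q: ring Q by (rule ring_Q)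
  have "module complex_field Q"
  proof (intro moduleI c Q.abelian_group_axioms)
    fix a b q assume "q \<in> carrier Q"
    then obtain x where x: "x \<in> free_carrier l" "q = cls x" by (rule carrier_Q_E)
    show "a \<odot>\<^bsub>Q\<^esub> q \<in> carrier Q" using x by simp
    show "(a \<oplus>\<^bsub>complex_field\<^esub> b) \<odot>\<^bsub>Q\<^esub> q = a \<odot>\<^bsub>Q\<^esub> q \<oplus>\<^bsub>Q\<^esub> b \<odot>\<^bsub>Q\<^esub> q"
      using x by (simp add: single_add distrib_right)
    show "(a \<otimes>\<^bsub>complex_field\<^esub> b) \<odot>\<^bsub>Q\<^esub> q = a \<odot>\<^bsub>Q\<^esub> (b \<odot>\<^bsub>Q\<^esub> q)"
      using x by (simp add: mult_single flip: mult.assoc)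
    show "\<one>\<^bsub>complex_field\<^esub> \<odot>\<^bsub>Q\<^esub> q = q"
      using x by simp
    fix r assume "r \<in> carrier Q"
    then obtain y where y: "y \<in> free_carrier l" "r = cls y" by (rule carrier_Q_E)
    show "a \<odot>\<^bsub>Q\<^esub> (q \<oplus>\<^bsub>Q\<^esub> r) = a \<odot>\<^bsub>Q\<^esub> q \<oplus>\<^bsub>Q\<^esub> a \<odot>\<^bsub>Q\<^esub> r"
      using x y by (simp add: distrib_left)
  qed
  moreover have "(c \<odot>\<^bsub>Q\<^esub> q) \<otimes>\<^bsub>Q\<^esub> r = c \<odot>\<^bsub>Q\<^esub> (q \<otimes>\<^bsub>Q\<^esub> r) \<and>
    q \<otimes>\<^bsub>Q\<^esub> (c \<odot>\<^bsub>Q\<^esub> r) = c \<odot>\<^bsub>Q\<^esub> (q \<otimes>\<^bsub>Q\<^esub> r)"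
    if "q \<in> carrier Q" "r \<in> carrier Q" for c q r
  proof -
    from that obtain x y where xy: "x \<in> free_carrier l" "q = cls x" "y \<in> free_carrier l" "r = cls y"
      by (elim carrier_Q_E) blast
    have "x * (scal c * y) = scal c * (x * y)"
      by (metis mult.assoc single_zero_commute)
    with xy show ?thesis by (simp add: mult.assoc)
  qed
  ultimately show ?thesis
    using f ring_Q by (simp add: complex_algebra_def vectorspace_def)
qed

lemma cls_minus [simp]:
  assumes "x \<in> free_carrier l" "y \<in> free_carrier l"
  shows "cls x \<ominus>\<^bsub>Q\<^esub> cls y = cls (x - y)"
proof -
  interpret Q: ring Q by (rule ring_Q)
  have "cls (- y) \<oplus>\<^bsub>Q\<^esub> cls y = \<zero>\<^bsub>Q\<^esub>"
    using assms by (simp add: cls_zero)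
  then have *: "\<ominus>\<^bsub>Q\<^esub> cls y = cls (- y)"
    using assms by (intro Q.minus_equality) auto
  show ?thesis using assms by (simp add: a_minus_def *)
qed

end

section \<open>The dihedral group in coordinates\<close>

text \<open>\<open>Rot k\<close> is the rotation by \<open>2\<pi>k/m\<close> and \<open>Ref k\<close> the reflection \<open>s\<^sub>k\<close>; the indices are
  integers, so that all formulas are those of the infinite dihedral group.\<close>

datatype gcode = Rot int | Ref int

fun gmul :: "gcode \<Rightarrow> gcode \<Rightarrow> gcode" where
  "gmul (Rot a) (Rot b) = Rot (a + b)"
| "gmul (Rot a) (Ref b) = Ref (a + b)"
| "gmul (Ref a) (Rot b) = Ref (a - b)"
| "gmul (Ref a) (Ref b) = Rot (a - b)"

fun ginv :: "gcode \<Rightarrow> gcode" where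
  "ginv (Rot a) = Rot (- a)"
| "ginv (Ref a) = Ref a"

text \<open>Conjugation on the indices of reflections: \<open>g s_j g^(-1)\<close> is the reflection
  with index \<open>gact g j\<close>, see \<open>gconj\<close>.\<close>

fun gact :: "gcode \<Rightarrow> int \<Rightarrow> int" where
  "gact (Rot a) j = j + 2 * a"
| "gact (Ref a) j = 2 * a - j"

fun gcong :: "nat \<Rightarrow> gcode \<Rightarrow> gcode \<Rightarrow> bool" where
  "gcong m (Rot a) (Rot b) = (int m dvd a - b)"
| "gcong m (Ref a) (Ref b) = (int m dvd a - b)"
| "gcong m _ _ = False"

text \<open>The angle of rotation of \<open>Rot k\<close>, and twice the angle of the mirror line of
  \<open>Ref k\<close>.\<close>

definition angle :: "nat \<Rightarrow> int \<Rightarrow> real"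
  where "angle m k = 2 * pi * real_of_int k / real m"

fun gmap :: "nat \<Rightarrow> gcode \<Rightarrow> real^2 \<Rightarrow> real^2" where
  "gmap m (Rot k) x = vector [cos (angle m k) * x$1 - sin (angle m k) * x$2,
     sin (angle m k) * x$1 + cos (angle m k) * x$2]"
| "gmap m (Ref k) x = vector [cos (angle m k) * x$1 + sin (angle m k) * x$2,
     sin (angle m k) * x$1 - cos (angle m k) * x$2]"

lemma angle_simps: "angle m 0 = 0" "angle m (a + b) = angle m a + angle m b"
  "angle m (a - b) = angle m a - angle m b"
  by (simp_all add: angle_def algebra_simps add_divide_distrib diff_divide_distrib)

lemma gmul_assoc: "gmul (gmul g h) k = gmul g (gmul h k)"
  by (cases g; cases h; cases k) auto

lemma gmul_Rot_0 [simp]: "gmul (Rot 0) g = g" "gmul g (Rot 0) = g"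
  by (cases g; simp)+

lemma gmul_ginv [simp]: "gmul g (ginv g) = Rot 0" "gmul (ginv g) g = Rot 0" "ginv (ginv g) = g"
  by (cases g; simp)+

lemma ginv_gmul: "ginv (gmul g h) = gmul (ginv h) (ginv g)"
  by (cases g; cases h) auto

lemma gact_gmul: "gact (gmul g h) j = gact g (gact h j)"
  by (cases g; cases h) auto

lemma gconj: "gmul (gmul g (Ref i)) (ginv g) = Ref (gact g i)"
  by (cases g) auto

lemma gcong_refl [simp, intro]: "gcong m g g"
  by (cases g) auto

text \<open>The double angle formulas turn \<open>2 (x . v) v - x\<close>, with \<open>v\<close> the
  unit vector at angle \<open>a\<close>, into the reflection matrix for the angle
  \<open>2 * a\<close>.\<close>

lemma plane_refl_eq_gmap: "plane_refl m i = gmap m (Ref (int i))"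
proof
  fix x :: "real^2"
  define a where "a = pi * real i / real m"
  have "angle m (int i) = 2 * a" by (simp add: a_def angle_def)
  moreover have "2 * (x$1 * cos a + x$2 * sin a) * cos a - x$1 = cos (2 * a) * x$1 + sin (2 * a) * x$2"
    unfolding cos_double_cos sin_double by (simp add: algebra_simps power2_eq_square)
  moreover have "2 * (x$1 * cos a + x$2 * sin a) * sin a - x$2 = sin (2 * a) * x$1 - cos (2 * a) * x$2"
    unfolding cos_double_sin sin_double by (simp add: algebra_simps power2_eq_square)
  ultimately show "plane_refl m i x = gmap m (Ref (int i)) x"
    by (simp add: plane_refl_def Let_def a_def[symmetric] vec_eq_iff forall_2 inner_vec_def sum_2)
qed

lemma gmap_gmul: "gmap m (gmul g h) = gmap m g \<circ> gmap m h"
  by (cases g; cases h)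
    (simp_all add: fun_eq_iff vec_eq_iff forall_2 angle_simps cos_add sin_add cos_diff sin_diff algebra_simps)

lemma gmap_one: "gmap m (Rot 0) = id"
  by (simp add: fun_eq_iff vec_eq_iff forall_2 angle_simps)

lemma angle_eq_iff:
  assumes "m > 0"
  shows "cos (angle m a) = cos (angle m b) \<and>
    sin (angle m a) = sin (angle m b) \<longleftrightarrow> int m dvd a - b"
proof -
  have "angle m a = angle m b + 2 * pi * real_of_int n \<longleftrightarrow> a - b = int m * n" for n
  proof -
    have "angle m a = angle m b + 2 * pi * real_of_int n \<longleftrightarrow>
      (2 * pi) * real_of_int a = (2 * pi) * (real_of_int b + real m * real_of_int n)"
      using assms by (simp add: angle_def field_simps)
    also have "\<dots> \<longleftrightarrow> real_of_int a = real_of_int (b + int m * n)"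
      by (simp del: mult_cancel_left1)
    also have "\<dots> \<longleftrightarrow> a - b = int m * n"
      by (simp only: of_int_eq_iff) auto
    finally show ?thesis .
  qed
  then show ?thesis
    using sin_cos_eq_iff[of "angle m a" "angle m b"]
    by (auto simp: dvd_def)
qed

lemma gmap_eq_iff:
  assumes "m > 0"
  shows "gmap m g = gmap m h \<longleftrightarrow> gcong m g h"
proof
  assume *: "gmap m g = gmap m h"
  have 1: "gmap m g (vector [1, 0]) $ i = gmap m h (vector [1, 0]) $ i"
    and 2: "gmap m g (vector [0, 1]) $ i = gmap m h (vector [0, 1]) $ i" for i
    by (simp_all add: *)
  \<comment> \<open>If a rotation matrix equalled a reflection matrix, comparing both columns would
    make a cosine and the sine of the same angle equal to their negatives, so both would be
    zero.\<close>
  have no: "\<not> (cos x = - cos x \<and> sin x = - sin x)" for x :: real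
    using sin_cos_squared_add[of x] by (auto simp: power2_eq_square)
  show "gcong m g h"
  proof (cases g; cases h)
    fix a b assume "g = Rot a" "h = Rot b"
    with 1[of 1] 1[of 2] angle_eq_iff[OF assms, of a b] show ?thesis by simp
  next
    fix a b assume "g = Ref a" "h = Ref b"
    with 1[of 1] 1[of 2] angle_eq_iff[OF assms, of a b] show ?thesis by simp
  next
    fix a b assume "g = Rot a" "h = Ref b"
    with 1[of 1] 1[of 2] 2[of 1] 2[of 2] no[of "angle m a"] show ?thesis
      by simp
  next
    fix a b assume "g = Ref a" "h = Rot b"
    with 1[of 1] 1[of 2] 2[of 1] 2[of 2] no[of "angle m a"] show ?thesis
      by simp
  qed
next
  assume "gcong m g h"
  then show "gmap m g = gmap m h"
    by (cases g; cases h) (auto simp: fun_eq_iff simp flip: angle_eq_iff[OF assms])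
qed

declare gmap.simps [simp del]

definition wcode :: "nat list \<Rightarrow> gcode"
  where "wcode u = foldr (\<lambda>i. gmul (Ref (int i))) u (Rot 0)"

lemma wcode_simps [simp]: "wcode [] = Rot 0" "wcode (i # u) = gmul (Ref (int i)) (wcode u)"
  by (simp_all add: wcode_def)

lemma wcode_append: "wcode (u @ v) = gmul (wcode u) (wcode v)"
  by (induction u) (auto simp: gmul_assoc)

lemma wcode_rev: "wcode (rev u) = ginv (wcode u)"
  by (induction u) (auto simp: wcode_append ginv_gmul)

lemma word_value_eq_gmap: "word_value m u = gmap m (wcode u)"
  by (induction u) (simp_all add: word_value_def gmap_one gmap_gmul plane_refl_eq_gmap)

text \<open>\<open>Rot 1\<close> is \<open>s_1 s_0\<close>, reversing a word negates the exponent,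
  and one more letter \<open>s_0\<close> at the end leads to the reflections.\<close>

lemma ex_wcode: "\<exists>u. set u \<subseteq> {0, 1} \<and> wcode u = g"
proof -
  have nat: "\<exists>u. set u \<subseteq> {0, 1} \<and> wcode u = Rot (int n)" for n
  proof (induction n)
    case 0
    show ?case by (rule exI[of _ "[]"]) simp
  next
    case (Suc n)
    then obtain u where "set u \<subseteq> {0, 1}" "wcode u = Rot (int n)" by auto
    then show ?case by (intro exI[of _ "1 # 0 # u"]) simp
  qed
  have rot: "\<exists>u. set u \<subseteq> {0, 1} \<and> wcode u = Rot k" for k
  proof (cases "k \<ge> 0")
    case True
    then show ?thesis using nat[of "nat k"] by simp
  next
    case False
    then obtain u where "set u \<subseteq> {0, 1} \<and> wcode u = Rot (- k)"
      using nat[of "nat (- k)"] by auto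
    then show ?thesis by (intro exI[of _ "rev u"]) (simp add: wcode_rev)
  qed
  show ?thesis
  proof (cases g)
    case (Rot k)
    then show ?thesis using rot by simp
  next
    case (Ref k)
    from rot[of k] obtain u where "set u \<subseteq> {0, 1} \<and> wcode u = Rot k" by auto
    then show ?thesis using Ref by (intro exI[of _ "u @ [0]"]) (simp add: wcode_append)
  qed
qed

text \<open>The word is obtained by choice from a map of the plane, so its integer code is known
  only modulo \<open>m\<close>.\<close>

lemma word_of_gmap:
  assumes "m > 0"
  shows "set (word_of m (gmap m g)) \<subseteq> {0, 1}" "gcong m (wcode (word_of m (gmap m g))) g"
proof -
  have "set (word_of m (gmap m g)) \<subseteq> {0, 1} \<and> word_value m (word_of m (gmap m g)) = gmap m g"
    unfolding word_of_def by (rule someI_ex) (metis ex_wcode word_value_eq_gmap)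
  then show "set (word_of m (gmap m g)) \<subseteq> {0, 1}" "gcong m (wcode (word_of m (gmap m g))) g"
    using assms by (simp_all add: word_value_eq_gmap gmap_eq_iff)
qed

lemma BijGroup_UNIV:
  "carrier (BijGroup UNIV) = {f. bij f}"
  "\<lbrakk>bij f; bij g\<rbrakk> \<Longrightarrow> f \<otimes>\<^bsub>BijGroup UNIV\<^esub> g = f \<circ> g"
  "\<one>\<^bsub>BijGroup UNIV\<^esub> = id"
  by (auto simp: BijGroup_def Bij_def compose_def restrict_def fun_eq_iff)

lemma bij_gmap: "bij (gmap m g)"
proof (rule o_bij)
  show "gmap m (ginv g) \<circ> gmap m g = id" "gmap m g \<circ> gmap m (ginv g) = id"
    by (simp_all add: gmap_one flip: gmap_gmul)
qed

lemma inv_BijGroup_gmap: "inv\<^bsub>BijGroup UNIV\<^esub> gmap m g = gmap m (ginv g)"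
proof -
  interpret group "BijGroup (UNIV :: (real^2) set)" by (rule group_BijGroup)
  show ?thesis
    by (rule inv_equality) (simp_all add: BijGroup_UNIV bij_gmap gmap_one flip: gmap_gmul)
qed

lemma generate_reflections: "generate (BijGroup UNIV) {plane_refl m 0, plane_refl m 1} = range (gmap m)"
proof (intro equalityI subsetI)
  fix f assume "f \<in> generate (BijGroup UNIV) {plane_refl m 0, plane_refl m 1}"
  then show "f \<in> range (gmap m)"
  proof induction
    case one
    then show ?case by (metis BijGroup_UNIV(3) gmap_one rangeI)
  next
    case (incl h)
    then show ?case by (auto simp: plane_refl_eq_gmap)
  next
    case (inv h)
    then show ?case by (auto simp: plane_refl_eq_gmap inv_BijGroup_gmap)
  next
    case (eng h1 h2)
    then show ?case by (auto simp: BijGroup_UNIV bij_gmap simp flip: gmap_gmul)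
  qed
next
  fix f assume "f \<in> range (gmap m)"
  then obtain u where u: "set u \<subseteq> {0, 1}" "f = gmap m (wcode u)"
    using ex_wcode by (metis imageE)
  from u(1) have "gmap m (wcode u) \<in> generate (BijGroup UNIV) {plane_refl m 0, plane_refl m 1}"
  proof (induction u)
    case Nil
    then show ?case by (metis BijGroup_UNIV(3) gmap_one generate.one wcode_simps(1))
  next
    case (Cons i u)
    have "plane_refl m i \<in> generate (BijGroup UNIV) {plane_refl m 0, plane_refl m 1}"
      using Cons.prems by (intro generate.incl) auto
    then have "plane_refl m i \<otimes>\<^bsub>BijGroup UNIV\<^esub> gmap m (wcode u)
      \<in> generate (BijGroup UNIV) {plane_refl m 0, plane_refl m 1}"
      using Cons by (intro generate.eng) auto
    then show ?case
      by (simp add: plane_refl_eq_gmap BijGroup_UNIV bij_gmap gmap_gmul del: o_apply)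
  qed
  with u show "f \<in> generate (BijGroup UNIV) {plane_refl m 0, plane_refl m 1}" by simp
qed

lemma dihedral_simps:
  "carrier (dihedral m) = range (gmap m)"
  "\<one>\<^bsub>dihedral m\<^esub> = gmap m (Rot 0)"
  "gmap m g \<otimes>\<^bsub>dihedral m\<^esub> gmap m h = gmap m (gmul g h)"
  by (simp_all add: dihedral_def generate_reflections[unfolded One_nat_def] BijGroup_UNIV gmap_one gmap_gmul bij_gmap)

lemma group_dihedral: "group (dihedral m)"
proof (rule groupI)
  fix x assume "x \<in> carrier (dihedral m)"
  then obtain g where "x = gmap m g" by (auto simp: dihedral_simps)
  then show "\<exists>y\<in>carrier (dihedral m). y \<otimes>\<^bsub>dihedral m\<^esub> x = \<one>\<^bsub>dihedral m\<^esub>"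
    by (intro bexI[of _ "gmap m (ginv g)"]) (auto simp: dihedral_simps)
qed (auto simp: dihedral_simps gmul_assoc)

lemma inv_dihedral: "inv\<^bsub>dihedral m\<^esub> gmap m g = gmap m (ginv g)"
proof -
  interpret group "dihedral m" by (rule group_dihedral)
  show ?thesis by (rule inv_equality) (simp_all add: dihedral_simps)
qed

section \<open>The regular representation\<close>

text \<open>\<open>Gi g\<close> labels the group element \<open>g\<close> and \<open>Ei k j\<close> the element \<open>r\<^sup>k e\<^sub>j\<close>, with \<open>r\<close> the
  rotation by \<open>2\<pi>/m\<close>. These span \<open>B\<close> since every coset of \<open>{1, s\<^sub>j}\<close> contains one rotation:
  \<open>s\<^sub>a e\<^sub>j = r\<^bsup>a-j\<^esup> e\<^sub>j\<close>. Vectors are coefficient functions, periodic modulo \<open>m = 2l\<close> in all indices.\<close>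

datatype idx = Gi gcode | Ei int int

text \<open>Left multiplication by \<open>g\<close> reads the coefficient at
  \<open>g^(-1) x\<close>. For a reflection
  \<open>s_a r^k' e_j = s_(a - k') e_j = r^(a - k' - j) e_j\<close>, so the coefficient at
  \<open>r^k e_j\<close> is taken from \<open>k' = a - k - j\<close>.\<close>

fun opG :: "gcode \<Rightarrow> (idx \<Rightarrow> complex) \<Rightarrow> idx \<Rightarrow> complex" where
  "opG g f (Gi h) = f (Gi (gmul (ginv g) h))"
| "opG (Rot a) f (Ei k j) = f (Ei (k - a) j)"
| "opG (Ref a) f (Ei k j) = f (Ei (a - k - j) j)"

lemma opG_gmul: "opG (gmul g h) f = opG g (opG h f)"
proof
  fix x show "opG (gmul g h) f x = opG g (opG h f) x"
  proof (cases x)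
    case (Gi k)
    then show ?thesis by (simp add: ginv_gmul gmul_assoc)
  next
    case (Ei k j)
    then show ?thesis by (cases g; cases h) (auto simp: algebra_simps)
  qed
qed

lemma opG_one [simp]: "opG (Rot 0) f = f"
proof
  fix x show "opG (Rot 0) f x = f x"
    by (cases x) auto
qed

lemma opG_linear [simp]:
  "opG g (f + h) = opG g f + opG g h" "opG g (fscale c f) = fscale c (opG g f)" "opG g 0 = 0"
proof -
  show "opG g (f + h) = opG g f + opG g h"
  proof
    fix x show "opG g (f + h) x = (opG g f + opG g h) x" by (cases x; cases g) auto
  qed
  show "opG g (fscale c f) = fscale c (opG g f)"
  proof
    fix x show "opG g (fscale c f) x = fscale c (opG g f) x"
      by (cases x; cases g) (auto simp: fscale_apply)
  qed
  show "opG g 0 = 0"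
  proof
    fix x show "opG g 0 x = 0 x" by (cases x; cases g) auto
  qed
qed

lemma dvd_cong: "(d::int) dvd a - b \<Longrightarrow> d dvd a \<longleftrightarrow> d dvd b"
  and dvd_cong_minus: "d dvd a + b \<Longrightarrow> d dvd a \<longleftrightarrow> d dvd b"
  using dvd_diff_right_iff[of d a b] dvd_diff_left_iff[of d b a] dvd_add_right_iff[of d a b] dvd_add_left_iff[of d b a]
  by metis+

text \<open>An injective map of the finite set of residues is a permutation, so it is enough that
  \<phi> is injective modulo \<open>m\<close>.\<close>

lemma sum_periodic_reindex:
  fixes m :: int and F :: "int \<Rightarrow> 'a::comm_monoid_add"
  assumes F: "\<And>a b. m dvd a - b \<Longrightarrow> F a = F b"
    and \<phi>: "\<And>a b. m dvd \<phi> a - \<phi> b \<Longrightarrow> m dvd a - b" and m: "m > 0"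
  shows "(\<Sum>k\<in>{0..<m}. F (\<phi> k)) = (\<Sum>k\<in>{0..<m}. F k)"
proof -
  have "inj_on (\<lambda>k. \<phi> k mod m) {0..<m}"
  proof (rule inj_onI)
    fix a b assume ab: "a \<in> {0..<m}" "b \<in> {0..<m}" "\<phi> a mod m = \<phi> b mod m"
    then have "m dvd \<phi> a - \<phi> b" by (metis mod_eq_dvd_iff)
    then have "a mod m = b mod m" using \<phi> by (metis mod_eq_dvd_iff)
    then show "a = b" using ab by simp
  qed
  moreover have "(\<lambda>k. \<phi> k mod m) ` {0..<m} \<subseteq> {0..<m}" using m by auto
  ultimately have "bij_betw (\<lambda>k. \<phi> k mod m) {0..<m} {0..<m}"
    by (simp add: bij_betw_def endo_inj_surj)
  then have "(\<Sum>k\<in>{0..<m}. F (\<phi> k mod m)) = (\<Sum>k\<in>{0..<m}. F k)"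
    by (rule sum.reindex_bij_betw)
  moreover have "F (\<phi> k mod m) = F (\<phi> k)" for k
    by (intro F) (metis mod_eq_dvd_iff mod_mod_trivial)
  ultimately show ?thesis by simp
qed

text \<open>Division by 2 leaves the condition \<open>L dvd k - t\<close>, which has two solutions
  modulo \<open>2 * L\<close>. They become the two terms on the right of the relation for
  \<open>e_i e_j\<close>.\<close>

lemma sum_two_torsion:
  fixes L :: int and F :: "int \<Rightarrow> 'a::comm_monoid_add"
  assumes F: "\<And>a b. 2 * L dvd a - b \<Longrightarrow> F a = F b" and L: "L > 0"
  shows "(\<Sum>k\<in>{0..<2 * L}. if 2 * L dvd 2 * k - 2 * t then F k else 0) = F t + F (t + L)"
proof -
  \<comment> \<open>After the shift by \<open>t\<close> the two solutions are \<open>0\<close> and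
    \<open>L\<close>, both within the range of summation.\<close>
  have "(\<Sum>k\<in>{0..<2 * L}. if 2 * L dvd 2 * k - 2 * t then F k else 0) =
    (\<Sum>k\<in>{0..<2 * L}. if 2 * L dvd 2 * (k + t) - 2 * t then F (k + t) else 0)"
    (is "_ = (\<Sum>k\<in>_. ?H (k + t))")
  proof (rule sum_periodic_reindex[symmetric])
    fix a b assume *: "2 * L dvd a - b"
    have "2 * L dvd 2 * a - 2 * t \<longleftrightarrow> 2 * L dvd 2 * b - 2 * t"
    proof (rule dvd_cong)
      have "2 * a - 2 * t - (2 * b - 2 * t) = 2 * (a - b)" by simp
      with * show "2 * L dvd 2 * a - 2 * t - (2 * b - 2 * t)" by (simp only: dvd_mult)
    qed
    then show "?H a = ?H b" using F[OF *] by simp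
  qed (use L in auto)
  also have "\<dots> = (\<Sum>k\<in>{0, L}. F (k + t))"
  proof (rule sum.mono_neutral_cong_right)
    show "\<forall>k\<in>{0..<2 * L} - {0, L}. (if 2 * L dvd 2 * (k + t) - 2 * t then F (k + t) else 0) = 0"
    proof
      fix k assume k: "k \<in> {0..<2 * L} - {0, L}"
      have "\<not> L dvd k"
      proof
        assume "L dvd k"
        then obtain c where c: "k = L * c" by (elim dvdE)
        have "0 \<le> c" "c < 2" using k c L by (auto simp: zero_le_mult_iff mult.commute)
        then have "c = 0 \<or> c = 1" by auto
        then show False using k c by auto
      qed
      then show "(if 2 * L dvd 2 * (k + t) - 2 * t then F (k + t) else 0) = 0" by simp
    qed
  qed (use L in auto)
  also have "\<dots> = F t + F (t + L)" using L by (simp add: add.commute)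
  finally show ?thesis .
qed

locale dihedral_brauer =
  fixes l :: nat and \<mu> \<tau> :: "nat \<Rightarrow> complex"
  assumes l_pos: "l \<ge> 1"
    and mu_parity: "\<And>i. \<mu> i = \<mu> (i mod 2)"
    and tau_parity: "\<And>i. \<tau> i = \<tau> (i mod 2)"
begin

abbreviation m :: int where "m \<equiv> 2 * int l"

definition mz :: "int \<Rightarrow> complex" where "mz k = \<mu> (nat (k mod 2))"
definition tz :: "int \<Rightarrow> complex" where "tz k = \<tau> (nat (k mod 2))"

lemma mz_of_nat: "\<mu> i = mz (int i)" and tz_of_nat: "\<tau> i = tz (int i)"
  using mu_parity[of i] tau_parity[of i] by (simp_all add: mz_def tz_def nat_mod_distrib)

lemma mz_cong: "even (a - b) \<Longrightarrow> mz a = mz b" and tz_cong: "even (a - b) \<Longrightarrow> tz a = tz b"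
  by (metis mz_def tz_def mod_eq_dvd_iff)+

definition periodic :: "(idx \<Rightarrow> complex) \<Rightarrow> bool"
  where "periodic f \<longleftrightarrow> (\<forall>a b. m dvd a - b \<longrightarrow>
    f (Gi (Rot a)) = f (Gi (Rot b)) \<and> f (Gi (Ref a)) = f (Gi (Ref b)) \<and>
    (\<forall>c. f (Ei a c) = f (Ei b c) \<and> f (Ei c a) = f (Ei c b)))"

lemma periodicD:
  assumes "periodic f" "m dvd a - b"
  shows "f (Gi (Rot a)) = f (Gi (Rot b))" "f (Gi (Ref a)) = f (Gi (Ref b))"
    "f (Ei a c) = f (Ei b c)" "f (Ei c a) = f (Ei c b)"
  using assms unfolding periodic_def by blast+

text \<open>Left multiplication by \<open>e_i\<close>, found from
  \<open>e_i r^k' = r^k' e_(i - 2k')\<close> and \<open>s_q e_j = r^(q - j) e_j\<close>. The group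
  elements that contribute to \<open>r^k e_j\<close> are the rotation and the reflection in its
  coset. A normal form \<open>r^k' e_j\<close> contributes with \<tau> if
  \<open>i - 2k' = j\<close>, and otherwise with \<mu> at the index \<open>q = k - k' + j\<close>,
  which has the parity of \<open>k + k' + j\<close>. The outer condition \<open>j + 2k = i\<close>
  holds for every result of such a product.\<close>

definition opE :: "int \<Rightarrow> (idx \<Rightarrow> complex) \<Rightarrow> idx \<Rightarrow> complex"
  where "opE i f x = (case x of Gi _ \<Rightarrow> 0 | Ei k j \<Rightarrow>
    if m dvd j + 2 * k - i then f (Gi (Rot k)) + f (Gi (Ref (k + j))) + tz i * f (Ei k j) +
      (\<Sum>k'\<in>{0..<m}. if m dvd j + 2 * k' - i then 0 else mz (k + k' + j) * f (Ei k' j))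
    else 0)"

lemma opE_Gi [simp]: "opE i f (Gi g) = 0"
  by (simp add: opE_def)

lemma opE_Ei: "opE i f (Ei k j) =
    (if m dvd j + 2 * k - i then f (Gi (Rot k)) + f (Gi (Ref (k + j))) + tz i * f (Ei k j) +
      (\<Sum>k'\<in>{0..<m}. if m dvd j + 2 * k' - i then 0 else mz (k + k' + j) * f (Ei k' j))
    else 0)"
  by (simp add: opE_def)

lemma opE_linear [simp]:
  "opE i (f + h) = opE i f + opE i h" "opE i (fscale c f) = fscale c (opE i f)" "opE i 0 = 0"
proof -
  show "opE i (f + h) = opE i f + opE i h"
  proof
    fix x show "opE i (f + h) x = (opE i f + opE i h) x"
      by (cases x) (auto simp: opE_Ei algebra_simps if_distrib sum.distrib[symmetric] intro!: sum.cong)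
  qed
  show "opE i (fscale c f) = fscale c (opE i f)"
  proof
    fix x show "opE i (fscale c f) x = fscale c (opE i f) x"
      by (cases x) (auto simp: opE_Ei fscale_apply algebra_simps sum_distrib_left intro!: sum.cong)
  qed
  show "opE i 0 = 0"
  proof
    fix x show "opE i 0 x = 0 x"
      by (cases x) (auto simp: opE_Ei cong: if_cong)
  qed
qed

lemma dvd_shift: "m dvd a - b \<Longrightarrow> m dvd c + a * n - d \<longleftrightarrow> m dvd c + b * n - d"
proof -
  assume "m dvd a - b"
  then have "m dvd (a - b) * n" by simp
  also have "(a - b) * n = (c + a * n - d) - (c + b * n - d)" by (simp add: algebra_simps)
  finally show ?thesis by (rule dvd_cong)
qed

lemma m_dvd_even: "m dvd a \<Longrightarrow> even a"
  by (meson dvd_mult_left dvd_trans dvd_triv_left)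

lemma periodic_opG:
  assumes f: "periodic f" shows "periodic (opG g f)"
  unfolding periodic_def
proof (intro allI impI)
  fix a b :: int assume ab: "m dvd a - b"
  then have *: "m dvd c + a - (c + b)" "m dvd a - c - (b - c)" "m dvd c - a - (c - b)"
    "m dvd c - a - d - (c - b - d)" "m dvd c - d - a - (c - d - b)" for c d
    by (simp_all add: dvd_diff_commute)
  show "opG g f (Gi (Rot a)) = opG g f (Gi (Rot b)) \<and> opG g f (Gi (Ref a)) = opG g f (Gi (Ref b)) \<and>
    (\<forall>c. opG g f (Ei a c) = opG g f (Ei b c) \<and> opG g f (Ei c a) = opG g f (Ei c b))"
  proof (cases g)
    case (Rot r)
    then show ?thesis
      using periodicD[OF f *(1), of "- r"] periodicD[OF f *(2), of r] periodicD[OF f ab] by simp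
  next
    case (Ref r)
    then show ?thesis
      using periodicD(1,2)[OF f *(3), of r] periodicD[OF f *(4), of r] periodicD[OF f *(5), of r] periodicD(4)[OF f ab]
      by simp
  qed
qed

lemma periodic_opE:
  assumes f: "periodic f" shows "periodic (opE i f)"
  unfolding periodic_def
proof (intro allI impI conjI)
  fix a b c :: int assume ab: "m dvd a - b"
  have e: "even (a - b)" using ab by (rule m_dvd_even)
  show "opE i f (Ei a c) = opE i f (Ei b c)"
  proof -
    have "mz (a + k' + c) = mz (b + k' + c)" for k' using e by (intro mz_cong) simp
    moreover have "m dvd c + 2 * a - i \<longleftrightarrow> m dvd c + 2 * b - i"
      using dvd_shift[OF ab, of c 2 i] by (simp add: mult.commute)
    moreover have "m dvd a + c - (b + c)" using ab by simp
    ultimately show ?thesis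
      using periodicD[OF f ab] periodicD(2)[OF f, of "a + c" "b + c"] by (simp add: opE_Ei cong: if_cong)
  qed
  show "opE i f (Ei c a) = opE i f (Ei c b)"
  proof -
    have "mz (c + k' + a) = mz (c + k' + b)" for k' using e by (intro mz_cong) simp
    moreover have "m dvd a + 2 * k' - i \<longleftrightarrow> m dvd b + 2 * k' - i" for k'
      using dvd_shift[OF ab, of "2 * k'" 1 i] by (simp add: add.commute)
    moreover have "m dvd c + a - (c + b)" using ab by simp
    ultimately show ?thesis
      using periodicD[OF f ab] periodicD(2)[OF f, of "c + a" "c + b"] by (simp add: opE_Ei cong: if_cong)
  qed
qed auto

text \<open>Periodic vectors see a code only modulo \<open>m\<close>; on them \<open>opG\<close> is
  an action of the finite group.\<close>

lemma opG_cong: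
  assumes "gcong (2 * l) g h" "periodic f"
  shows "opG g f = opG h f"
proof
  fix x
  show "opG g f x = opG h f x"
  proof (cases g; cases h)
    fix a b assume gh: "g = Rot a" "h = Rot b"
    then have ab: "m dvd a - b" using assms by simp
    then have *: "m dvd c - a - (c - b)" "m dvd - a + c - (- b + c)" for c
      by (simp_all add: dvd_diff_commute)
    show ?thesis
    proof (cases x)
      case (Gi k)
      then show ?thesis using gh periodicD(1,2)[OF assms(2) *(2)] by (cases k) auto
    next
      case (Ei k j)
      then show ?thesis using gh periodicD(3)[OF assms(2) *(1)] by auto
    qed
  next
    fix a b assume gh: "g = Ref a" "h = Ref b"
    then have ab: "m dvd a - b" using assms by simp
    then have *: "m dvd a - c - (b - c)" "m dvd a - c - d - (b - c - d)" for c d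
      by (simp_all add: dvd_diff_commute)
    show ?thesis
    proof (cases x)
      case (Gi k)
      then show ?thesis using gh periodicD(1,2)[OF assms(2) *(1)] by (cases k) auto
    next
      case (Ei k j)
      then show ?thesis using gh periodicD(3)[OF assms(2) *(2)] by auto
    qed
  qed (use assms in auto)
qed

lemma opE_cong:
  assumes "m dvd i - i'" shows "opE i f = opE i' f"
proof -
  have "tz i = tz i'" using m_dvd_even[OF assms] by (rule tz_cong)
  moreover have "m dvd a - i \<longleftrightarrow> m dvd a - i'" for a
    using dvd_shift[OF assms, of a "-1" 0] by simp
  ultimately show ?thesis by (intro ext) (simp add: opE_def cong: if_cong split: idx.split)
qed

text \<open>The conjugation relation. In the inner sum \<open>k'\<close> is replaced by
  \<open>k' - a\<close> or by \<open>a - k' - j\<close>; this permutes the residues and respects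
  both the divisibility condition and the parity of the index of \<mu>.\<close>

lemma opG_opE:
  assumes f: "periodic f"
  shows "opG g (opE i f) = opE (gact g i) (opG g f)"
proof
  fix x
  have P: "f (Ei a j) = f (Ei b j)" if "m dvd a - b" for a b j
    using periodicD(3)[OF f that] .
  have per: "(if m dvd j + 2 * a - i then 0 else mz (a + d) * f (Ei a j)) =
      (if m dvd j + 2 * b - i then 0 else mz (b + d) * f (Ei b j))" if "m dvd a - b" for a b d j
  proof -
    have "m dvd j + 2 * a - i \<longleftrightarrow> m dvd j + 2 * b - i"
      using dvd_shift[OF that, of j 2 i] by (simp add: mult.commute)
    moreover have "mz (a + d) = mz (b + d)"
      using m_dvd_even[OF that] by (intro mz_cong) simp
    ultimately show ?thesis using P[OF that] by simp
  qed
  show "opG g (opE i f) x = opE (gact g i) (opG g f) x"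
  proof (cases x)
    case (Ei k j)
    show ?thesis
    proof (cases g)
      case (Rot a)
      have t: "tz i = tz (i + 2 * a)" by (rule tz_cong) simp
      have c: "j + 2 * (k - a) - i = j + 2 * k - (i + 2 * a)" by simp
      have "(\<Sum>k'\<in>{0..<m}. if m dvd j + 2 * k' - i then 0 else mz (k' + (k - a + j)) * f (Ei k' j)) =
        (\<Sum>k'\<in>{0..<m}. if m dvd j + 2 * (k' - a) - i then 0 else mz (k' - a + (k - a + j)) * f (Ei (k' - a) j))"
        by (rule sum_periodic_reindex[symmetric, OF per]) (use l_pos in auto)
      also have "\<dots> = (\<Sum>k'\<in>{0..<m}. if m dvd j + 2 * k' - (i + 2 * a) then 0 else mz (k + k' + j) * f (Ei (k' - a) j))"
        by (intro sum.cong if_cong refl arg_cong2[where f = "(*)"] mz_cong) (auto simp: algebra_simps)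
      finally show ?thesis
        using Ei Rot t c by (simp add: opE_Ei algebra_simps cong: if_cong)
    next
      case (Ref a)
      have t: "tz i = tz (2 * a - i)" by (rule tz_cong) simp
      have c: "m dvd j + 2 * (a - k - j) - i \<longleftrightarrow> m dvd j + 2 * k - (2 * a - i)" for k
        by (rule dvd_cong_minus) simp
      have "(\<Sum>k'\<in>{0..<m}. if m dvd j + 2 * k' - i then 0 else mz (k' + (a - k)) * f (Ei k' j)) =
        (\<Sum>k'\<in>{0..<m}. if m dvd j + 2 * (a - k' - j) - i then 0 else mz (a - k' - j + (a - k)) * f (Ei (a - k' - j) j))"
        by (rule sum_periodic_reindex[symmetric, OF per]) (use l_pos in \<open>auto simp: dvd_diff_commute\<close>)
      also have "\<dots> = (\<Sum>k'\<in>{0..<m}. if m dvd j + 2 * k' - (2 * a - i) then 0 else mz (k + k' + j) * f (Ei (a - k' - j) j))"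
        by (intro sum.cong if_cong refl arg_cong2[where f = "(*)"] mz_cong c) auto
      finally show ?thesis
        using Ei Ref t c[of k] by (simp add: opE_Ei algebra_simps cong: if_cong)
    qed
  qed (cases g; simp)
qed

text \<open>On the support of \<open>opE i f\<close> one has \<open>j + 2 * k = i\<close> modulo
  \<open>m\<close>, so the reflected index \<open>i - k - j\<close> is \<open>k\<close>
  again.\<close>

lemma opG_Ref_opE:
  assumes f: "periodic f"
  shows "opG (Ref i) (opE i f) = opE i f"
proof
  fix x show "opG (Ref i) (opE i f) x = opE i f x"
  proof (cases x)
    case (Ei k j)
    have c: "m dvd j + 2 * (i - k - j) - i \<longleftrightarrow> m dvd j + 2 * k - i"
      by (rule dvd_cong_minus) simp
    show ?thesis
    proof (cases "m dvd j + 2 * k - i")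
      case True
      then have "m dvd (i - k - j) - k" by (subst dvd_minus_iff[symmetric]) (simp add: algebra_simps)
      from periodicD(3)[OF periodic_opE[OF f] this, of i j] Ei show ?thesis by simp
    next
      case False
      with c Ei show ?thesis by (simp add: opE_Ei)
    qed
  qed simp
qed

text \<open>A vector \<open>opE i f\<close> has no group part and is supported where the inner sum
  of \<open>opE i\<close> is cut out. Only the \<tau> term is left.\<close>

lemma opE_sq: "opE i (opE i f) = fscale (tz i) (opE i f)"
proof
  fix x show "opE i (opE i f) x = fscale (tz i) (opE i f) x"
  proof (cases x)
    case (Ei k j)
    have "(\<Sum>k'\<in>{0..<m}. if m dvd j + 2 * k' - i then 0 else mz (k + k' + j) * opE i f (Ei k' j)) = 0"
      by (intro sum.neutral) (simp add: opE_Ei)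
    then show ?thesis
      by (subst opE_def) (simp add: Ei fscale_apply, simp add: opE_Ei)
  qed (simp add: fscale_apply)
qed

lemma opE_odd:
  assumes "odd (i - j)" shows "opE i (opE j f) = 0"
proof
  fix x show "opE i (opE j f) x = 0 x"
  proof (cases x)
    case (Ei k b)
    have no: "opE j f (Ei k' b) = 0" if "m dvd b + 2 * k - i" for k'
    proof -
      have "\<not> m dvd b + 2 * k' - j"
        using m_dvd_even[OF that] m_dvd_even[of "b + 2 * k' - j"] assms by auto
      then show ?thesis by (simp add: opE_Ei)
    qed
    then show ?thesis by (subst opE_def) (simp add: Ei cong: if_cong)
  qed simp
qed

text \<open>In the inner sum only those \<open>k'\<close> count that meet the support of
  \<open>opE j f\<close>, that is \<open>b + 2 * k' = j\<close> modulo \<open>m\<close>. There are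
  two of them, \<open>t\<close> and \<open>t + l\<close>, and these are the places at which
  \<open>s_q\<close> and \<open>s_(q + l)\<close> read the vector.\<close>

lemma opE_opE:
  assumes f: "periodic f" and ij: "\<not> m dvd i - j" and q: "i + j = 2 * q"
  shows "opE i (opE j f) = fscale (mz q) (opG (Ref q) (opE j f)) +
    fscale (mz (q + int l)) (opG (Ref (q + int l)) (opE j f))"
proof
  fix x
  show "opE i (opE j f) x = (fscale (mz q) (opG (Ref q) (opE j f)) +
    fscale (mz (q + int l)) (opG (Ref (q + int l)) (opE j f))) x"
  proof (cases x)
    case (Ei k b)
    let ?h = "opE j f"
    have h: "?h (Ei a c) = (if m dvd c + 2 * a - j then ?h (Ei a c) else 0)" for a c
      by (simp add: opE_Ei)
    show ?thesis
    proof (cases "m dvd b + 2 * k - i")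
      case True
      define t where "t = q - k - b"
      define F where "F k' = mz (k + k' + b) * ?h (Ei k' b)" for k'
      have F: "F a = F c" if "m dvd a - c" for a c
        using periodicD(3)[OF periodic_opE[OF f] that] m_dvd_even[OF that]
        by (auto simp: F_def intro!: arg_cong2[where f = "(*)"] mz_cong)
      have not_both: "\<not> (m dvd b + 2 * k' - i \<and> m dvd b + 2 * k' - j)" for k'
      proof
        assume "m dvd b + 2 * k' - i \<and> m dvd b + 2 * k' - j"
        then have "m dvd (b + 2 * k' - j) - (b + 2 * k' - i)" using dvd_diff by blast
        with ij show False by simp
      qed
      have eqv: "m dvd b + 2 * k' - j \<longleftrightarrow> m dvd 2 * k' - 2 * t" for k'
      proof (rule dvd_cong)
        have "b + 2 * k' - j - (2 * k' - 2 * t) = - (b + 2 * k - i)"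
          using q by (simp add: t_def algebra_simps)
        then show "m dvd b + 2 * k' - j - (2 * k' - 2 * t)" using True by (simp only: dvd_minus_iff)
      qed
      \<comment> \<open>This is the \<tau> term; it vanishes because \<open>i\<close> and
        \<open>j\<close> differ modulo \<open>m\<close>.\<close>
      have "?h (Ei k b) = 0" using not_both[of k] True by (simp add: opE_Ei)
      moreover have "(\<Sum>k'\<in>{0..<m}. if m dvd b + 2 * k' - i then 0 else mz (k + k' + b) * ?h (Ei k' b)) =
        (\<Sum>k'\<in>{0..<m}. if m dvd 2 * k' - 2 * t then F k' else 0)"
      proof (intro sum.cong refl)
        fix k'
        show "(if m dvd b + 2 * k' - i then 0 else mz (k + k' + b) * ?h (Ei k' b)) =
          (if m dvd 2 * k' - 2 * t then F k' else 0)"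
          using not_both[of k'] h[of k' b] eqv[of k'] by (auto simp: F_def)
      qed
      moreover have "\<dots> = F t + F (t + int l)"
        using l_pos by (intro sum_two_torsion F) auto
      moreover have "F t = mz q * ?h (Ei t b)"
        by (simp add: F_def t_def)
      moreover have "F (t + int l) = mz (q + int l) * ?h (Ei (t + int l) b)"
        unfolding F_def t_def by (simp add: algebra_simps)
      ultimately show ?thesis
        using True by (subst opE_def) (simp add: Ei fscale_apply t_def algebra_simps)
    next
      case False
      \<comment> \<open>Outside the support of \<open>opE i\<close> the right side vanishes too,
        because conjugation by \<open>s_q\<close> and by \<open>s_(q + l)\<close> exchanges the
        indices \<open>i\<close> and \<open>j\<close>.\<close>
      have "\<not> m dvd b + 2 * (p - k - b) - j" if "p = q \<or> p = q + int l" for p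
      proof
        assume *: "m dvd b + 2 * (p - k - b) - j"
        have "b + 2 * k - i = - (b + 2 * (p - k - b) - j) + (2 * p - 2 * q)"
          using q by (simp add: algebra_simps)
        moreover have "m dvd 2 * p - 2 * q" using that by auto
        ultimately have "m dvd b + 2 * k - i" using * by (metis dvd_add dvd_minus_iff)
        with False show False ..
      qed
      from this[of q] this[of "q + int l"]
      have "?h (Ei (q - k - b) b) = 0" "?h (Ei (q + int l - k - b) b) = 0"
        by (simp_all only: opE_Ei if_False simp_thms)
      with False show ?thesis by (subst opE_def) (simp add: Ei fscale_apply)
    qed
  qed (simp add: fscale_apply)
qed

end

section \<open>The action of the free algebra, and the relations as identities of operators\<close>

declare plus_fun_apply [simp del] zero_fun_apply [simp del]

context dihedral_brauer
begin

primrec opL :: "gen list \<Rightarrow> (idx \<Rightarrow> complex) \<Rightarrow> idx \<Rightarrow> complex" where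
  "opL [] f = f"
| "opL (x # u) f = (case x of Gen_s i \<Rightarrow> opG (Ref (int i)) (opL u f) | Gen_e i \<Rightarrow> opE (int i) (opL u f))"

definition act :: "free_elem \<Rightarrow> (idx \<Rightarrow> complex) \<Rightarrow> idx \<Rightarrow> complex"
  where "act x f = (\<Sum>u\<in>Poly_Mapping.keys x. fscale (Poly_Mapping.lookup x u) (opL u f))"

lemma opL_append: "opL (u @ v) f = opL u (opL v f)"
  by (induction u) (auto split: gen.splits)

lemma opL_linear:
  "opL u (f + h) = opL u f + opL u h" "opL u (fscale c f) = fscale c (opL u f)" "opL u 0 = 0"
  by (induction u) (auto split: gen.splits)

lemma opL_sum: "opL u (sum f I) = (\<Sum>i\<in>I. opL u (f i))"
  by (induction I rule: infinite_finite_induct) (auto simp: opL_linear)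

lemma act_superset:
  assumes "finite U" "Poly_Mapping.keys x \<subseteq> U"
  shows "act x f = (\<Sum>u\<in>U. fscale (Poly_Mapping.lookup x u) (opL u f))"
  unfolding act_def using assms by (intro sum.mono_neutral_left) (auto simp: in_keys_iff)

lemma act_add_left: "act (x + y) f = act x f + act y f"
proof -
  let ?U = "Poly_Mapping.keys x \<union> Poly_Mapping.keys y"
  have "act z f = (\<Sum>u\<in>?U. fscale (Poly_Mapping.lookup z u) (opL u f))" if "z \<in> {x, y, x + y}" for z
    using that Poly_Mapping.keys_add[of x y] by (intro act_superset) auto
  then show ?thesis by (simp add: lookup_add fvs.scale_left_distrib sum.distrib)
qed

lemma act_single: "act (Poly_Mapping.single u c) f = fscale c (opL u f)"
  by (simp add: act_def)

lemma act_zero_left: "act 0 f = 0"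
  by (simp add: act_def)

lemma act_sum_left: "act (sum x I) f = (\<Sum>i\<in>I. act (x i) f)"
  by (induction I rule: infinite_finite_induct) (auto simp: act_add_left act_zero_left)

lemma act_linear:
  "act x (f + h) = act x f + act x h" "act x (fscale c f) = fscale c (act x f)" "act x 0 = 0"
  by (auto simp: act_def opL_linear fvs.scale_right_distrib sum.distrib fvs.scale_sum_right
      mult.commute)

lemma act_mult: "act (x * y) f = act x (act y f)"
proof -
  have "act (x * y) f = (\<Sum>u\<in>Poly_Mapping.keys x. \<Sum>v\<in>Poly_Mapping.keys y.
      fscale (Poly_Mapping.lookup x u * Poly_Mapping.lookup y v) (opL (u @ v) f))"
    by (subst sum_times_poly_mapping[symmetric]) (simp add: act_sum_left act_single plus_list_def)
  also have "\<dots> = act x (act y f)"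
    by (simp add: act_def opL_sum opL_linear opL_append fvs.scale_sum_right fvs.scale_scale)
  finally show ?thesis .
qed

lemma act_one: "act 1 f = f"
  by (simp add: act_single zero_list_def flip: single_one)

lemma act_scal: "act (scal c * x) f = fscale c (act x f)"
  by (simp add: act_mult act_single zero_list_def)

lemma act_diff_left: "act (x - y) f = act x f - act y f"
  using act_add_left[of "x - y" y f] by (simp add: eq_diff_eq)

lemma periodic_linear:
  "periodic 0" "periodic f \<Longrightarrow> periodic h \<Longrightarrow> periodic (f + h)" "periodic f \<Longrightarrow> periodic (fscale c f)"
  by (auto simp: periodic_def fscale_apply plus_fun_apply zero_fun_apply)

lemma periodic_opL: "periodic f \<Longrightarrow> periodic (opL u f)"
  by (induction u) (auto split: gen.splits intro: periodic_opG periodic_opE)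

lemma periodic_act: "periodic f \<Longrightarrow> periodic (act x f)"
proof -
  assume f: "periodic f"
  have "periodic (\<Sum>u\<in>U. fscale (Poly_Mapping.lookup x u) (opL u f))" for U
    by (induction U rule: infinite_finite_induct) (auto intro!: periodic_linear periodic_opL f)
  then show ?thesis by (simp add: act_def)
qed

lemma act_word: "act (free_word u) f = opG (wcode u) f"
proof -
  have "opL (map Gen_s u) f = opG (wcode u) f"
    by (induction u) (auto simp: opG_gmul)
  then show ?thesis by (simp add: free_word_def act_single)
qed

lemma act_grp: "periodic f \<Longrightarrow> act (free_grp l (gmap (2 * l) g)) f = opG g f"
  unfolding free_grp_def act_word using word_of_gmap[of "2 * l" g] l_pos by (intro opG_cong) auto

lemma act_refl: "periodic f \<Longrightarrow> act (free_refl l i) f = opG (Ref (int i)) f"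
  by (simp add: free_refl_def plane_refl_eq_gmap act_grp)

lemma act_e: "act (free_e i) f = opE (int i) f"
  by (simp add: free_e_def act_single)

lemma free_alg_pow: "x [^]\<^bsub>free_alg l\<^esub> n = x ^ n"
proof -
  interpret ring "free_alg l" by (rule ring_free_alg)
  show ?thesis by (induction n) (simp_all add: power_commutes)
qed

lemma free_elem_closed [simp, intro]:
  "set u \<subseteq> {0, 1} \<Longrightarrow> free_word u \<in> free_carrier l"
  "free_grp l (gmap (2 * l) g) \<in> free_carrier l"
  "free_refl l i \<in> free_carrier l"
  "i < 2 * l \<Longrightarrow> free_e i \<in> free_carrier l"
proof -
  show 1: "set u \<subseteq> {0, 1} \<Longrightarrow> free_word u \<in> free_carrier l" for u
    by (auto simp: free_word_def gens_def)
  show "free_grp l (gmap (2 * l) g) \<in> free_carrier l" for g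
    unfolding free_grp_def using word_of_gmap(1)[of "2 * l" g] l_pos by (intro 1) auto
  then show "free_refl l i \<in> free_carrier l"
    by (simp add: free_refl_def plane_refl_eq_gmap)
  show "i < 2 * l \<Longrightarrow> free_e i \<in> free_carrier l"
    by (auto simp: free_e_def gens_def)
qed

lemma free_carrier_pow [simp, intro]: "x \<in> free_carrier l \<Longrightarrow> x ^ n \<in> free_carrier l"
  by (induction n) auto

lemma conj_gmap_iff:
  "gmap (2 * l) g \<otimes>\<^bsub>dihedral (2 * l)\<^esub> plane_refl (2 * l) i \<otimes>\<^bsub>dihedral (2 * l)\<^esub> inv\<^bsub>dihedral (2 * l)\<^esub> gmap (2 * l) g
    = plane_refl (2 * l) j \<longleftrightarrow> m dvd gact g (int i) - int j"
  using l_pos by (simp add: plane_refl_eq_gmap inv_dihedral dihedral_simps gconj gmap_eq_iff)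

lemma rels_closed:
  assumes "(x, y) \<in> rels l \<mu> \<tau>"
  shows "x \<in> free_carrier l" "y \<in> free_carrier l"
  using assms
  by (cases; (auto simp: free_alg_pow dihedral_simps inv_dihedral; fail))+

lemma mod_less_eq: "\<lbrakk>i < 2 * l; j < 2 * l; i \<noteq> j\<rbrakk> \<Longrightarrow> \<not> m dvd int i - int j"
  using zdvd_not_zless[of "int i - int j" m] zdvd_not_zless[of "int j - int i" m]
  by (cases "i < j") (auto simp: dvd_diff_commute)

lemma act_pow: "act (x ^ n) f = (act x ^^ n) f"
  by (induction n) (auto simp: act_one act_mult)

text \<open>The relation has the residue \<open>k'\<close> in place of \<open>k + l\<close>. Both
  give the same reflection, and the same \<mu> since \<open>m\<close> is even.\<close>

lemma opE_opE_nat: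
  assumes f: "periodic f" and ij: "i < 2 * l" "j < 2 * l" "i \<noteq> j" "even (int i - int j)"
    and k: "k = (i + j) div 2" and k': "k' = (k + l) mod (2 * l)"
  shows "int i + int j = 2 * int k" "m dvd int k + int l - int k'"
    "opE (int i) (opE (int j) f) = fscale (mz (int k)) (opG (Ref (int k)) (opE (int j) f)) +
      fscale (mz (int k')) (opG (Ref (int k')) (opE (int j) f))"
proof -
  show 1: "int i + int j = 2 * int k" using ij(4) k by presburger
  show 2: "m dvd int k + int l - int k'" using k' by (simp add: mod_eq_dvd_iff[symmetric] zmod_int)
  have "gcong (2 * l) (Ref (int k + int l)) (Ref (int k'))" "mz (int k + int l) = mz (int k')"
    using 2 mz_cong[OF m_dvd_even[OF 2]] by simp_all
  then show "opE (int i) (opE (int j) f) = fscale (mz (int k)) (opG (Ref (int k)) (opE (int j) f)) +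
      fscale (mz (int k')) (opG (Ref (int k')) (opE (int j) f))"
    using opE_opE[OF f mod_less_eq[OF ij(1-3)] 1] opG_cong[OF _ periodic_opE[OF f]] by metis
qed

text \<open>Periodicity matters: on arbitrary functions the rotations have infinite order, and
  neither the braid relation nor independence of the chosen words would hold.\<close>

lemma act_rels:
  assumes "(x, y) \<in> rels l \<mu> \<tau>" and f: "periodic f"
  shows "act x f = act y f"
  using assms(1)
proof cases
  case s0_sq
  then show ?thesis by (simp add: act_mult act_word act_one flip: opG_gmul)
next
  case s1_sq
  then show ?thesis by (simp add: act_mult act_word act_one flip: opG_gmul)
next
  case braid
  have "(act (free_word [0] * free_word [1]) ^^ n) f = opG (Rot (- int n)) f" for n
    by (induction n) (simp_all add: act_mult act_word flip: opG_gmul)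
  then have "act x f = opG (Rot (- m)) f"
    using braid by (simp add: free_alg_pow act_pow)
  also have "\<dots> = opG (Rot 0) f"
    using f by (intro opG_cong) auto
  finally show ?thesis using braid by (simp add: act_one)
next
  case (s_e i)
  then show ?thesis using f by (simp add: act_mult act_e act_refl periodic_opE opG_Ref_opE)
next
  case (e_s i)
  \<comment> \<open>Conjugation by \<open>s_i\<close> fixes the index \<open>i\<close>, which
    reduces this relation to the preceding one.\<close>
  have "opE (int i) (opG (Ref (int i)) f) = opG (Ref (int i)) (opE (int i) f)"
    using opG_opE[OF f, of "Ref (int i)" "int i"] by simp
  then show ?thesis using e_s f by (simp add: act_mult act_e act_refl opG_Ref_opE)
next
  case (conj_e i j w)
  then obtain g where w: "w = gmap (2 * l) g" by (auto simp: dihedral_simps)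
  with conj_e have "m dvd gact g (int i) - int j" by (simp add: conj_gmap_iff)
  then have "opE (gact g (int i)) f = opE (int j) f" by (rule opE_cong)
  moreover have "opG g (opE (int i) (opG (ginv g) f)) = opE (gact g (int i)) f"
    using f by (simp add: opG_opE periodic_opG flip: opG_gmul)
  ultimately show ?thesis
    using conj_e w f by (simp add: act_mult act_e act_grp inv_dihedral periodic_opE periodic_opG)
next
  case (e_sq i)
  then show ?thesis by (simp add: act_mult act_e act_single opE_sq tz_of_nat zero_list_def)
next
  case (e_e_odd i j)
  then show ?thesis by (simp add: act_mult act_e opE_odd act_zero_left)
next
  case (e_e_even i j k k')
  then show ?thesis using opE_opE_nat(3)[OF f e_e_even(3-8)] f
    by (simp add: act_mult act_e act_refl act_add_left act_single zero_list_def mz_of_nat periodic_opE)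
qed

abbreviation J :: "free_elem set" where "J \<equiv> rel_ideal l \<mu> \<tau>"

lemma rels_minus:
  assumes "(x, y) \<in> rels l \<mu> \<tau>"
  shows "x \<ominus>\<^bsub>free_alg l\<^esub> y = x - y" "x - y \<in> free_carrier l"
  using rels_closed[OF assms] by auto

lemma rel_differences_closed:
  "{x \<ominus>\<^bsub>free_alg l\<^esub> y | x y. (x, y) \<in> rels l \<mu> \<tau>} \<subseteq> carrier (free_alg l)"
  by (auto simp: rels_minus)

lemma ideal_J: "ideal J (free_alg l)"
  unfolding rel_ideal_def by (rule ring.genideal_ideal[OF ring_free_alg rel_differences_closed])

sublocale free_quotient l J
  by (rule free_quotient.intro) (rule ideal_J)

lemma B_alg_eq: "B_alg l \<mu> \<tau> = Q" and B_class_eq: "B_class l \<mu> \<tau> = cls"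
  by (simp_all add: B_alg_def fun_eq_iff B_class_def cls_def)

text \<open>The periodic vectors form an invariant subspace, so their annihilator is a two-sided
  ideal; it contains all differences of related elements.\<close>

lemma act_J:
  assumes "x \<in> J" "periodic f"
  shows "act x f = 0"
proof -
  let ?K = "{x \<in> free_carrier l. \<forall>f. periodic f \<longrightarrow> act x f = 0}"
  interpret R: ring "free_alg l" by (rule ring_free_alg)
  have "ideal ?K (free_alg l)"
  proof (rule idealI)
    show "subgroup ?K (add_monoid (free_alg l))"
    proof (rule R.add.subgroupI)
      fix a assume "a \<in> ?K"
      then show "\<ominus>\<^bsub>free_alg l\<^esub> a \<in> ?K"
        using free_alg_minus[of 0 l a] act_diff_left[of 0 a]
        by (auto simp: R.minus_eq act_zero_left)
    qed (auto simp: act_add_left act_zero_left intro: exI[of _ 0])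
  qed (auto simp: act_mult act_linear periodic_act ring_free_alg)
  then have "J \<subseteq> ?K"
    unfolding rel_ideal_def
    by (rule R.genideal_minimal) (auto simp: rels_minus act_diff_left act_rels)
  with assms show ?thesis by auto
qed


section \<open>Congruence modulo the relations, and canonical words for group elements\<close>

definition eqv :: "free_elem \<Rightarrow> free_elem \<Rightarrow> bool" (infix "\<doteq>" 50)
  where "x \<doteq> y \<longleftrightarrow> x \<in> free_carrier l \<and> y \<in> free_carrier l \<and> x - y \<in> J"

lemma eqv_closed: "x \<doteq> y \<Longrightarrow> x \<in> free_carrier l" "x \<doteq> y \<Longrightarrow> y \<in> free_carrier l"
  by (simp_all add: eqv_def)

lemma eqv_refl [simp]: "x \<in> free_carrier l \<Longrightarrow> x \<doteq> x"
  by (simp add: eqv_def I_closed)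

lemma eqv_sym: "x \<doteq> y \<Longrightarrow> y \<doteq> x"
  unfolding eqv_def using I_minus[OF I_closed(1), of "x - y"] by auto

lemma eqv_trans [trans]: "x \<doteq> y \<Longrightarrow> y \<doteq> z \<Longrightarrow> x \<doteq> z"
  unfolding eqv_def using I_closed(2)[of "x - y" "y - z"] by auto

lemma eqv_add: "x \<doteq> y \<Longrightarrow> x' \<doteq> y' \<Longrightarrow> x + x' \<doteq> y + y'"
  unfolding eqv_def using I_closed(2)[of "x - y" "x' - y'"] by (auto simp: algebra_simps)

lemma eqv_mult: "x \<doteq> y \<Longrightarrow> x' \<doteq> y' \<Longrightarrow> x * x' \<doteq> y * y'"
  unfolding eqv_def using I_closed(2)[of "x * (x' - y')" "(x - y) * y'"]
    I_closed(3)[of "x - y" y'] I_closed(4)[of "x' - y'" x] by (auto simp: algebra_simps)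

lemma eqv_mult_left: "x' \<doteq> y' \<Longrightarrow> x \<in> free_carrier l \<Longrightarrow> x * x' \<doteq> x * y'"
  and eqv_mult_right: "x' \<doteq> y' \<Longrightarrow> x \<in> free_carrier l \<Longrightarrow> x' * x \<doteq> y' * x"
  by (simp_all add: eqv_mult)

lemma eqv_scal: "x \<doteq> y \<Longrightarrow> scal c * x \<doteq> scal c * y"
  by (simp add: eqv_mult)

lemma eqv_rels: "(x, y) \<in> rels l \<mu> \<tau> \<Longrightarrow> x \<doteq> y"
proof -
  assume xy: "(x, y) \<in> rels l \<mu> \<tau>"
  interpret R: ring "free_alg l" by (rule ring_free_alg)
  have "{x \<ominus>\<^bsub>free_alg l\<^esub> y | x y. (x, y) \<in> rels l \<mu> \<tau>} \<subseteq> J"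
    unfolding rel_ideal_def by (rule R.genideal_self[OF rel_differences_closed])
  moreover have "x - y \<in> {x \<ominus>\<^bsub>free_alg l\<^esub> y | x y. (x, y) \<in> rels l \<mu> \<tau>}"
    using xy rels_minus(1)[OF xy] by (intro CollectI exI[of _ x] exI[of _ y]) simp
  ultimately have "x - y \<in> J" by (rule subsetD)
  then show ?thesis using rels_closed[OF xy] by (simp add: eqv_def)
qed

lemma cls_eq_iff_eqv: "\<lbrakk>x \<in> free_carrier l; y \<in> free_carrier l\<rbrakk> \<Longrightarrow> cls x = cls y \<longleftrightarrow> x \<doteq> y"
  by (simp add: eqv_def cls_eq_iff)

lemma act_eqv: "x \<doteq> y \<Longrightarrow> periodic f \<Longrightarrow> act x f = act y f"
  using act_J[of "x - y" f] by (simp add: eqv_def act_diff_left)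

lemma free_word_append: "free_word (u @ v) = free_word u * free_word v"
  by (simp add: free_word_def mult_single plus_list_def)

lemma free_word_Nil [simp]: "free_word [] = 1"
  by (simp add: free_word_def zero_list_def flip: single_one)

lemma free_word_Cons: "free_word (i # u) = free_word [i] * free_word u"
  using free_word_append[of "[i]" u] by simp

abbreviation s0 where "s0 \<equiv> free_word [0]"
abbreviation s1 where "s1 \<equiv> free_word [1]"
abbreviation rot where "rot \<equiv> s1 * s0"
abbreviation rot_inv where "rot_inv \<equiv> s0 * s1"

lemma s0_s0: "s0 * s0 \<doteq> 1" and s1_s1: "s1 * s1 \<doteq> 1"
  using eqv_rels[OF rels.s0_sq] eqv_rels[OF rels.s1_sq] by simp_all

lemma rot_inv_pow_order: "rot_inv ^ (2 * l) \<doteq> 1"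
  using eqv_rels[OF rels.braid] by (simp add: free_alg_pow)

lemma rot_rot_inv: "rot * rot_inv \<doteq> 1"
proof -
  have "rot * rot_inv = s1 * ((s0 * s0) * s1)" by (simp add: mult.assoc)
  also have "\<dots> \<doteq> s1 * (1 * s1)" by (intro eqv_mult s0_s0 eqv_refl) auto
  also have "\<dots> = s1 * s1" by simp
  also have "\<dots> \<doteq> 1" by (rule s1_s1)
  finally show ?thesis .
qed

lemma rot_pow_inverse: "rot ^ n * rot_inv ^ n \<doteq> 1"
proof (induction n)
  case (Suc n)
  have "rot ^ Suc n * rot_inv ^ Suc n = rot * (rot ^ n * rot_inv ^ n) * rot_inv"
    by (subst power_Suc, subst power_Suc2) (simp add: mult.assoc)
  also have "\<dots> \<doteq> rot * 1 * rot_inv" by (intro eqv_mult Suc.IH eqv_refl) auto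
  also have "\<dots> = rot * rot_inv" by simp
  also have "\<dots> \<doteq> 1" by (rule rot_rot_inv)
  finally show ?case .
qed simp

lemma rot_pow_order: "rot ^ (2 * l) \<doteq> 1"
proof -
  have "rot ^ (2 * l) = rot ^ (2 * l) * 1" by simp
  also have "\<dots> \<doteq> rot ^ (2 * l) * rot_inv ^ (2 * l)"
    by (intro eqv_mult_left eqv_sym[OF rot_inv_pow_order]) auto
  also have "\<dots> \<doteq> 1" by (rule rot_pow_inverse)
  finally show ?thesis .
qed

lemma rot_inv_pow:
  assumes "n \<le> 2 * l" shows "rot_inv ^ n \<doteq> rot ^ (2 * l - n)"
proof -
  have "rot_inv ^ n = 1 * rot_inv ^ n" by simp
  also have "\<dots> \<doteq> rot ^ (2 * l) * rot_inv ^ n"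
    by (intro eqv_mult_right eqv_sym[OF rot_pow_order]) auto
  also have "rot ^ (2 * l) = rot ^ (2 * l - n) * rot ^ n"
    using assms by (simp flip: power_add)
  also have "\<dots> * rot_inv ^ n = rot ^ (2 * l - n) * (rot ^ n * rot_inv ^ n)" by (simp add: mult.assoc)
  also have "\<dots> \<doteq> rot ^ (2 * l - n) * 1" by (intro eqv_mult_left rot_pow_inverse) auto
  finally show ?thesis by simp
qed

lemma s0_rot_pow: "s0 * rot ^ n = rot_inv ^ n * s0"
proof (induction n)
  case (Suc n)
  have "s0 * rot ^ Suc n = rot_inv * (s0 * rot ^ n)" by (simp add: mult.assoc)
  also have "\<dots> = rot_inv ^ Suc n * s0" by (simp only: Suc.IH power_Suc mult.assoc)
  finally show ?case .
qed simp

text \<open>Reducing the exponent makes congruent codes yield the very same element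
  (\<open>can_cong\<close>), so periodicity in the index costs nothing later on.\<close>

fun can :: "gcode \<Rightarrow> free_elem" where
  "can (Rot k) = rot ^ nat (k mod m)"
| "can (Ref k) = rot ^ nat (k mod m) * s0"

lemma can_closed [simp, intro]: "can g \<in> free_carrier l"
  by (cases g) auto

lemma can_cong: "gcong (2 * l) g h \<Longrightarrow> can g = can h"
  by (cases g; cases h) (auto simp: mod_eq_dvd_iff[symmetric])

lemma can_one: "can (Rot 0) = 1"
  by simp

lemma rot_inv_pow_can: "rot_inv ^ nat (k mod m) \<doteq> can (Rot (- k))"
proof (cases "k mod m = 0")
  case True
  then have "(- k) mod m = 0" by (simp add: mod_eq_0_iff_dvd)
  with True show ?thesis by simp
next
  case False
  have "0 \<le> k mod m" "k mod m < m" using l_pos by auto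
  moreover have "(- k) mod m = m - k mod m"
    using False by (simp add: zmod_zminus1_eq_if)
  ultimately have "nat ((- k) mod m) = 2 * l - nat (k mod m)" "nat (k mod m) \<le> 2 * l"
    by linarith+
  then show ?thesis using rot_inv_pow[of "nat (k mod m)"] by simp
qed

lemma s0_can: "s0 * can g \<doteq> can (gmul (Ref 0) g)"
proof (cases g)
  case (Rot k)
  have "s0 * can g = rot_inv ^ nat (k mod m) * s0"
    by (simp only: Rot can.simps s0_rot_pow)
  also have "\<dots> \<doteq> can (Rot (- k)) * s0"
    by (intro eqv_mult_right rot_inv_pow_can) auto
  also have "\<dots> = can (gmul (Ref 0) g)" by (simp add: Rot)
  finally show ?thesis .
next
  case (Ref k)
  have "s0 * can g = (s0 * rot ^ nat (k mod m)) * s0"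
    by (simp add: Ref mult.assoc)
  also have "\<dots> = rot_inv ^ nat (k mod m) * (s0 * s0)"
    by (simp only: s0_rot_pow mult.assoc)
  also have "\<dots> \<doteq> can (Rot (- k)) * 1"
    by (intro eqv_mult rot_inv_pow_can s0_s0)
  also have "\<dots> = can (gmul (Ref 0) g)" by (simp add: Ref)
  finally show ?thesis .
qed

lemma rot_can: "rot * can g \<doteq> can (gmul (Rot 1) g)"
proof -
  have *: "rot * rot ^ nat (k mod m) \<doteq> rot ^ nat ((1 + k) mod m)" for k
  proof -
    have k: "0 \<le> k mod m" "k mod m < m" using l_pos by auto
    have e: "(1 + k) mod m = (k mod m + 1) mod m" by (simp add: mod_simps add.commute)
    show ?thesis
    proof (cases "k mod m + 1 = m")
      case True
      then have "(1 + k) mod m = 0" using e by simp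
      moreover have "rot * rot ^ nat (k mod m) = rot ^ (2 * l)"
      proof -
        have "Suc (nat (k mod m)) = 2 * l" using k True by linarith
        then show ?thesis by (metis power_Suc)
      qed
      ultimately show ?thesis using rot_pow_order by simp
    next
      case False
      then have "(1 + k) mod m = k mod m + 1" using k e by simp
      then have "nat ((1 + k) mod m) = Suc (nat (k mod m))" using k by simp
      then show ?thesis by simp
    qed
  qed
  show ?thesis
  proof (cases g)
    case (Rot k)
    then show ?thesis using *[of k] by simp
  next
    case (Ref k)
    have "rot * rot ^ nat (k mod m) * s0 \<doteq> rot ^ nat ((1 + k) mod m) * s0"
      by (intro eqv_mult_right *) auto
    then show ?thesis using Ref by (simp add: mult.assoc)
  qed
qed

text \<open>Inserting \<open>s0 * s0\<close> turns \<open>s1\<close> into \<open>rot * s0\<close>,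
  which leaves the two multiplications already known.\<close>

lemma s1_can: "s1 * can g \<doteq> can (gmul (Ref 1) g)"
proof -
  have "s1 * can g = s1 * (1 * can g)" by simp
  also have "\<dots> \<doteq> s1 * ((s0 * s0) * can g)"
    by (intro eqv_mult_left eqv_mult_right eqv_sym[OF s0_s0]) auto
  also have "\<dots> = rot * (s0 * can g)" by (simp add: mult.assoc)
  also have "\<dots> \<doteq> rot * can (gmul (Ref 0) g)"
    by (intro eqv_mult_left s0_can) auto
  also have "\<dots> \<doteq> can (gmul (Rot 1) (gmul (Ref 0) g))" by (rule rot_can)
  also have "gmul (Rot 1) (gmul (Ref 0) g) = gmul (Ref 1) g"
    by (simp flip: gmul_assoc)
  finally show ?thesis .
qed

lemma word_can: "set u \<subseteq> {0, 1} \<Longrightarrow> free_word u \<doteq> can (wcode u)"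
proof (induction u)
  case (Cons i u)
  have "free_word (i # u) = free_word [i] * free_word u" by (rule free_word_Cons)
  also have "\<dots> \<doteq> free_word [i] * can (wcode u)"
    using Cons by (intro eqv_mult_left) auto
  also have "\<dots> \<doteq> can (gmul (Ref (int i)) (wcode u))"
    using Cons.prems s0_can[of "wcode u"] s1_can[of "wcode u"] by auto
  finally show ?case by simp
qed simp

lemma grp_can: "free_grp l (gmap (2 * l) g) \<doteq> can g"
proof -
  have "free_grp l (gmap (2 * l) g) \<doteq> can (wcode (word_of (2 * l) (gmap (2 * l) g)))"
    unfolding free_grp_def using word_of_gmap(1) l_pos by (intro word_can) auto
  also have "\<dots> = can g"
    using l_pos by (intro can_cong word_of_gmap) auto
  finally show ?thesis .
qed

text \<open>Every code is the code of some word, and concatenation of words multiplies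
  codes.\<close>

lemma can_mult: "can g * can h \<doteq> can (gmul g h)"
proof -
  obtain u v where u: "set u \<subseteq> {0, 1}" "wcode u = g" and v: "set v \<subseteq> {0, 1}" "wcode v = h"
    using ex_wcode by metis
  have "can g * can h \<doteq> free_word u * free_word v"
    using eqv_sym[OF word_can[OF u(1)]] eqv_sym[OF word_can[OF v(1)]] u v by (intro eqv_mult) auto
  also have "\<dots> = free_word (u @ v)" by (simp add: free_word_append)
  also have "\<dots> \<doteq> can (wcode (u @ v))" using u v by (intro word_can) auto
  finally show ?thesis using u v by (simp add: wcode_append)
qed

definition ee :: "int \<Rightarrow> free_elem" where "ee i = free_e (nat (i mod m))"

lemma res_less: "nat (i mod m) < 2 * l"
  using l_pos by (simp add: nat_less_iff)

lemma res_cong: "m dvd int (nat (i mod m)) - i"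
  using l_pos by (simp add: mod_eq_dvd_iff[symmetric])

lemma ee_closed [simp, intro]: "ee i \<in> free_carrier l"
  unfolding ee_def using res_less by auto

lemma ee_of_nat: "i < 2 * l \<Longrightarrow> ee (int i) = free_e i"
  by (simp add: ee_def)

lemma gact_cong: "m dvd i - j \<Longrightarrow> m dvd gact g i - gact g j"
  by (cases g) (auto simp: dvd_diff_commute)

lemma can_conj_ee: "can g * ee i * can (ginv g) \<doteq> ee (gact g i)"
proof -
  define i' j' where "i' = nat (i mod m)" and "j' = nat (gact g i mod m)"
  have less: "i' < 2 * l" "j' < 2 * l" by (simp_all add: i'_def j'_def res_less)
  have "m dvd gact g (int i') - gact g i"
    unfolding i'_def by (intro gact_cong res_cong)
  moreover have "m dvd int j' - gact g i" unfolding j'_def by (rule res_cong)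
  ultimately have "m dvd (gact g (int i') - gact g i) - (int j' - gact g i)" by (rule dvd_diff)
  then have "m dvd gact g (int i') - int j'" by simp
  note eqv_rels[OF rels.conj_e[OF less _ conj_gmap_iff[THEN iffD2, OF this]]]
  then have "free_grp l (gmap (2 * l) g) * free_e i' * free_grp l (gmap (2 * l) (ginv g)) \<doteq> free_e j'"
    by (simp add: dihedral_simps inv_dihedral)
  moreover have "can g * free_e i' * can (ginv g) \<doteq>
    free_grp l (gmap (2 * l) g) * free_e i' * free_grp l (gmap (2 * l) (ginv g))"
    using less by (intro eqv_mult eqv_sym[OF grp_can] eqv_refl) auto
  ultimately show ?thesis
    unfolding ee_def i'_def j'_def by (metis eqv_trans)
qed

lemma ee_can: "ee i * can g \<doteq> can g * ee (gact (ginv g) i)"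
proof -
  let ?j = "gact (ginv g) i"
  have "gact g ?j = i" by (simp flip: gact_gmul)
  then have "ee i * can g \<doteq> can g * ee ?j * can (ginv g) * can g"
    using eqv_mult_right[OF eqv_sym[OF can_conj_ee[of g ?j]], of "can g"] by simp
  also have "\<dots> = can g * ee ?j * (can (ginv g) * can g)" by (simp add: mult.assoc)
  also have "\<dots> \<doteq> can g * ee ?j * 1"
    using can_mult[of "ginv g" g] by (intro eqv_mult_left) (auto simp: can_one simp del: can.simps)
  finally show ?thesis by simp
qed

lemma refl_can: "free_refl l i \<doteq> can (Ref (int i))"
  unfolding free_refl_def plane_refl_eq_gmap by (rule grp_can)

text \<open>Write \<open>s_a = r^(a - j) s_j\<close>; then \<open>e_j\<close> absorbs
  \<open>s_j\<close>.\<close>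

lemma can_Ref_ee: "can (Ref a) * ee j \<doteq> can (Rot (a - j)) * ee j"
proof -
  let ?j = "nat (j mod m)"
  have "can (Ref j) = can (Ref (int ?j))"
    using res_cong[of j] by (intro can_cong) (simp add: dvd_diff_commute)
  then have 1: "can (Ref j) * ee j \<doteq> free_refl l ?j * ee j"
    using eqv_sym[OF refl_can[of ?j]] by (intro eqv_mult_right) (simp_all del: can.simps)
  have 2: "free_refl l ?j * ee j \<doteq> ee j"
    using eqv_rels[OF rels.s_e[OF res_less]] by (simp add: ee_def)
  have "can (Ref a) * ee j \<doteq> (can (Rot (a - j)) * can (Ref j)) * ee j"
    using eqv_sym[OF can_mult[of "Rot (a - j)" "Ref j"]] by (intro eqv_mult_right) (simp_all del: can.simps)
  also have "\<dots> = can (Rot (a - j)) * (can (Ref j) * ee j)" by (simp add: mult.assoc del: can.simps)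
  also have "\<dots> \<doteq> can (Rot (a - j)) * ee j"
    using eqv_trans[OF 1 2] by (intro eqv_mult_left can_closed)
  finally show ?thesis .
qed

lemma can_ee_rot: "\<exists>k. can g * ee j \<doteq> can (Rot k) * ee j"
proof (cases g)
  case (Rot k)
  then show ?thesis by (intro exI[of _ k]) (simp del: can.simps)
next
  case (Ref a)
  then show ?thesis using can_Ref_ee by blast
qed

text \<open>For spanning only the shape of the product counts: at most two summands, each a group
  element times \<open>e_j\<close> up to a scalar.\<close>

lemma ee_ee_cases:
  obtains (same) c where "ee i * ee j \<doteq> scal c * ee j"
  | (diff) c g d h where "ee i * ee j \<doteq> scal c * (can g * ee j) + scal d * (can h * ee j)"
proof -
  let ?i = "nat (i mod m)" and ?j = "nat (j mod m)"
  consider "?i = ?j" | "odd (int ?i - int ?j)" | "?i \<noteq> ?j" "even (int ?i - int ?j)" by blast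
  then show ?thesis
  proof cases
    case 1
    then have "ee i * ee j \<doteq> scal (\<tau> ?j) * ee j"
      using eqv_rels[OF rels.e_sq[OF res_less]] by (simp add: ee_def)
    then show ?thesis by (rule same)
  next
    case 2
    then have "ee i * ee j \<doteq> scal 0 * ee j"
      using eqv_rels[OF rels.e_e_odd[OF res_less res_less]] by (simp add: ee_def)
    then show ?thesis by (rule same)
  next
    case 3
    define k k' where "k = (?i + ?j) div 2" and "k' = (k + l) mod (2 * l)"
    have "ee i * ee j \<doteq> (scal (\<mu> k) * free_refl l k + scal (\<mu> k') * free_refl l k') * ee j"
      using eqv_rels[OF rels.e_e_even[OF res_less res_less 3 k_def k'_def]] by (simp add: ee_def)
    also have "\<dots> \<doteq> (scal (\<mu> k) * can (Ref (int k)) + scal (\<mu> k') * can (Ref (int k'))) * ee j"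
      by (intro eqv_mult_right eqv_add eqv_scal refl_can) auto
    also have "\<dots> = scal (\<mu> k) * (can (Ref (int k)) * ee j) + scal (\<mu> k') * (can (Ref (int k')) * ee j)"
      by (simp add: distrib_right mult.assoc del: can.simps)
    finally show ?thesis by (rule diff)
  qed
qed

section \<open>Normal forms: independence and spanning\<close>

definition unit :: "idx \<Rightarrow> complex"
  where "unit x = (case x of Gi (Rot a) \<Rightarrow> of_bool (m dvd a) | _ \<Rightarrow> 0)"

lemma unit_simps [simp]: "unit (Gi (Rot a)) = of_bool (m dvd a)" "unit (Gi (Ref a)) = 0" "unit (Ei k j) = 0"
  by (simp_all add: unit_def)

lemma periodic_unit [simp]: "periodic unit"
  by (auto simp: periodic_def dest: dvd_cong)

definition idx_reps :: "idx set"
  where "idx_reps = (\<lambda>k. Gi (Rot k)) ` {0..<m} \<union> (\<lambda>k. Gi (Ref k)) ` {0..<m} \<union>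
    (\<lambda>(k, j). Ei k j) ` ({0..<m} \<times> {0..<m})"

fun bas :: "idx \<Rightarrow> free_elem" where
  "bas (Gi g) = can g"
| "bas (Ei k j) = can (Rot k) * ee j"

lemma finite_idx_reps [simp]: "finite idx_reps"
  by (simp add: idx_reps_def)

lemma bas_closed [simp, intro]: "bas x \<in> free_carrier l"
  by (cases x) (auto simp del: can.simps)

lemma bas_rep: "\<exists>y\<in>idx_reps. bas x = bas y"
proof (cases x)
  case (Gi g)
  show ?thesis
  proof (cases g)
    case (Rot k)
    then show ?thesis using Gi l_pos
      by (intro bexI[of _ "Gi (Rot (k mod m))"]) (auto simp: idx_reps_def)
  next
    case (Ref k)
    then show ?thesis using Gi l_pos
      by (intro bexI[of _ "Gi (Ref (k mod m))"]) (auto simp: idx_reps_def)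
  qed
next
  case (Ei k j)
  have "ee j = ee (j mod m)" by (simp add: ee_def)
  then show ?thesis using Ei l_pos
    by (intro bexI[of _ "Ei (k mod m) (j mod m)"]) (auto simp: idx_reps_def)
qed

lemma act_can: "periodic f \<Longrightarrow> act (can g) f = opG g f"
  using act_eqv[OF grp_can, of f g] by (simp add: act_grp)

lemma act_ee: "act (ee i) f = opE i f"
  unfolding ee_def act_e by (intro opE_cong res_cong)

lemma dvd_range: "a \<in> {0..<m} \<Longrightarrow> b \<in> {0..<m} \<Longrightarrow> m dvd a - b \<longleftrightarrow> a = b"
  by (metis atLeastLessThan_iff mod_eq_dvd_iff mod_pos_pos_trivial)

lemma opE_unit: "opE j unit (Ei k i) = of_bool (m dvd k \<and> m dvd i - j)"
proof -
  have "m dvd k \<Longrightarrow> m dvd i + 2 * k - j \<longleftrightarrow> m dvd i - j"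
    by (rule dvd_cong) (metis add_diff_cancel_right' add_diff_eq diff_diff_eq2 dvd_mult add.commute)
  then show ?thesis by (auto simp: opE_Ei cong: if_cong)
qed

text \<open>This is the independence of the normal forms: evaluation at the unit turns them into
  indicators of distinct indices.\<close>

lemma act_bas:
  assumes "x \<in> idx_reps" "y \<in> idx_reps"
  shows "act (bas x) unit y = of_bool (x = y)"
proof -
  have R: "m dvd b - a \<longleftrightarrow> a = b" if "0 \<le> a" "a < m" "0 \<le> b" "b < m" for a b
    using dvd_range[of b a] that by auto
  show ?thesis
    using assms
    by (auto simp: idx_reps_def act_mult act_can act_ee opE_unit periodic_opE R simp del: can.simps)
qed

definition NF :: "(idx \<Rightarrow> complex) \<Rightarrow> free_elem"
  where "NF f = (\<Sum>x\<in>idx_reps. scal (f x) * bas x)"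

lemma NF_linear: "NF (f + h) = NF f + NF h" "NF (fscale c f) = scal c * NF f" "NF 0 = 0"
  by (simp_all add: NF_def plus_fun_apply zero_fun_apply fscale_apply single_add distrib_right
      sum.distrib sum_distrib_left mult_single flip: mult.assoc)

lemma NF_closed [simp, intro]: "NF f \<in> free_carrier l"
  unfolding NF_def by (intro free_carrier_sum) auto

text \<open>Spanning with the coefficients already named: by \<open>act_bas\<close> they can only be
  the values of \<open>act x unit\<close>.\<close>

definition spanned :: "free_elem \<Rightarrow> bool" where "spanned x \<longleftrightarrow> x \<doteq> NF (act x unit)"

lemma spanned_eqv: "x \<doteq> y \<Longrightarrow> spanned y \<Longrightarrow> spanned x"
  unfolding spanned_def using act_eqv[of x y unit] by (auto intro: eqv_trans)

lemma spanned_linear: "spanned 0" "spanned x \<Longrightarrow> spanned y \<Longrightarrow> spanned (x + y)"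
  "spanned x \<Longrightarrow> spanned (scal c * x)"
  by (auto simp: spanned_def act_add_left act_scal act_zero_left NF_linear intro: eqv_add eqv_scal)

lemma spanned_sum: "(\<And>i. i \<in> I \<Longrightarrow> spanned (f i)) \<Longrightarrow> spanned (sum f I)"
  by (induction I rule: infinite_finite_induct) (auto intro: spanned_linear)

lemma spanned_bas: "spanned (bas x)"
proof -
  obtain y where y: "y \<in> idx_reps" "bas x = bas y" using bas_rep by blast
  have "NF (act (bas y) unit) = (\<Sum>z\<in>idx_reps. if z = y then bas y else 0)"
    unfolding NF_def using y by (intro sum.cong) (auto simp: act_bas)
  also have "\<dots> = bas y" using y by simp
  finally show ?thesis using y by (simp add: spanned_def)
qed

lemma spanned_can_ee: "spanned (can g * ee j)"
  using can_ee_rot[of g j] spanned_bas[of "Ei _ j"] spanned_eqv by (metis bas.simps(2))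

text \<open>A letter \<open>s_i\<close> is absorbed by the group part. A letter \<open>e_i\<close>
  moves right past the group part; there it either stands last or meets \<open>e_j\<close>, and
  their product is known from \<open>ee_ee_cases\<close>.\<close>

lemma spanned_gen_bas:
  assumes "g \<in> gens l"
  shows "spanned (Poly_Mapping.single [g] 1 * bas x)"
proof -
  consider i where "i \<in> {0, 1}" "g = Gen_s i" | i where "i < 2 * l" "g = Gen_e i"
    using assms by (auto simp: gens_def)
  then show ?thesis
  proof cases
    case (1 i)
    then have g: "Poly_Mapping.single [g] 1 \<doteq> can (Ref (int i))"
      using word_can[of "[i]"] by (auto simp: free_word_def simp del: can.simps)
    show ?thesis
    proof (cases x)
      case (Gi h)
      then show ?thesis
        using eqv_trans[OF eqv_mult_right[OF g can_closed] can_mult] spanned_bas[of "Gi _"]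
        by (auto intro: spanned_eqv simp del: can.simps)
    next
      case (Ei k j)
      have "Poly_Mapping.single [g] 1 * bas x \<doteq> can (Ref (int i)) * bas x"
        using g by (rule eqv_mult_right) auto
      also have "\<dots> = can (Ref (int i)) * can (Rot k) * ee j"
        by (simp add: Ei mult.assoc del: can.simps)
      also have "\<dots> \<doteq> can (gmul (Ref (int i)) (Rot k)) * ee j"
        by (intro eqv_mult_right can_mult) auto
      finally show ?thesis using spanned_can_ee by (rule spanned_eqv)
    qed
  next
    case (2 i)
    then have g: "Poly_Mapping.single [g] 1 = ee (int i)"
      by (simp add: ee_of_nat free_e_def)
    show ?thesis
    proof (cases x)
      case (Gi h)
      then show ?thesis
        using ee_can[of "int i" h] spanned_can_ee by (auto simp: g intro: spanned_eqv simp del: can.simps)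
    next
      case (Ei k j)
      let ?i = "gact (ginv (Rot k)) (int i)"
      have "Poly_Mapping.single [g] 1 * bas x = (ee (int i) * can (Rot k)) * ee j"
        by (simp add: g Ei mult.assoc del: can.simps)
      also have "\<dots> \<doteq> (can (Rot k) * ee ?i) * ee j"
        by (intro eqv_mult_right ee_can) auto
      also have "\<dots> = can (Rot k) * (ee ?i * ee j)" by (simp add: mult.assoc del: can.simps)
      finally have *: "Poly_Mapping.single [g] 1 * bas x \<doteq> can (Rot k) * (ee ?i * ee j)" .
      have comm: "can (Rot k) * (scal c * y) = scal c * (can (Rot k) * y)" for c y
        by (metis mult.assoc single_zero_commute)
      have "spanned (can (Rot k) * (ee ?i * ee j))"
      proof (cases rule: ee_ee_cases[of ?i j])
        case (same c)
        have "spanned (scal c * (can (Rot k) * ee j))"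
          by (intro spanned_linear spanned_can_ee)
        then show ?thesis
          using eqv_mult_left[OF same, of "can (Rot k)"] by (auto simp: comm intro: spanned_eqv simp del: can.simps)
      next
        case (diff c g d h)
        have sp: "spanned (can (Rot k) * (can g * ee j))" for g
          using eqv_mult_right[OF can_mult[of "Rot k" g], of "ee j"] spanned_can_ee
          by (auto simp: mult.assoc intro: spanned_eqv simp del: can.simps)
        have "spanned (scal c * (can (Rot k) * (can g * ee j)) + scal d * (can (Rot k) * (can h * ee j)))"
          by (intro spanned_linear sp)
        then show ?thesis
          using eqv_mult_left[OF diff, of "can (Rot k)"]
          by (auto simp: comm distrib_left intro: spanned_eqv simp del: can.simps)
      qed
      with * show ?thesis by (rule spanned_eqv)
    qed
  qed
qed

lemma spanned_free:
  assumes "x \<in> free_carrier l" shows "spanned x"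
  using assms
proof (induction rule: free_carrier_induct)
  case (gen g)
  have "spanned (Poly_Mapping.single [g] 1 * bas (Gi (Rot 0)))"
    using gen by (rule spanned_gen_bas)
  then show ?case by simp
next
  case one
  then show ?case using spanned_bas[of "Gi (Rot 0)"] by simp
next
  case (mult g x)
  have "Poly_Mapping.single [g] 1 * x \<doteq> Poly_Mapping.single [g] 1 * NF (act x unit)"
    using mult by (intro eqv_mult_left) (auto simp: spanned_def)
  also have "\<dots> = (\<Sum>y\<in>idx_reps. scal (act x unit y) * (Poly_Mapping.single [g] 1 * bas y))"
    unfolding NF_def sum_distrib_left
    by (intro sum.cong refl) (metis mult.assoc single_zero_commute)
  finally show ?case
    by (rule spanned_eqv) (intro spanned_sum spanned_linear spanned_gen_bas mult.hyps)
qed (auto intro: spanned_linear)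

text \<open>Elements with the same coefficients have the same normal form. From here on, identities
  in \<open>B\<close> are computed with operators on \<open>unit\<close>.\<close>

lemma eqv_iff_act:
  assumes "x \<in> free_carrier l" "y \<in> free_carrier l"
  shows "x \<doteq> y \<longleftrightarrow> act x unit = act y unit"
proof
  assume "act x unit = act y unit"
  then show "x \<doteq> y"
    using spanned_free[OF assms(1)] spanned_free[OF assms(2)] by (metis eqv_sym eqv_trans spanned_def)
qed (simp add: act_eqv)

end

section \<open>The anti-involution as reversal of words\<close>

definition frev :: "free_elem \<Rightarrow> free_elem"
  where "frev x = (\<Sum>u\<in>Poly_Mapping.keys x. Poly_Mapping.single (rev u) (Poly_Mapping.lookup x u))"

lemma rev_zero_list [simp]: "rev 0 = 0"
  by (simp add: zero_list_def)

lemma frev_superset: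
  assumes "finite U" "Poly_Mapping.keys x \<subseteq> U"
  shows "frev x = (\<Sum>u\<in>U. Poly_Mapping.single (rev u) (Poly_Mapping.lookup x u))"
  unfolding frev_def using assms by (intro sum.mono_neutral_left) (auto simp: in_keys_iff)

lemma frev_single [simp]: "frev (Poly_Mapping.single u c) = Poly_Mapping.single (rev u) c"
  by (simp add: frev_def)

lemma frev_add [simp]: "frev (x + y) = frev x + frev y"
proof -
  let ?U = "Poly_Mapping.keys x \<union> Poly_Mapping.keys y"
  have "frev z = (\<Sum>u\<in>?U. Poly_Mapping.single (rev u) (Poly_Mapping.lookup z u))" if "z \<in> {x, y, x + y}" for z
    using that Poly_Mapping.keys_add[of x y] by (intro frev_superset) auto
  then show ?thesis by (simp add: lookup_add single_add sum.distrib)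
qed

lemma frev_zero [simp]: "frev 0 = 0"
  by (simp add: frev_def)

lemma frev_diff [simp]: "frev (x - y) = frev x - frev y"
  using frev_add[of "x - y" y] by (simp add: eq_diff_eq del: frev_add)

lemma frev_sum: "frev (sum x I) = (\<Sum>i\<in>I. frev (x i))"
  by (induction I rule: infinite_finite_induct) auto

lemma frev_mult [simp]: "frev (x * y) = frev y * frev x"
proof -
  have "frev (x * y) = (\<Sum>u\<in>Poly_Mapping.keys x. \<Sum>v\<in>Poly_Mapping.keys y.
      Poly_Mapping.single (rev v + rev u) (Poly_Mapping.lookup x u * Poly_Mapping.lookup y v))"
    by (subst sum_times_poly_mapping[symmetric]) (simp add: frev_sum plus_list_def)
  also have "\<dots> = (\<Sum>v\<in>Poly_Mapping.keys y. \<Sum>u\<in>Poly_Mapping.keys x.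
      Poly_Mapping.single (rev v) (Poly_Mapping.lookup y v) * Poly_Mapping.single (rev u) (Poly_Mapping.lookup x u))"
    by (subst sum.swap) (simp add: mult_single mult.commute)
  also have "\<dots> = frev y * frev x" by (simp add: frev_def sum_product)
  finally show ?thesis .
qed

lemma frev_one [simp]: "frev 1 = 1"
  using frev_single[of "[]" 1] by (simp add: zero_list_def flip: single_one)

lemma frev_frev [simp]: "frev (frev x) = x"
  by (subst (2) frev_def) (simp add: frev_sum poly_mapping_sum_single)

lemma frev_closed [simp, intro]: "x \<in> free_carrier l \<Longrightarrow> frev x \<in> free_carrier l"
proof -
  assume "x \<in> free_carrier l"
  then have "set u \<subseteq> gens l" if "u \<in> Poly_Mapping.keys x" for u
    using that by (auto simp: free_carrier_def)
  then show ?thesis unfolding frev_def by (intro free_carrier_sum) simp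
qed

lemma frev_word [simp]: "frev (free_word u) = free_word (rev u)"
  by (simp add: free_word_def rev_map)

lemma frev_e [simp]: "frev (free_e i) = free_e i"
  by (simp add: free_e_def)

lemma frev_pow: "frev (x ^ n) = frev x ^ n"
  by (induction n) (simp_all add: power_commutes)

lemma gcong_ginv: "gcong n g h \<Longrightarrow> gcong n (ginv g) (ginv h)"
  by (cases g; cases h) (auto simp: dvd_diff_commute)

context dihedral_brauer
begin

lemma act_frev_grp: "periodic f \<Longrightarrow> act (frev (free_grp l (gmap (2 * l) g))) f = opG (ginv g) f"
  unfolding free_grp_def frev_word act_word wcode_rev
  using word_of_gmap[of "2 * l" g] l_pos by (intro opG_cong gcong_ginv) auto

lemma act_frev_refl: "periodic f \<Longrightarrow> act (frev (free_refl l i)) f = opG (Ref (int i)) f"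
  by (simp add: free_refl_def plane_refl_eq_gmap act_frev_grp)

lemma opE_opG: "periodic f \<Longrightarrow> opE i (opG g f) = opG g (opE (gact (ginv g) i) f)"
  by (simp add: opG_opE flip: gact_gmul)

lemma act_frev_rels:
  assumes "(x, y) \<in> rels l \<mu> \<tau>" and f: "periodic f"
  shows "act (frev x) f = act (frev y) f"
  using assms(1)
proof cases
  case braid
  have "(act (free_word [1] * free_word [0]) ^^ n) f = opG (Rot (int n)) f" for n
    by (induction n) (simp_all add: act_mult act_word flip: opG_gmul)
  then have "act (frev x) f = opG (Rot m) f"
    using braid by (simp add: free_alg_pow act_pow frev_pow)
  also have "\<dots> = opG (Rot 0) f"
    using f by (intro opG_cong) auto
  finally show ?thesis using braid by (simp add: act_one)
next
  case (s_e i)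
  then show ?thesis
    using f by (simp add: act_mult act_e act_frev_refl opE_opG opG_Ref_opE)
next
  case (e_s i)
  then show ?thesis
    using f by (simp add: act_mult act_e act_frev_refl periodic_opE opG_Ref_opE)
next
  case (conj_e i j w)
  then obtain g where w: "w = gmap (2 * l) g" by (auto simp: dihedral_simps)
  with conj_e have "m dvd gact g (int i) - int j" by (simp add: conj_gmap_iff)
  then have "opE (gact g (int i)) f = opE (int j) f" by (rule opE_cong)
  then show ?thesis
    using conj_e w f
    by (simp add: act_mult act_e act_frev_grp inv_dihedral periodic_opE periodic_opG opE_opG flip: opG_gmul)
next
  case (e_sq i)
  then show ?thesis
    by (simp add: act_mult act_e act_single opE_sq tz_of_nat zero_list_def)
next
  case (e_e_odd i j)
  then have "odd (int j - int i)" by auto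
  with e_e_odd show ?thesis by (simp add: act_mult act_e opE_odd act_zero_left)
next
  \<comment> \<open>Reversed, the right side is \<open>e_j\<close> times a combination of
    \<open>s_k\<close> and \<open>s_k'\<close>. Moving \<open>e_j\<close> across either reflection
    changes it into \<open>e_i\<close>, as \<open>2 * k - j = i\<close> and \<open>2 * k'\<close>
    agrees with \<open>2 * k\<close> modulo \<open>m\<close>. What results is the relation for the
    pair \<open>(j, i)\<close>.\<close>
  case (e_e_even i j k k')
  have ji: "j \<noteq> i" "even (int j - int i)" "k = (j + i) div 2" using e_e_even by (auto simp: add.commute)
  note nat = opE_opE_nat[OF f e_e_even(4,3) ji e_e_even(8)]
  note k = nat(1) and * = nat(2)
  have "m dvd 2 * (int k + int l - int k')" using * by (rule dvd_mult)
  moreover have "gact (Ref (int k')) (int j) - int i = m - 2 * (int k + int l - int k')"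
    using k by simp
  ultimately have "m dvd gact (Ref (int k')) (int j) - int i"
    by (simp only: dvd_diff dvd_refl)
  then have 2: "opE (int j) (opG (Ref (int k')) f) = opG (Ref (int k')) (opE (int i) f)"
    using opE_opG[OF f, of "int j" "Ref (int k')"] opE_cong[of "gact (Ref (int k')) (int j)" "int i" f] by simp
  have "gact (Ref (int k)) (int j) = int i" using k by simp
  then have 1: "opE (int j) (opG (Ref (int k)) f) = opG (Ref (int k)) (opE (int i) f)"
    using opE_opG[OF f, of "int j" "Ref (int k)"] by simp
  from nat(3) show ?thesis using e_e_even f 1 2
    by (simp add: act_mult act_e act_frev_refl act_add_left act_single zero_list_def mz_of_nat periodic_opE periodic_linear distrib_left)
qed (simp_all add: act_mult act_word act_one flip: opG_gmul)

text \<open>The elements whose reversal lies in \<open>J\<close> form an ideal. It contains the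
  relations because acting equally on the unit already implies congruence, so no reversed relation
  has to be derived by rewriting.\<close>

lemma frev_J: "x \<in> J \<Longrightarrow> frev x \<in> J"
proof -
  assume x: "x \<in> J"
  let ?K = "{x \<in> free_carrier l. frev x \<in> J}"
  interpret R: ring "free_alg l" by (rule ring_free_alg)
  have "ideal ?K (free_alg l)"
  proof (rule idealI)
    show "subgroup ?K (add_monoid (free_alg l))"
    proof (rule R.add.subgroupI)
      fix a assume "a \<in> ?K"
      then show "\<ominus>\<^bsub>free_alg l\<^esub> a \<in> ?K"
        using free_alg_minus[of 0 l a] I_minus[of 0 "frev a"] frev_diff[of 0 a] I_closed(1)
        by (auto simp: R.minus_eq)
    qed (auto simp: I_closed intro: exI[of _ 0])
  qed (auto simp: I_closed ring_free_alg)
  moreover have "frev x \<doteq> frev y" if "(x, y) \<in> rels l \<mu> \<tau>" for x y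
    using rels_closed[OF that] act_frev_rels[OF that periodic_unit] by (subst eqv_iff_act) auto
  ultimately have "J \<subseteq> ?K"
    unfolding rel_ideal_def
    by (intro R.genideal_minimal) (auto simp: rels_minus eqv_def rel_ideal_def[symmetric])
  with x show ?thesis by auto
qed

lemma frev_eqv: "x \<doteq> y \<Longrightarrow> frev x \<doteq> frev y"
  using frev_J[of "x - y"] by (auto simp: eqv_def)

definition rep :: "free_elem set \<Rightarrow> free_elem"
  where "rep q = (SOME x. x \<in> free_carrier l \<and> cls x = q)"

lemma rep_cls: "x \<in> free_carrier l \<Longrightarrow> rep (cls x) \<doteq> x"
proof -
  assume x: "x \<in> free_carrier l"
  then have "rep (cls x) \<in> free_carrier l \<and> cls (rep (cls x)) = cls x"
    unfolding rep_def by (intro someI_ex[of "\<lambda>y. y \<in> free_carrier l \<and> cls y = cls x"]) auto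
  with x show ?thesis by (auto simp: cls_eq_iff_eqv)
qed

definition coord :: "free_elem set \<Rightarrow> idx \<Rightarrow> complex"
  where "coord q = act (rep q) unit"

lemma coord_cls: "x \<in> free_carrier l \<Longrightarrow> coord (cls x) = act x unit"
  unfolding coord_def by (intro act_eqv rep_cls periodic_unit)

lemma coord_eq_iff:
  assumes "q \<in> carrier Q" "r \<in> carrier Q"
  shows "coord q = coord r \<longleftrightarrow> q = r"
  using assms by (elim carrier_Q_E) (auto simp: coord_cls cls_eq_iff_eqv eqv_iff_act)

text \<open>Bases of \<open>B\<close> and membership in spans are from now on questions about
  coefficient functions.\<close>

sublocale B: coordinate_map Q coord
proof (rule coordinate_map.intro)
  show "inj_on coord (carrier Q)" by (auto intro: inj_onI simp: coord_eq_iff)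
  show "coord (q \<oplus>\<^bsub>Q\<^esub> r) = coord q + coord r" if "q \<in> carrier Q" "r \<in> carrier Q" for q r
    using that by (elim carrier_Q_E) (auto simp: coord_cls act_add_left)
  show "coord (c \<odot>\<^bsub>Q\<^esub> q) = fscale c (coord q)" if "q \<in> carrier Q" for c q
    using that by (elim carrier_Q_E) (auto simp: coord_cls act_scal)
qed (rule complex_algebra_Q)

text \<open>The restriction to the carrier matches the extensionality in \<open>B_star\<close>,
  which makes the two equal as functions.\<close>

definition star :: "free_elem set \<Rightarrow> free_elem set"
  where "star = restrict (\<lambda>q. cls (frev (rep q))) (carrier Q)"

lemma star_cls: "x \<in> free_carrier l \<Longrightarrow> star (cls x) = cls (frev x)"
  using frev_eqv[OF rep_cls, of x] cls_eq_iff_eqv[OF eqv_closed] by (simp add: star_def)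

lemma B_s_cls: "B_s l \<mu> \<tau> i = cls (free_refl l i)"
  and B_e_cls: "B_e l \<mu> \<tau> i = cls (free_e i)"
  and B_grp_cls: "B_grp l \<mu> \<tau> w = cls (free_grp l w)"
  and B_word_cls: "B_word l \<mu> \<tau> u = cls (free_word u)"
  by (simp_all add: B_s_def B_e_def B_grp_def B_word_def B_class_eq free_refl_def)

lemma star_props:
  "linear_anti_involution Q star"
  "i < 2 * l \<Longrightarrow> star (B_s l \<mu> \<tau> i) = B_s l \<mu> \<tau> i"
  "i < 2 * l \<Longrightarrow> star (B_e l \<mu> \<tau> i) = B_e l \<mu> \<tau> i"
proof -
  show "star (B_s l \<mu> \<tau> i) = B_s l \<mu> \<tau> i"
    by (simp add: B_s_cls star_cls cls_eq_iff_eqv eqv_iff_act act_frev_refl act_refl)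
  show "i < 2 * l \<Longrightarrow> star (B_e l \<mu> \<tau> i) = B_e l \<mu> \<tau> i"
    by (simp add: B_e_cls star_cls)
  have "star \<in> module_hom complex_field Q Q"
    unfolding module_hom_def
    by (auto elim!: carrier_Q_E simp: star_cls single_zero_commute)
  moreover have "star (q \<otimes>\<^bsub>Q\<^esub> r) = star r \<otimes>\<^bsub>Q\<^esub> star q" if "q \<in> carrier Q" "r \<in> carrier Q" for q r
    using that by (elim carrier_Q_E) (auto simp: star_cls)
  moreover have "star (star q) = q" if "q \<in> carrier Q" for q
    using that by (elim carrier_Q_E) (auto simp: star_cls)
  ultimately show "linear_anti_involution Q star"
    by (simp add: linear_anti_involution_def)
qed

text \<open>An anti-automorphism is determined by its values on generators, and \<open>f\<close>
  fixes them all.\<close>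

lemma star_unique:
  assumes f: "linear_anti_involution Q f"
    and s: "\<And>i. i < 2 * l \<Longrightarrow> f (B_s l \<mu> \<tau> i) = B_s l \<mu> \<tau> i"
    and e: "\<And>i. i < 2 * l \<Longrightarrow> f (B_e l \<mu> \<tau> i) = B_e l \<mu> \<tau> i"
    and x: "x \<in> free_carrier l"
  shows "f (cls x) = cls (frev x)"
proof -
  interpret Q: ring Q by (rule ring_Q)
  have f_closed: "f q \<in> carrier Q" if "q \<in> carrier Q" for q
    using f that by (auto simp: linear_anti_involution_def module_hom_def)
  have f_smult: "f (c \<odot>\<^bsub>Q\<^esub> q) = c \<odot>\<^bsub>Q\<^esub> f q" if "q \<in> carrier Q" for c q
    using f that by (auto simp: linear_anti_involution_def module_hom_def)
  have f_add: "f (q \<oplus>\<^bsub>Q\<^esub> r) = f q \<oplus>\<^bsub>Q\<^esub> f r" "f (q \<otimes>\<^bsub>Q\<^esub> r) = f r \<otimes>\<^bsub>Q\<^esub> f q" "f (f q) = q"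
    if "q \<in> carrier Q" "r \<in> carrier Q" for q r
    using f that by (auto simp: linear_anti_involution_def module_hom_def)
  \<comment> \<open>Preservation of the unit has to be derived: \<open>f (f 1 * 1)\<close> equals
    \<open>f (f 1) = 1\<close> by involutivity, and \<open>f 1 * f (f 1) = f 1\<close> by reversal
    of products.\<close>
  have f_one: "f \<one>\<^bsub>Q\<^esub> = \<one>\<^bsub>Q\<^esub>"
  proof -
    have "f (f \<one>\<^bsub>Q\<^esub> \<otimes>\<^bsub>Q\<^esub> \<one>\<^bsub>Q\<^esub>) = f \<one>\<^bsub>Q\<^esub> \<otimes>\<^bsub>Q\<^esub> f (f \<one>\<^bsub>Q\<^esub>)"
      by (intro f_add(2) f_closed Q.one_closed)
    moreover have "f (f \<one>\<^bsub>Q\<^esub>) = \<one>\<^bsub>Q\<^esub>"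
      by (rule f_add(3)[OF Q.one_closed Q.one_closed])
    ultimately show ?thesis by (simp add: f_closed)
  qed
  have gen: "f (cls (Poly_Mapping.single [g] 1)) = cls (Poly_Mapping.single [g] 1)" if g: "g \<in> gens l" for g
  proof -
    consider i where "i < 2 * l" "i \<in> {0, 1}" "g = Gen_s i" | i where "i < 2 * l" "g = Gen_e i"
      using g l_pos by (auto simp: gens_def)
    then show ?thesis
    proof cases
      case (1 i)
      \<comment> \<open>\<open>B_s\<close> is the class of a chosen word for the reflection; it is
        that of the single letter because both act in the same way.\<close>
      have "cls (Poly_Mapping.single [g] 1) = B_s l \<mu> \<tau> i"
        unfolding B_s_cls using 1 g act_word[of "[i]" unit] unfolding free_word_def
        by (subst cls_eq_iff_eqv) (auto simp: eqv_iff_act act_refl)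
      with s[OF 1(1)] show ?thesis by simp
    next
      case (2 i)
      then show ?thesis using e[OF 2(1)] by (simp add: B_e_cls free_e_def)
    qed
  qed
  show ?thesis using x
  proof (induction rule: free_carrier_induct)
    case (gen g)
    then show ?case using \<open>\<And>g. g \<in> gens l \<Longrightarrow> _\<close> by simp
  next
    case one
    then show ?case using f_one by (simp add: cls_one)
  next
    case (scal c x)
    have "f (cls (scal c * x)) = f (c \<odot>\<^bsub>Q\<^esub> cls x)" using scal by simp
    also have "\<dots> = c \<odot>\<^bsub>Q\<^esub> f (cls x)" using scal by (intro f_smult) auto
    also have "\<dots> = cls (frev (scal c * x))" using scal by (simp add: single_zero_commute)
    finally show ?case .
  next
    case (add x y)
    have "f (cls (x + y)) = f (cls x \<oplus>\<^bsub>Q\<^esub> cls y)" using add by simp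
    also have "\<dots> = f (cls x) \<oplus>\<^bsub>Q\<^esub> f (cls y)" using add by (intro f_add(1)) auto
    finally show ?case using add by simp
  next
    case (mult g x)
    have g: "Poly_Mapping.single [g] 1 \<in> free_carrier l" using mult by simp
    have "f (cls (Poly_Mapping.single [g] 1 * x)) = f (cls (Poly_Mapping.single [g] 1) \<otimes>\<^bsub>Q\<^esub> cls x)"
      using mult g by simp
    also have "\<dots> = f (cls x) \<otimes>\<^bsub>Q\<^esub> f (cls (Poly_Mapping.single [g] 1))"
      using mult g by (intro f_add(2)) auto
    finally show ?case using mult g gen[OF mult(1)] by simp
  qed
qed

lemma B_star_eq: "B_star l \<mu> \<tau> = star"
  unfolding B_star_def B_alg_eq
proof (rule the_equality)
  show "star \<in> extensional (carrier Q) \<and> linear_anti_involution Q star \<and>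
    (\<forall>i<2 * l. star (B_s l \<mu> \<tau> i) = B_s l \<mu> \<tau> i \<and> star (B_e l \<mu> \<tau> i) = B_e l \<mu> \<tau> i)"
    using star_props by (auto simp: star_def)
next
  fix f
  assume f: "f \<in> extensional (carrier Q) \<and> linear_anti_involution Q f \<and>
    (\<forall>i<2 * l. f (B_s l \<mu> \<tau> i) = B_s l \<mu> \<tau> i \<and> f (B_e l \<mu> \<tau> i) = B_e l \<mu> \<tau> i)"
  show "f = star"
  proof (rule extensionalityI[of _ "carrier Q"])
    fix q assume "q \<in> carrier Q"
    then show "f q = star q"
      using f by (elim carrier_Q_E) (auto simp: star_unique star_cls)
  qed (use f in \<open>auto simp: star_def\<close>)
qed

end

section \<open>The group algebra inside the algebra, and the ideal complementary to it\<close>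

lemma lookup_map_times [simp]: "Poly_Mapping.lookup (Poly_Mapping.map ((*) c) f) x = (c :: complex) * Poly_Mapping.lookup f x"
  by (simp add: Poly_Mapping.map.rep_eq when_def)

context dihedral_brauer
begin

abbreviation CG :: "(complex, (real^2 \<Rightarrow> real^2) \<Rightarrow>\<^sub>0 complex) module"
  where "CG \<equiv> monoid_algebra (dihedral (2 * l))"

lemma CG_simps:
  "carrier CG = {f. Poly_Mapping.keys f \<subseteq> range (gmap (2 * l))}"
  "f \<oplus>\<^bsub>CG\<^esub> g = f + g" "c \<odot>\<^bsub>CG\<^esub> f = Poly_Mapping.map ((*) c) f"
  "\<zero>\<^bsub>CG\<^esub> = 0" "\<one>\<^bsub>CG\<^esub> = Poly_Mapping.single (gmap (2 * l) (Rot 0)) 1"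
  by (simp_all add: monoid_algebra_def dihedral_simps)

definition incl :: "((real^2 \<Rightarrow> real^2) \<Rightarrow>\<^sub>0 complex) \<Rightarrow> idx \<Rightarrow> complex"
  where "incl f x = (case x of Gi g \<Rightarrow> Poly_Mapping.lookup f (gmap (2 * l) g) | Ei _ _ \<Rightarrow> 0)"

lemma incl_simps [simp]:
  "incl f (Gi g) = Poly_Mapping.lookup f (gmap (2 * l) g)" "incl f (Ei k j) = 0"
  by (simp_all add: incl_def)

lemma incl_linear: "incl (f + h) = incl f + incl h" "incl (Poly_Mapping.map ((*) c) f) = fscale c (incl f)"
  "incl 0 = 0"
  by (auto simp: fun_eq_iff incl_def plus_fun_apply zero_fun_apply fscale_apply lookup_add split: idx.splits)

lemma incl_CG_zero: "incl \<zero>\<^bsub>CG\<^esub> = 0"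
  by (simp add: CG_simps(4) incl_linear)

lemma incl_sum: "incl (sum f I) = (\<Sum>i\<in>I. incl (f i))"
  by (induction I rule: infinite_finite_induct) (auto simp: incl_linear)

lemma gmap_cong_iff: "gmap (2 * l) g = gmap (2 * l) h \<longleftrightarrow> gcong (2 * l) g h"
  using l_pos by (simp add: gmap_eq_iff)

lemma gcong_left_div: "gcong n (gmul (ginv g) h) (Rot 0) \<longleftrightarrow> gcong n g h"
  by (cases g; cases h) (auto simp: dvd_diff_commute)

lemma gcong_left_mul: "gcong n (gmul g h) k \<longleftrightarrow> gcong n h (gmul (ginv g) k)"
  by (cases g; cases h; cases k) (auto simp: dvd_diff_commute algebra_simps)

lemma unit_Gi: "unit (Gi g) = of_bool (gcong (2 * l) g (Rot 0))"
  by (cases g) auto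

lemma incl_single: "incl (Poly_Mapping.single (gmap (2 * l) g) c) = fscale c (opG g unit)"
proof
  fix x show "incl (Poly_Mapping.single (gmap (2 * l) g) c) x = fscale c (opG g unit) x"
  proof (cases x)
    case (Gi h)
    then show ?thesis
      by (simp add: fscale_apply unit_Gi gcong_left_div lookup_single when_def gmap_cong_iff)
  next
    case (Ei k j)
    then show ?thesis by (cases g) (simp_all add: fscale_apply)
  qed
qed

lemma periodic_incl [simp]: "periodic (incl f)"
proof -
  have "gmap (2 * l) (Rot a) = gmap (2 * l) (Rot b)" "gmap (2 * l) (Ref a) = gmap (2 * l) (Ref b)"
    if "m dvd a - b" for a b
    using that by (simp_all add: gmap_cong_iff)
  then show ?thesis by (simp add: periodic_def)
qed

lemma incl_inject: "inj_on incl (carrier CG)"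
proof (rule inj_onI)
  fix f h assume fh: "f \<in> carrier CG" "h \<in> carrier CG" "incl f = incl h"
  show "f = h"
  proof (rule poly_mapping_eqI)
    fix w show "Poly_Mapping.lookup f w = Poly_Mapping.lookup h w"
    proof (cases "w \<in> range (gmap (2 * l))")
      case True
      then show ?thesis using fh(3) by (metis imageE incl_simps(1))
    next
      case False
      then have "w \<notin> Poly_Mapping.keys f" "w \<notin> Poly_Mapping.keys h" using fh by (auto simp: CG_simps)
      then show ?thesis by (simp add: in_keys_iff)
    qed
  qed
qed

lemma coordinate_map_incl: "complex_algebra CG \<Longrightarrow> coordinate_map CG incl"
  by (rule coordinate_map.intro) (simp_all add: incl_inject CG_simps(2,3) incl_linear)

lemma incl_expand: "incl f = (\<Sum>w\<in>Poly_Mapping.keys f. incl (Poly_Mapping.single w (Poly_Mapping.lookup f w)))"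
  by (subst (1) poly_mapping_sum_single[symmetric]) (rule incl_sum)

definition lift :: "((real^2 \<Rightarrow> real^2) \<Rightarrow>\<^sub>0 complex) \<Rightarrow> free_elem"
  where "lift f = (\<Sum>w\<in>Poly_Mapping.keys f. scal (Poly_Mapping.lookup f w) * free_grp l w)"

lemma free_grp_closed: "w \<in> range (gmap (2 * l)) \<Longrightarrow> free_grp l w \<in> free_carrier l"
  by auto

lemma lift_closed: "f \<in> carrier CG \<Longrightarrow> lift f \<in> free_carrier l"
  unfolding lift_def by (intro free_carrier_sum) (auto simp: CG_simps intro!: free_grp_closed)

lemma act_lift:
  assumes "f \<in> carrier CG" shows "act (lift f) unit = incl f"
proof -
  have "act (lift f) unit = (\<Sum>w\<in>Poly_Mapping.keys f. act (scal (Poly_Mapping.lookup f w) * free_grp l w) unit)"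
    by (simp add: lift_def act_sum_left)
  also have "\<dots> = incl f"
    unfolding incl_expand[of f] using assms
    by (intro sum.cong refl) (auto simp: CG_simps act_scal act_grp incl_single dest!: subsetD)
  finally show ?thesis .
qed

lemma inversion_star_closed: "f \<in> carrier CG \<Longrightarrow> inversion_star (dihedral (2 * l)) f \<in> carrier CG"
proof -
  assume f: "f \<in> carrier CG"
  have "Poly_Mapping.keys (\<Sum>w\<in>U. Poly_Mapping.single (inv\<^bsub>dihedral (2 * l)\<^esub> w) (Poly_Mapping.lookup f w)) \<subseteq> range (gmap (2 * l))"
    if "finite U" "U \<subseteq> range (gmap (2 * l))" for U
    using that
  proof (induction U)
    case (insert w U)
    then obtain g where "w = gmap (2 * l) g" by auto
    then have "Poly_Mapping.keys (Poly_Mapping.single (inv\<^bsub>dihedral (2 * l)\<^esub> w) (Poly_Mapping.lookup f w)) \<subseteq> range (gmap (2 * l))"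
      by (simp add: inv_dihedral)
    with insert show ?case
      using Poly_Mapping.keys_add[of "Poly_Mapping.single (inv\<^bsub>dihedral (2 * l)\<^esub> w) (Poly_Mapping.lookup f w)"
        "\<Sum>w\<in>U. Poly_Mapping.single (inv\<^bsub>dihedral (2 * l)\<^esub> w) (Poly_Mapping.lookup f w)"]
      by auto
  qed simp
  with f show ?thesis by (simp add: CG_simps inversion_star_def)
qed

lemma act_frev_lift:
  assumes "f \<in> carrier CG"
  shows "act (frev (lift f)) unit = incl (inversion_star (dihedral (2 * l)) f)"
proof -
  have "act (frev (lift f)) unit =
    (\<Sum>w\<in>Poly_Mapping.keys f. act (frev (free_grp l w) * scal (Poly_Mapping.lookup f w)) unit)"
    by (simp add: lift_def frev_sum act_sum_left)
  also have "\<dots> = (\<Sum>w\<in>Poly_Mapping.keys f. incl (Poly_Mapping.single (inv\<^bsub>dihedral (2 * l)\<^esub> w) (Poly_Mapping.lookup f w)))"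
    using assms
    by (intro sum.cong refl)
      (auto simp: CG_simps act_scal act_frev_grp incl_single inv_dihedral simp flip: single_zero_commute dest!: subsetD)
  finally show ?thesis by (simp add: inversion_star_def incl_sum)
qed

lemma B_incl_eq: "f \<in> carrier CG \<Longrightarrow> B_incl l \<mu> \<tau> f = cls (lift f)"
proof -
  assume f: "f \<in> carrier CG"
  have closed: "(\<lambda>w. Poly_Mapping.lookup f w \<odot>\<^bsub>Q\<^esub> B_grp l \<mu> \<tau> w) \<in> Poly_Mapping.keys f \<rightarrow> carrier Q"
    using f by (auto simp: CG_simps B_grp_cls dest!: subsetD)
  have "coord (B_incl l \<mu> \<tau> f) = (\<Sum>w\<in>Poly_Mapping.keys f. coord (Poly_Mapping.lookup f w \<odot>\<^bsub>Q\<^esub> B_grp l \<mu> \<tau> w))"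
    unfolding B_incl_def B_alg_eq by (rule B.h_finsum[OF closed])
  also have "\<dots> = act (lift f) unit"
    unfolding lift_def act_sum_left using f
    by (intro sum.cong refl) (auto simp: CG_simps B_grp_cls coord_cls dest!: subsetD)
  also have "\<dots> = coord (cls (lift f))" using f by (simp add: coord_cls lift_closed)
  finally show ?thesis
    using f closed by (subst (asm) coord_eq_iff) (auto simp: B_incl_def B_alg_eq lift_closed)
qed

lemma coord_B_incl: "f \<in> carrier CG \<Longrightarrow> coord (B_incl l \<mu> \<tau> f) = incl f"
  by (simp add: B_incl_eq coord_cls lift_closed act_lift)

lemma B_incl_closed: "f \<in> carrier CG \<Longrightarrow> B_incl l \<mu> \<tau> f \<in> carrier Q"
  by (simp add: B_incl_eq lift_closed)

text \<open>Reversing a word in involutions inverts the group element it represents.\<close>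

lemma star_B_incl:
  assumes "f \<in> carrier CG"
  shows "star (B_incl l \<mu> \<tau> f) = B_incl l \<mu> \<tau> (inversion_star (dihedral (2 * l)) f)"
  using assms
  by (subst coord_eq_iff[symmetric])
    (simp_all add: B_incl_eq star_cls lift_closed coord_cls act_frev_lift act_lift inversion_star_closed)

lemma opG_incl:
  assumes f: "f \<in> carrier CG"
  shows "opG g (incl f) = incl (Poly_Mapping.single (gmap (2 * l) g) 1 \<otimes>\<^bsub>CG\<^esub> f)"
proof
  fix x show "opG g (incl f) x = incl (Poly_Mapping.single (gmap (2 * l) g) 1 \<otimes>\<^bsub>CG\<^esub> f) x"
  proof (cases x)
    case (Gi h)
    let ?w = "gmap (2 * l) (gmul (ginv g) h)"
    have "Poly_Mapping.lookup (Poly_Mapping.single (gmap (2 * l) g) 1 \<otimes>\<^bsub>CG\<^esub> f) (gmap (2 * l) h) =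
      (\<Sum>y\<in>Poly_Mapping.keys f. Poly_Mapping.lookup f y when gmap (2 * l) g \<otimes>\<^bsub>dihedral (2 * l)\<^esub> y = gmap (2 * l) h)"
      by (simp add: monoid_algebra_def lookup_sum lookup_single)
    also have "\<dots> = (\<Sum>y\<in>Poly_Mapping.keys f. if y = ?w then Poly_Mapping.lookup f ?w else 0)"
      using f by (intro sum.cong refl)
        (auto simp: CG_simps dihedral_simps gmap_cong_iff gcong_left_mul when_def dest!: subsetD)
    also have "\<dots> = Poly_Mapping.lookup f ?w" by (simp add: in_keys_iff)
    finally show ?thesis using Gi by simp
  next
    case (Ei k j)
    then show ?thesis by (cases g) auto
  qed
qed

text \<open>The coefficient functions of the two-sided ideal generated by the \<open>e_i\<close>;
  the quotient by it is the group algebra.\<close>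

definition ideal_part :: "(idx \<Rightarrow> complex) set"
  where "ideal_part = {f. periodic f \<and> (\<forall>g. f (Gi g) = 0)}"

lemma ideal_part_linear:
  "0 \<in> ideal_part" "f \<in> ideal_part \<Longrightarrow> h \<in> ideal_part \<Longrightarrow> f + h \<in> ideal_part"
  "f \<in> ideal_part \<Longrightarrow> fscale c f \<in> ideal_part"
  by (auto simp: ideal_part_def periodic_linear plus_fun_apply zero_fun_apply fscale_apply)

lemma ideal_part_op:
  "f \<in> ideal_part \<Longrightarrow> opG g f \<in> ideal_part" "periodic f \<Longrightarrow> opE i f \<in> ideal_part"
  by (auto simp: ideal_part_def periodic_opG periodic_opE)

lemma act_gen: "act (Poly_Mapping.single [Gen_s i] 1) f = opG (Ref (int i)) f"
  "act (Poly_Mapping.single [Gen_e i] 1) f = opE (int i) f"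
  by (simp_all add: act_single)

text \<open>Modulo the ideal each \<open>e_i\<close> becomes \<open>0\<close> and \<open>B\<close>
  becomes the group algebra, where \<open>g\<close> is the image of \<open>x\<close>. This carries
  (C3) over to the old cells; with \<open>f = 1\<close> it splits any vector into a group part and a
  rest in the ideal.\<close>

lemma act_incl:
  assumes CG: "complex_algebra CG" and x: "x \<in> free_carrier l"
  shows "\<exists>g\<in>carrier CG. \<forall>f\<in>carrier CG. act x (incl f) - incl (g \<otimes>\<^bsub>CG\<^esub> f) \<in> ideal_part"
proof -
  interpret CG: ring CG using CG by (simp add: complex_algebra_def)
  have smult: "c \<odot>\<^bsub>CG\<^esub> g \<in> carrier CG" "(c \<odot>\<^bsub>CG\<^esub> g) \<otimes>\<^bsub>CG\<^esub> f = c \<odot>\<^bsub>CG\<^esub> (g \<otimes>\<^bsub>CG\<^esub> f)"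
    if "g \<in> carrier CG" "f \<in> carrier CG" for c g f
  proof -
    interpret V: vectorspace complex_field CG using CG by (simp add: complex_algebra_def)
    show "c \<odot>\<^bsub>CG\<^esub> g \<in> carrier CG" using that by simp
    show "(c \<odot>\<^bsub>CG\<^esub> g) \<otimes>\<^bsub>CG\<^esub> f = c \<odot>\<^bsub>CG\<^esub> (g \<otimes>\<^bsub>CG\<^esub> f)"
      using CG that by (auto simp: complex_algebra_def)
  qed
  have gen_ex: "\<exists>g\<in>carrier CG. \<forall>f\<in>carrier CG. act (Poly_Mapping.single [s] 1) (incl f) - incl (g \<otimes>\<^bsub>CG\<^esub> f) \<in> ideal_part"
    and gen_closed: "\<forall>f\<in>ideal_part. act (Poly_Mapping.single [s] 1) f \<in> ideal_part"
    if "s \<in> gens l" for s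
  proof -
    have "(\<exists>i. s = Gen_s i) \<or> (\<exists>i. s = Gen_e i)" by (cases s) auto
    then show "\<exists>g\<in>carrier CG. \<forall>f\<in>carrier CG. act (Poly_Mapping.single [s] 1) (incl f) - incl (g \<otimes>\<^bsub>CG\<^esub> f) \<in> ideal_part"
    proof (elim disjE exE)
      fix i assume "s = Gen_s i"
      then show ?thesis
        by (intro bexI[of _ "Poly_Mapping.single (gmap (2 * l) (Ref (int i))) 1"])
          (auto simp: act_gen opG_incl ideal_part_linear CG_simps(1))
    next
      fix i assume "s = Gen_e i"
      then show ?thesis
        by (intro bexI[of _ "\<zero>\<^bsub>CG\<^esub>"]) (auto simp: act_gen ideal_part_op incl_CG_zero)
    qed
    show "\<forall>f\<in>ideal_part. act (Poly_Mapping.single [s] 1) f \<in> ideal_part"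
      by (cases s) (auto simp: act_gen ideal_part_op, auto simp: ideal_part_def periodic_opE)
  qed
  show ?thesis using x
  proof (induction rule: free_carrier_induct)
    case (gen g)
    then show ?case by (rule gen_ex)
  next
    case one
    then show ?case
      by (intro bexI[of _ "\<one>\<^bsub>CG\<^esub>"]) (auto simp: act_one ideal_part_linear)
  next
    case (scal c x)
    then obtain g where g: "g \<in> carrier CG" "\<And>f. f \<in> carrier CG \<Longrightarrow> act x (incl f) - incl (g \<otimes>\<^bsub>CG\<^esub> f) \<in> ideal_part"
      by blast
    show ?case
    proof (intro bexI[of _ "c \<odot>\<^bsub>CG\<^esub> g"] ballI)
      fix f assume f: "f \<in> carrier CG"
      have "act (scal c * x) (incl f) - incl ((c \<odot>\<^bsub>CG\<^esub> g) \<otimes>\<^bsub>CG\<^esub> f) = fscale c (act x (incl f) - incl (g \<otimes>\<^bsub>CG\<^esub> f))"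
        using g f by (simp add: act_scal smult(2)) (simp add: CG_simps(3) incl_linear fvs.scale_right_diff_distrib)
      with g(2)[OF f] show "act (scal c * x) (incl f) - incl ((c \<odot>\<^bsub>CG\<^esub> g) \<otimes>\<^bsub>CG\<^esub> f) \<in> ideal_part"
        by (simp add: ideal_part_linear)
    qed (use g smult in auto)
  next
    case (add x y)
    then obtain g h where g: "g \<in> carrier CG" "\<And>f. f \<in> carrier CG \<Longrightarrow> act x (incl f) - incl (g \<otimes>\<^bsub>CG\<^esub> f) \<in> ideal_part"
      and h: "h \<in> carrier CG" "\<And>f. f \<in> carrier CG \<Longrightarrow> act y (incl f) - incl (h \<otimes>\<^bsub>CG\<^esub> f) \<in> ideal_part"
      by blast
    show ?case
    proof (intro bexI[of _ "g \<oplus>\<^bsub>CG\<^esub> h"] ballI)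
      fix f assume f: "f \<in> carrier CG"
      have "act (x + y) (incl f) - incl ((g \<oplus>\<^bsub>CG\<^esub> h) \<otimes>\<^bsub>CG\<^esub> f) =
        (act x (incl f) - incl (g \<otimes>\<^bsub>CG\<^esub> f)) + (act y (incl f) - incl (h \<otimes>\<^bsub>CG\<^esub> f))"
        using g h f by (simp add: CG.l_distr) (simp add: CG_simps(2) incl_linear act_add_left)
      with g(2)[OF f] h(2)[OF f] show "act (x + y) (incl f) - incl ((g \<oplus>\<^bsub>CG\<^esub> h) \<otimes>\<^bsub>CG\<^esub> f) \<in> ideal_part"
        by (simp add: ideal_part_linear)
    qed (use g h in auto)
  next
    case (mult s x)
    let ?s = "Poly_Mapping.single [s] 1"
    obtain g where g: "g \<in> carrier CG" "\<And>f. f \<in> carrier CG \<Longrightarrow> act ?s (incl f) - incl (g \<otimes>\<^bsub>CG\<^esub> f) \<in> ideal_part"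
      using gen_ex[OF mult(1)] by blast
    obtain h where h: "h \<in> carrier CG" "\<And>f. f \<in> carrier CG \<Longrightarrow> act x (incl f) - incl (h \<otimes>\<^bsub>CG\<^esub> f) \<in> ideal_part"
      using mult by blast
    show ?case
    proof (intro bexI[of _ "g \<otimes>\<^bsub>CG\<^esub> h"] ballI)
      fix f assume f: "f \<in> carrier CG"
      have "act ?s (act x (incl f)) = act ?s (act x (incl f) - incl (h \<otimes>\<^bsub>CG\<^esub> f)) + act ?s (incl (h \<otimes>\<^bsub>CG\<^esub> f))"
        by (simp flip: act_linear)
      then have "act (?s * x) (incl f) - incl ((g \<otimes>\<^bsub>CG\<^esub> h) \<otimes>\<^bsub>CG\<^esub> f) =
        act ?s (act x (incl f) - incl (h \<otimes>\<^bsub>CG\<^esub> f)) + (act ?s (incl (h \<otimes>\<^bsub>CG\<^esub> f)) - incl (g \<otimes>\<^bsub>CG\<^esub> (h \<otimes>\<^bsub>CG\<^esub> f)))"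
        using g h f by (simp add: act_mult CG.m_assoc)
      moreover have "act ?s (incl (h \<otimes>\<^bsub>CG\<^esub> f)) - incl (g \<otimes>\<^bsub>CG\<^esub> (h \<otimes>\<^bsub>CG\<^esub> f)) \<in> ideal_part"
        using h f by (intro g(2)) auto
      moreover have "act ?s (act x (incl f) - incl (h \<otimes>\<^bsub>CG\<^esub> f)) \<in> ideal_part"
        using gen_closed[OF mult(1)] h(2)[OF f] by blast
      ultimately show "act (?s * x) (incl f) - incl ((g \<otimes>\<^bsub>CG\<^esub> h) \<otimes>\<^bsub>CG\<^esub> f) \<in> ideal_part"
        by (simp add: ideal_part_linear)
    qed (use g h in auto)
  qed
qed

end

section \<open>The vectors of the new cells\<close>

lemma finite_parity_labels [simp]: "finite (parity_labels l p)"
proof -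
  have "parity_labels l p = (\<lambda>i. 2 * i + p) ` {..<l}" by (auto simp: parity_labels_def)
  then show ?thesis by simp
qed

lemma parity_labels_iff: "p < 2 \<Longrightarrow> a \<in> parity_labels l p \<longleftrightarrow> a < 2 * l \<and> a mod 2 = p"
  unfolding parity_labels_def by (auto intro!: exI[of _ "a div 2"])

context dihedral_brauer
begin

definition dE :: "int \<Rightarrow> int \<Rightarrow> idx \<Rightarrow> complex"
  where "dE k j = opG (Rot k) (opE j unit)"

lemma dE_simps [simp]: "dE k j (Gi g) = 0" "dE k j (Ei k' i) = of_bool (m dvd k' - k \<and> m dvd i - j)"
  by (simp_all add: dE_def opE_unit)

lemma dE_cong: "m dvd k - k' \<Longrightarrow> dE k j = dE k' j"
  unfolding dE_def by (rule opG_cong) (simp_all add: periodic_opE)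

text \<open>The exponent of the rotation in the coset of \<open>g\<close> is half the displacement
  of \<open>j\<close>. Stating \<open>2 * k\<close> as an integer equation fixes which of the two
  halves modulo \<open>m\<close> is meant.\<close>

lemma opG_opE_unit: "\<exists>k. 2 * k = gact g j - j \<and> opG g (opE j unit) = dE k j \<and>
  opG g (opG (Rot (int l)) (opE j unit)) = dE (k + int l) j"
proof (cases g)
  case (Rot k)
  then show ?thesis by (intro exI[of _ k]) (simp add: dE_def flip: opG_gmul)
next
  case (Ref q)
  have u: "periodic (opE j unit)" by (simp add: periodic_opE)
  have *: "opG (Ref q) (opE j unit) = dE (q - j) j" for q
  proof -
    have "opG (Ref q) (opE j unit) = opG (gmul (Rot (q - j)) (Ref j)) (opE j unit)" by simp
    also have "\<dots> = dE (q - j) j"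
      unfolding opG_gmul opG_Ref_opE[OF periodic_unit] dE_def ..
    finally show ?thesis .
  qed
  have "opG (Ref q) (opG (Rot (int l)) (opE j unit)) = dE (q - int l - j) j"
    by (simp add: * flip: opG_gmul)
  also have "\<dots> = dE (q - j + int l) j"
    by (rule dE_cong) simp
  finally show ?thesis using * Ref by (intro exI[of _ "q - j"]) simp
qed

lemma opG_half: "periodic f \<Longrightarrow> opG h (opG (Rot (int l)) f) = opG (Rot (int l)) (opG h f)"
  unfolding opG_gmul[symmetric] by (cases h) (auto intro!: opG_cong)

lemma opE_half: "periodic f \<Longrightarrow> opE i (opG (Rot (int l)) f) = opG (Rot (int l)) (opE i f)"
  by (subst opE_opG) (auto intro!: arg_cong[where f = "opG _"] opE_cong)

text \<open>The element \<open>c w\<^sub>a (1 + \<epsilon> r\<^sup>l) e\<^sub>p w\<^sub>b\<inverse>\<close>; both kinds of new cells are of this shape.\<close>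

definition seed :: "complex \<Rightarrow> complex \<Rightarrow> idx \<Rightarrow> complex"
  where "seed c \<epsilon> = fscale c (unit + fscale \<epsilon> (opG (Rot (int l)) unit))"

definition fam :: "complex \<Rightarrow> complex \<Rightarrow> nat \<Rightarrow> (nat \<Rightarrow> gcode) \<Rightarrow> nat \<Rightarrow> nat \<Rightarrow> idx \<Rightarrow> complex"
  where "fam c \<epsilon> p w a b = opG (w a) (opE (int p) (opG (ginv (w b)) (seed c \<epsilon>)))"

lemma periodic_seed [simp]: "periodic (seed c \<epsilon>)"
  by (simp add: seed_def periodic_linear periodic_opG)

text \<open>Let \<open>A\<close> and \<open>B\<close> be the indices of the conjugates of
  \<open>s_p\<close> by \<open>w_a\<close> and \<open>w_b\<close>. Moving \<open>e_p\<close> to the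
  right leaves \<open>w_a w_b^(-1) e_B\<close>, in which the group element may be replaced by a
  rotation from \<open>B\<close> to \<open>A\<close>.\<close>

lemma fam_eq:
  obtains k where "2 * k = gact (w a) (int p) - gact (w b) (int p)"
    "fam c \<epsilon> p w a b = fscale c (dE k (gact (w b) (int p)) + fscale \<epsilon> (dE (k + int l) (gact (w b) (int p))))"
proof -
  let ?B = "gact (w b) (int p)" and ?g = "gmul (w a) (ginv (w b))"
  have "fam c \<epsilon> p w a b = opG ?g (opE ?B (seed c \<epsilon>))"
    by (simp add: fam_def opE_opG opG_gmul)
  also have "\<dots> = fscale c (opG ?g (opE ?B unit) + fscale \<epsilon> (opG ?g (opG (Rot (int l)) (opE ?B unit))))"
    by (simp add: seed_def opE_half)
  finally have *: "fam c \<epsilon> p w a b = \<dots>" .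
  have "gact ?g ?B = gact (w a) (int p)" by (simp add: gact_gmul) (simp flip: gact_gmul)
  then show ?thesis
    using opG_opE_unit[of ?g ?B] * that by metis
qed

lemma l_not_dvd: "\<not> (m dvd k \<and> m dvd k - int l)"
proof
  assume "m dvd k \<and> m dvd k - int l"
  then have "m dvd k - (k - int l)" using dvd_diff by blast
  then show False using l_pos zdvd_not_zless[of "int l" m] by simp
qed

lemma m_dvd_double: "m dvd 2 * k \<longleftrightarrow> m dvd k \<or> m dvd k - int l"
proof
  assume "m dvd 2 * k"
  then obtain c where c: "k = int l * c" by (auto elim!: dvdE)
  show "m dvd k \<or> m dvd k - int l"
  proof (cases "even c")
    case True
    then show ?thesis using c by (auto elim!: evenE)
  next
    case False
    then show ?thesis using c by (auto elim!: oddE simp: algebra_simps)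
  qed
next
  assume "m dvd k \<or> m dvd k - int l"
  then show "m dvd 2 * k"
  proof
    assume "m dvd k - int l"
    then have "m dvd 2 * (k - int l)" by (rule dvd_mult)
    then show ?thesis using dvd_cong[of m "2 * (k - int l)" "2 * k"] by simp
  qed (rule dvd_mult)
qed

text \<open>The eigenvector equation for \<open>r^l\<close> in coordinates;
  \<open>\<epsilon> * \<epsilon> = 1\<close> lets \<epsilon> stand for its own inverse.\<close>

lemma fam_shift:
  assumes "\<epsilon> * \<epsilon> = 1"
  shows "fam c \<epsilon> p w a b (Ei (k + int l) j) = \<epsilon> * fam c \<epsilon> p w a b (Ei k j)"
proof -
  obtain k0 where k0: "fam c \<epsilon> p w a b = fscale c (dE k0 (gact (w b) (int p)) + fscale \<epsilon> (dE (k0 + int l) (gact (w b) (int p))))"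
    using fam_eq[of w a p b c \<epsilon>] .
  have 1: "m dvd k + int l - k0 \<longleftrightarrow> m dvd k - k0 - int l" by (rule dvd_cong) simp
  have 2: "k + int l - (k0 + int l) = k - k0" "k - (k0 + int l) = k - k0 - int l" by simp_all
  have swap: "c * (x + \<epsilon> * y) = \<epsilon> * (c * (y + \<epsilon> * x))" for x y
  proof -
    have "\<epsilon> * (c * (y + \<epsilon> * x)) = c * ((\<epsilon> * \<epsilon>) * x + \<epsilon> * y)" by (simp add: distrib_left)
    then show ?thesis by (simp only: assms mult_1)
  qed
  show ?thesis
    unfolding k0 fscale_apply plus_fun_apply dE_simps 1 2 by (rule swap)
qed

text \<open>The support consists of the two rotations from \<open>B\<close> to \<open>A\<close>,
  paired with \<open>e_B\<close>. Different pairs of residues \<open>(A, B)\<close> thus have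
  disjoint supports.\<close>

lemma fam_nonzero:
  assumes "c \<noteq> 0" "\<epsilon> \<noteq> 0"
  shows "fam c \<epsilon> p w a b (Ei k j) \<noteq> 0 \<longleftrightarrow>
    m dvd j - gact (w b) (int p) \<and> m dvd 2 * k - (gact (w a) (int p) - gact (w b) (int p))"
proof -
  obtain k0 where k0: "2 * k0 = gact (w a) (int p) - gact (w b) (int p)"
    "fam c \<epsilon> p w a b = fscale c (dE k0 (gact (w b) (int p)) + fscale \<epsilon> (dE (k0 + int l) (gact (w b) (int p))))"
    using fam_eq[of w a p b c \<epsilon>] .
  have "m dvd 2 * k - (gact (w a) (int p) - gact (w b) (int p)) \<longleftrightarrow> m dvd 2 * (k - k0)"
    by (simp only: k0(1)[symmetric] right_diff_distrib)
  also have "\<dots> \<longleftrightarrow> m dvd k - k0 \<or> m dvd k - k0 - int l" by (rule m_dvd_double)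
  finally show ?thesis
    using assms l_not_dvd[of "k - k0"] by (auto simp: k0 fscale_apply plus_fun_apply diff_diff_eq)
qed

text \<open>Selects one eigenvalue of \<open>r^l\<close>: on a vector of sign \<epsilon>' it is
  \<open>1 + \<epsilon> * \<epsilon>'\<close> times a coefficient, a factor \<open>2\<close> for
  equal signs and \<open>0\<close> for opposite ones.\<close>

definition functional :: "complex \<Rightarrow> int \<Rightarrow> int \<Rightarrow> (idx \<Rightarrow> complex) \<Rightarrow> complex"
  where "functional \<epsilon> k j f = f (Ei k j) + \<epsilon> * f (Ei (k + int l) j)"

lemma functional_linear: "Modules.module_hom fscale (*) (functional \<epsilon> k j)"
proof -
  have "Modules.module ((*) :: complex \<Rightarrow> complex \<Rightarrow> complex)"
    by unfold_locales (auto simp: algebra_simps)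
  then show ?thesis
    by (simp add: Modules.module_hom_iff fvs.module_axioms functional_def plus_fun_apply fscale_apply algebra_simps)
qed

lemma functional_fam:
  assumes "\<epsilon> * \<epsilon> = 1" "\<epsilon>' * \<epsilon>' = 1"
  shows "functional \<epsilon> k j (fam c \<epsilon>' p w a b) = (1 + \<epsilon> * \<epsilon>') * fam c \<epsilon>' p w a b (Ei k j)"
  by (simp add: functional_def fam_shift[OF assms(2)] algebra_simps)

text \<open>What the rotations used for \<open>Kr\<close> and the alternating words used for
  \<open>K\<close> have in common: they conjugate \<open>s_p\<close> to pairwise distinct
  reflections.\<close>

definition separating :: "nat \<Rightarrow> (nat \<Rightarrow> gcode) \<Rightarrow> bool"
  where "separating p w \<longleftrightarrow> (\<forall>a\<in>parity_labels l p. \<forall>b\<in>parity_labels l p.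
    m dvd gact (w a) (int p) - gact (w b) (int p) \<longrightarrow> a = b)"

lemma even_gact: "even (gact g j - j)"
  by (cases g) auto

lemma nat_mod_eqD: "nat (i mod m) = nat (j mod m) \<Longrightarrow> m dvd i - j"
  using dvd_diff[OF res_cong[of j] res_cong[of i]] by simp

text \<open>There are \<open>l\<close> labels and \<open>l\<close> reflections whose index has the
  parity of \<open>p\<close>, so an injective assignment is onto.\<close>

lemma separating_surj:
  assumes p: "p < 2" and w: "separating p w" and i: "even (i - int p)"
  shows "\<exists>a\<in>parity_labels l p. m dvd gact (w a) (int p) - i"
proof -
  define \<phi> where "\<phi> a = nat (gact (w a) (int p) mod m)" for a
  have mem: "nat (j mod m) \<in> parity_labels l p" if "even (j - int p)" for j
  proof -
    have "even (int (nat (j mod m)) - int p)"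
      using m_dvd_even[OF res_cong[of j]] that by auto
    moreover have "even (int n - int p) \<Longrightarrow> n mod 2 = p mod 2" for n by presburger
    ultimately have "nat (j mod m) mod 2 = p mod 2" by blast
    then show ?thesis using p res_less[of j] by (simp add: parity_labels_iff)
  qed
  have "inj_on \<phi> (parity_labels l p)"
  proof (rule inj_onI)
    fix a b assume ab: "a \<in> parity_labels l p" "b \<in> parity_labels l p" "\<phi> a = \<phi> b"
    then have "m dvd gact (w a) (int p) - gact (w b) (int p)"
      unfolding \<phi>_def by (intro nat_mod_eqD)
    with w ab show "a = b" by (auto simp: separating_def)
  qed
  moreover have "\<phi> ` parity_labels l p \<subseteq> parity_labels l p"
    by (auto simp: \<phi>_def intro!: mem even_gact)
  ultimately have "\<phi> ` parity_labels l p = parity_labels l p"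
    by (simp add: endo_inj_surj)
  then obtain a where a: "a \<in> parity_labels l p" "nat (i mod m) = \<phi> a"
    using mem[OF i] by (metis imageE)
  then have "m dvd gact (w a) (int p) - i"
    unfolding \<phi>_def by (intro nat_mod_eqD) simp
  then show ?thesis using a(1) by blast
qed

text \<open>The congruence \<open>2 * k = 0\<close> modulo \<open>2 * l\<close> has the solutions
  \<open>0\<close> and \<open>l\<close>, which gives a centralizer of four elements. On an
  eigenvector \<open>e_j v\<close> of \<open>r^l\<close> they act by \<open>1\<close> or by
  \<epsilon>.\<close>

lemma stabilizer_cases:
  assumes "m dvd gact h j - j"
  shows "gcong (2 * l) h (Rot 0) \<or> gcong (2 * l) h (Rot (int l)) \<or>
    gcong (2 * l) h (Ref j) \<or> gcong (2 * l) h (gmul (Rot (int l)) (Ref j))"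
proof (cases h)
  case (Rot k)
  then show ?thesis using assms m_dvd_double[of k] by simp
next
  case (Ref a)
  then have "gact h j - j = 2 * (a - j)" by simp
  then show ?thesis using assms m_dvd_double[of "a - j"] Ref by (simp add: algebra_simps)
qed

section \<open>Left multiplication on the new cells\<close>

definition eigen_generator :: "complex \<Rightarrow> nat \<Rightarrow> (idx \<Rightarrow> complex) \<Rightarrow> bool"
  where "eigen_generator \<epsilon> p u \<longleftrightarrow> (\<exists>v. periodic v \<and> u = opE (int p) v) \<and> opG (Rot (int l)) u = fscale \<epsilon> u"

text \<open>The coefficients are quantified before \<open>u\<close>. One choice for all
  \<open>u\<close> is what makes them independent of the second label in (C3).\<close>

definition combines :: "complex \<Rightarrow> nat \<Rightarrow> (nat \<Rightarrow> gcode) \<Rightarrow> ((idx \<Rightarrow> complex) \<Rightarrow> idx \<Rightarrow> complex) \<Rightarrow> bool"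
  where "combines \<epsilon> p w \<psi> \<longleftrightarrow> (\<exists>r. \<forall>u. eigen_generator \<epsilon> p u \<longrightarrow>
    \<psi> u = (\<Sum>S\<in>parity_labels l p. fscale (r S) (opG (w S) u)))"

lemma combines_linear:
  "combines \<epsilon> p w (\<lambda>u. 0)"
  "combines \<epsilon> p w \<psi> \<Longrightarrow> combines \<epsilon> p w \<xi> \<Longrightarrow> combines \<epsilon> p w (\<lambda>u. \<psi> u + \<xi> u)"
  "combines \<epsilon> p w \<psi> \<Longrightarrow> combines \<epsilon> p w (\<lambda>u. fscale d (\<psi> u))"
proof -
  show "combines \<epsilon> p w (\<lambda>u. 0)"
    unfolding combines_def by (rule exI[of _ "\<lambda>_. 0"]) simp
  show "combines \<epsilon> p w (\<lambda>u. \<psi> u + \<xi> u)" if "combines \<epsilon> p w \<psi>" "combines \<epsilon> p w \<xi>"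
  proof -
    from that obtain r s where
      "\<And>u. eigen_generator \<epsilon> p u \<Longrightarrow> \<psi> u = (\<Sum>S\<in>parity_labels l p. fscale (r S) (opG (w S) u))"
      "\<And>u. eigen_generator \<epsilon> p u \<Longrightarrow> \<xi> u = (\<Sum>S\<in>parity_labels l p. fscale (s S) (opG (w S) u))"
      unfolding combines_def by blast
    then show ?thesis unfolding combines_def
      by (intro exI[of _ "\<lambda>S. r S + s S"]) (simp add: fvs.scale_left_distrib sum.distrib)
  qed
  show "combines \<epsilon> p w (\<lambda>u. fscale d (\<psi> u))" if "combines \<epsilon> p w \<psi>"
  proof -
    from that obtain r where
      "\<And>u. eigen_generator \<epsilon> p u \<Longrightarrow> \<psi> u = (\<Sum>S\<in>parity_labels l p. fscale (r S) (opG (w S) u))"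
      unfolding combines_def by blast
    then show ?thesis unfolding combines_def
      by (intro exI[of _ "\<lambda>S. d * r S"]) (simp add: fvs.scale_sum_right)
  qed
qed

lemma combines_sum: "(\<And>i. i \<in> I \<Longrightarrow> combines \<epsilon> p w (\<psi> i)) \<Longrightarrow> combines \<epsilon> p w (\<lambda>u. \<Sum>i\<in>I. \<psi> i u)"
  by (induction I rule: infinite_finite_induct) (auto intro: combines_linear)

lemma combines_cong:
  "combines \<epsilon> p w \<xi> \<Longrightarrow> (\<And>u. eigen_generator \<epsilon> p u \<Longrightarrow> \<psi> u = \<xi> u) \<Longrightarrow> combines \<epsilon> p w \<psi>"
  unfolding combines_def by auto

context
  fixes \<epsilon> :: complex and p :: nat and w :: "nat \<Rightarrow> gcode"
  assumes p: "p < 2" and w: "separating p w"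
begin

lemma combines_label:
  assumes "S \<in> parity_labels l p" shows "combines \<epsilon> p w (\<lambda>u. opG (w S) u)"
  unfolding combines_def
proof (intro exI allI impI)
  fix u
  have "(\<Sum>S'\<in>parity_labels l p. fscale (of_bool (S' = S)) (opG (w S') u)) =
    (\<Sum>S'\<in>parity_labels l p. if S' = S then opG (w S) u else 0)"
    by (intro sum.cong) auto
  then show "opG (w S) u = (\<Sum>S'\<in>parity_labels l p. fscale (of_bool (S' = S)) (opG (w S') u))"
    using assms by simp
qed

text \<open>Take the label \<open>S\<close> for which \<open>w_S\<close> and \<open>g\<close>
  conjugate \<open>s_p\<close> to the same reflection. Then \<open>g = w_S h\<close> with
  \<open>h\<close> in the centralizer of \<open>s_p\<close>, and \<open>h\<close> acts on
  \<open>u\<close> as a scalar.\<close>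

lemma combines_opG: "combines \<epsilon> p w (\<lambda>u. opG g u)"
proof -
  have "even (gact g (int p) - int p)" by (rule even_gact)
  then obtain S where S: "S \<in> parity_labels l p" "m dvd gact (w S) (int p) - gact g (int p)"
    using separating_surj[OF p w] by blast
  let ?h = "gmul (ginv (w S)) g"
  have "m dvd gact (ginv (w S)) (gact g (int p)) - gact (ginv (w S)) (gact (w S) (int p))"
    using S by (intro gact_cong) (simp add: dvd_diff_commute)
  then have "m dvd gact ?h (int p) - int p" by (simp flip: gact_gmul)
  then have h: "gcong (2 * l) ?h (Rot 0) \<or> gcong (2 * l) ?h (Rot (int l)) \<or>
    gcong (2 * l) ?h (Ref (int p)) \<or> gcong (2 * l) ?h (gmul (Rot (int l)) (Ref (int p)))"
    by (rule stabilizer_cases)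
  have g: "opG g u = opG (w S) (opG ?h u)" for u
    by (simp flip: opG_gmul gmul_assoc)
  have cell_vector: "periodic u" "opG (Rot (int l)) u = fscale \<epsilon> u" "opG (Ref (int p)) u = u" if "eigen_generator \<epsilon> p u" for u
    using that by (auto simp: eigen_generator_def periodic_opE opG_Ref_opE)
  show ?thesis
  \<comment> \<open>Without the factor \<open>r^l\<close> the element \<open>h\<close> fixes
    \<open>u\<close>; with it \<open>h\<close> multiplies \<open>u\<close> by \<epsilon>.\<close>
  proof (cases "gcong (2 * l) ?h (Rot 0) \<or> gcong (2 * l) ?h (Ref (int p))")
    case True
    then have "opG g u = opG (w S) u" if "eigen_generator \<epsilon> p u" for u
      using opG_cong[of ?h _ u] cell_vector[OF that] by (auto simp: g)
    then show ?thesis by (rule combines_cong[OF combines_label[OF S(1)]])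
  next
    case False
    have "opG g u = fscale \<epsilon> (opG (w S) u)" if "eigen_generator \<epsilon> p u" for u
      using False h opG_cong[of ?h _ u] cell_vector[OF that] by (auto simp: g opG_gmul[of "Rot (int l)"] simp del: gmul.simps)
    then show ?thesis by (rule combines_cong[OF combines_linear(3)[OF combines_label[OF S(1)]]])
  qed
qed

text \<open>Moving \<open>e_i\<close> past \<open>g\<close> produces \<open>g e_i' e_p v\<close>.
  The three relations for \<open>e_i' e_p\<close> decide, and each leaves a combination of vectors
  \<open>g' u\<close>.\<close>

lemma combines_opE: "combines \<epsilon> p w (\<lambda>u. opE i (opG g u))"
proof -
  let ?i = "gact (ginv g) i"
  have eq: "opE i (opG g u) = opG g (opE ?i u)" if "eigen_generator \<epsilon> p u" for u
    using that by (auto simp: eigen_generator_def opE_opG periodic_opE)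
  consider "m dvd ?i - int p" | "odd (?i - int p)" | "\<not> m dvd ?i - int p" "even (?i - int p)" by blast
  then show ?thesis
  proof cases
    case 1
    have "opE i (opG g u) = fscale (tz (int p)) (opG g u)" if u: "eigen_generator \<epsilon> p u" for u
    proof -
      have "opE ?i u = opE (int p) u" using 1 by (rule opE_cong)
      also have "\<dots> = fscale (tz (int p)) u" using u by (auto simp: eigen_generator_def opE_sq)
      finally show ?thesis using eq[OF u] by simp
    qed
    then show ?thesis by (rule combines_cong[OF combines_linear(3)[OF combines_opG]])
  next
    case 2
    have "opE i (opG g u) = 0" if u: "eigen_generator \<epsilon> p u" for u
      using eq[OF u] u opE_odd[OF 2] by (auto simp: eigen_generator_def)
    then show ?thesis by (rule combines_cong[OF combines_linear(1)])
  next
    case 3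
    have "even (?i + int p)" using 3(2) by simp
    then obtain q where q: "?i + int p = 2 * q" by (rule evenE)
    have "opE i (opG g u) = fscale (mz q) (opG (gmul g (Ref q)) u) +
      fscale (mz (q + int l)) (opG (gmul g (Ref (q + int l))) u)" if u: "eigen_generator \<epsilon> p u" for u
    proof -
      obtain v where v: "periodic v" "u = opE (int p) v" using u by (auto simp: eigen_generator_def)
      have "opE i (opG g u) = opG g (opE ?i (opE (int p) v))" using eq[OF u] v(2) by simp
      also have "\<dots> = opG g (fscale (mz q) (opG (Ref q) u) + fscale (mz (q + int l)) (opG (Ref (q + int l)) u))"
        by (subst opE_opE[OF v(1) 3(1) q]) (simp only: v(2))
      finally show ?thesis by (simp add: opG_gmul)
    qed
    then show ?thesis
      by (rule combines_cong[OF combines_linear(2)[OF combines_linear(3)[OF combines_opG] combines_linear(3)[OF combines_opG]]])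
  qed
qed

lemma combines_act:
  assumes "x \<in> free_carrier l"
  shows "combines \<epsilon> p w \<psi> \<Longrightarrow> combines \<epsilon> p w (\<lambda>u. act x (\<psi> u))"
proof -
  have gen_act: "combines \<epsilon> p w (\<lambda>u. act (Poly_Mapping.single [g] 1) (\<psi> u))" if \<psi>: "combines \<epsilon> p w \<psi>" for g \<psi>
  proof -
    from \<psi> obtain r where r:
      "\<And>u. eigen_generator \<epsilon> p u \<Longrightarrow> \<psi> u = (\<Sum>S\<in>parity_labels l p. fscale (r S) (opG (w S) u))"
      unfolding combines_def by blast
    have lin: "act x (\<Sum>S\<in>I. fscale (r S) (f S)) = (\<Sum>S\<in>I. fscale (r S) (act x (f S)))" for x I and f :: "nat \<Rightarrow> idx \<Rightarrow> complex"
      by (induction I rule: infinite_finite_induct) (auto simp: act_linear)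
    have "combines \<epsilon> p w (\<lambda>u. act (Poly_Mapping.single [g] 1) (opG h u))" for h
    proof (cases g)
      case (Gen_s i)
      have "(\<lambda>u. act (Poly_Mapping.single [g] 1) (opG h u)) = (\<lambda>u. opG (gmul (Ref (int i)) h) u)"
        by (simp add: Gen_s act_gen opG_gmul)
      then show ?thesis using combines_opG by simp
    next
      case (Gen_e i)
      then show ?thesis using combines_opE by (simp add: act_gen)
    qed
    then have "combines \<epsilon> p w (\<lambda>u. \<Sum>S\<in>parity_labels l p. fscale (r S) (act (Poly_Mapping.single [g] 1) (opG (w S) u)))"
      by (intro combines_sum combines_linear(3))
    then show ?thesis by (rule combines_cong) (simp add: r lin)
  qed
  show "combines \<epsilon> p w \<psi> \<Longrightarrow> combines \<epsilon> p w (\<lambda>u. act x (\<psi> u))"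
    using assms
  proof (induction arbitrary: \<psi> rule: free_carrier_induct)
    case (gen g)
    then show ?case by (intro gen_act)
  next
    case one
    then show ?case by (simp add: act_one)
  next
    case (scal c x)
    then show ?case by (simp add: act_scal combines_linear)
  next
    case (add x y)
    then show ?case by (simp add: act_add_left combines_linear)
  next
    case (mult g x)
    show ?case unfolding act_mult by (intro gen_act mult)
  qed
qed

text \<open>The second label enters only through the vector
  \<open>e_p w_T^(-1) (1 + \<epsilon> r^l)\<close>, which is one instance of the generic
  \<open>u\<close>.\<close>

lemma act_fam:
  assumes "x \<in> free_carrier l" "\<epsilon> * \<epsilon> = 1"
  shows "\<exists>r. \<forall>S\<in>parity_labels l p. \<forall>T\<in>parity_labels l p.
    act x (fam c \<epsilon> p w S T) = (\<Sum>S'\<in>parity_labels l p. fscale (r S' S) (fam c \<epsilon> p w S' T))"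
proof -
  have cell_vector: "eigen_generator \<epsilon> p (opE (int p) (opG (ginv (w T)) (seed c \<epsilon>)))" for T
    unfolding eigen_generator_def
  proof
    show "\<exists>v. periodic v \<and> opE (int p) (opG (ginv (w T)) (seed c \<epsilon>)) = opE (int p) v"
      by (intro exI[of _ "opG (ginv (w T)) (seed c \<epsilon>)"]) (simp add: periodic_opG)
    have "opG (Rot (int l)) (opG (Rot (int l)) unit) = opG (Rot 0) unit"
      unfolding opG_gmul[symmetric] by (rule opG_cong) simp_all
    then have "opG (Rot (int l)) (seed c \<epsilon>) = fscale c (opG (Rot (int l)) unit + fscale \<epsilon> unit)"
      by (simp add: seed_def)
    \<comment> \<open>The coefficient \<open>1\<close> of \<open>r^l\<close> is rewritten as
      \<open>\<epsilon> * \<epsilon>\<close>, so that \<epsilon> can be taken out.\<close>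
    also have "\<dots> = fscale c (fscale (\<epsilon> * \<epsilon>) (opG (Rot (int l)) unit) + fscale \<epsilon> unit)"
      by (simp add: assms(2))
    also have "\<dots> = fscale \<epsilon> (seed c \<epsilon>)"
      by (rule ext) (simp add: seed_def fscale_apply plus_fun_apply distrib_left)
    finally have "opG (Rot (int l)) (seed c \<epsilon>) = fscale \<epsilon> (seed c \<epsilon>)" .
    then show "opG (Rot (int l)) (opE (int p) (opG (ginv (w T)) (seed c \<epsilon>))) =
      fscale \<epsilon> (opE (int p) (opG (ginv (w T)) (seed c \<epsilon>)))"
      by (simp add: periodic_opG flip: opE_half opG_half)
  qed
  have "\<forall>S. \<exists>r. S \<in> parity_labels l p \<longrightarrow> (\<forall>u. eigen_generator \<epsilon> p u \<longrightarrow>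
    act x (opG (w S) u) = (\<Sum>S'\<in>parity_labels l p. fscale (r S') (opG (w S') u)))"
    using combines_act[OF assms(1) combines_label] unfolding combines_def by blast
  then obtain r where "\<And>S u. S \<in> parity_labels l p \<Longrightarrow> eigen_generator \<epsilon> p u \<Longrightarrow>
    act x (opG (w S) u) = (\<Sum>S'\<in>parity_labels l p. fscale (r S S') (opG (w S') u))"
    by metis
  with cell_vector show ?thesis unfolding fam_def by (intro exI[of _ "\<lambda>S' S. r S S'"]) simp
qed

end

end

section \<open>The prescribed elements identified with these vectors\<close>

lemma wcode_alt_word: "wcode (alt_word x y n) =
  (if even n then Rot (int (n div 2) * (int x - int y)) else Ref (int y - int (n div 2) * (int x - int y)))"
  by (induction x y n rule: alt_word.induct) (auto simp: wcode_append algebra_simps)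

lemma set_alt_word: "set (alt_word x y n) \<subseteq> {x, y}"
  by (induction x y n rule: alt_word.induct) auto

context dihedral_brauer
begin

lemma coord_mult:
  assumes "x \<in> free_carrier l" "q \<in> carrier Q"
  shows "coord (cls x \<otimes>\<^bsub>Q\<^esub> q) = act x (coord q)"
  using assms(2) by (rule carrier_Q_E) (simp add: assms(1) coord_cls act_mult)

lemma act_scal_1: "act (scal c) f = fscale c f"
  using act_scal[of c 1 f] by (simp add: act_one)

lemma opE_diff: "opE i (f - h) = opE i f - opE i h"
  using opE_linear(1)[of i "f - h" h] by (simp add: eq_diff_eq del: opE_linear)

lemma act_frev_can: "periodic f \<Longrightarrow> act (frev (can g)) f = opG (ginv g) f"
  using act_eqv[OF frev_eqv[OF grp_can], of f g] by (simp add: act_frev_grp)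

lemma frev_ee: "frev (ee i) = ee i"
  by (simp add: ee_def)

text \<open>Reversal inverts and exchanges the outer factors of
  \<open>w_a e_p (1 + \<epsilon> r^l) w_b^(-1)\<close>; the inner ones commute, and
  \<open>r^l\<close> is its own inverse.\<close>

lemma star_fam:
  assumes q: "q \<in> carrier Q" and coord: "coord q = fam c \<epsilon> p w a b"
  shows "coord (star q) = fam c \<epsilon> p w b a"
proof -
  \<comment> \<open>An explicit product with the given coordinates, to which reversal can be applied
    factor by factor.\<close>
  define x where "x = scal c * (can (w a) * (ee (int p) * ((1 + scal \<epsilon> * can (Rot (int l))) * can (ginv (w b)))))"
  have x: "x \<in> free_carrier l"
    unfolding x_def by (intro free_carrier_closed can_closed ee_closed)
  have u: "periodic (opG (ginv (w a)) unit)" for a by (simp add: periodic_opG)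
  have inv: "opG (Rot (- int l)) f = opG (Rot (int l)) f" if "periodic f" for f
    using that by (intro opG_cong) auto
  have "act x unit = fam c \<epsilon> p w a b"
    by (simp add: x_def act_mult act_scal act_can act_ee act_add_left act_one fam_def seed_def act_scal_1
        fvs.scale_right_distrib mult.commute periodic_opG periodic_opE periodic_linear opG_half opE_half act_linear del: can.simps)
  then have "q = cls x"
    using q x coord by (subst coord_eq_iff[symmetric]) (auto simp: coord_cls)
  then have "coord (star q) = act (frev x) unit"
    using x by (simp add: star_cls coord_cls)
  also have "\<dots> = fam c \<epsilon> p w b a"
    by (simp add: x_def act_mult act_frev_can frev_ee act_ee act_add_left act_one fam_def seed_def
        act_scal_1 fvs.scale_right_distrib mult.commute periodic_opG periodic_opE periodic_linear opG_half opE_half inv del: can.simps)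
  finally show ?thesis .
qed

text \<open>For \<open>wR\<close> the conjugate of \<open>s_p\<close> is \<open>s_a\<close> itself.
  For \<open>wK\<close> the label only records the length \<open>a div 2\<close> of the word, and
  the conjugate generally has another index, see \<open>gact_wK\<close>.\<close>

definition wR :: "nat \<Rightarrow> nat \<Rightarrow> gcode" where "wR p a = Rot ((int a - int p) div 2)"
definition wK :: "nat \<Rightarrow> nat \<Rightarrow> gcode" where "wK p a = wcode (alt_word p (1 - p) (a div 2))"

lemma gact_wR:
  assumes "p < 2" "a \<in> parity_labels l p" shows "gact (wR p a) (int p) = int a"
proof -
  obtain i where "a = 2 * i + p" using assms by (auto simp: parity_labels_def)
  then show ?thesis by (simp add: wR_def)
qed

lemma separating_wR:
  assumes "p < 2" shows "separating p (wR p)"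
  unfolding separating_def
proof (intro ballI impI)
  fix a b assume ab: "a \<in> parity_labels l p" "b \<in> parity_labels l p"
    "m dvd gact (wR p a) (int p) - gact (wR p b) (int p)"
  then have "m dvd int a - int b" "a < 2 * l" "b < 2 * l"
    using assms by (auto simp: gact_wR parity_labels_iff)
  then show "a = b" using mod_less_eq by blast
qed

text \<open>As \<open>i\<close> grows, the indices run through \<open>0, 2, -2, 4, -4, ...\<close>
  for \<open>p = 0\<close> and through \<open>1, -1, 3, -3, 5, ...\<close> for
  \<open>p = 1\<close>.\<close>

lemma gact_wK:
  assumes "p < 2"
  shows "gact (wK p (2 * i + p)) (int p) =
    (if even i then int p + int i * (2 * int p - 1) else 1 - int p - int i * (2 * int p - 1))"
proof -
  have "(2 * i + p) div 2 = i" using assms by simp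
  moreover have "p = 0 \<or> p = 1" using assms by auto
  ultimately show ?thesis
    by (auto simp: wK_def wcode_alt_word elim!: evenE oddE)
qed

text \<open>Two entries of the zigzag in \<open>gact_wK\<close> differ, up to sign, by
  \<open>i - j\<close> on the same side and by \<open>i + j + 1\<close> on opposite sides. Both are
  smaller than \<open>2 * l\<close> in absolute value, and the second is positive.\<close>

lemma separating_wK:
  assumes p: "p < 2" shows "separating p (wK p)"
  unfolding separating_def
proof (intro ballI impI)
  fix a b assume ab: "a \<in> parity_labels l p" "b \<in> parity_labels l p"
    "m dvd gact (wK p a) (int p) - gact (wK p b) (int p)"
  then obtain i j where ij: "i < l" "j < l" "a = 2 * i + p" "b = 2 * j + p"
    by (auto simp: parity_labels_def)
  have small: "d = 0" if "m dvd d" "\<bar>d\<bar> < m" for d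
    using that dvd_imp_le_int[of d m] by auto
  have p01: "p = 0 \<or> p = 1" using p by auto
  show "a = b"
  proof (cases "even i = even j")
    case True
    then have "m dvd int i - int j"
      using ab(3) p01 unfolding ij gact_wK[OF p] by (auto simp: dvd_diff_commute split: if_splits)
    then show ?thesis using small[of "int i - int j"] ij by auto
  next
    case False
    then have "m dvd int i + int j + 1"
      using ab(3) p01 unfolding ij gact_wK[OF p]
      by (auto split: if_splits simp: algebra_simps dest: dvd_minus_iff[THEN iffD2])
    then show ?thesis using small[of "int i + int j + 1"] ij by auto
  qed
qed

lemma wK_base: "p < 2 \<Longrightarrow> wK p p = Rot 0"
  by (simp add: wK_def)

lemma alt_word_closed [simp, intro]: "p < 2 \<Longrightarrow> free_word (alt_word p (1 - p) n) \<in> free_carrier l"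
  using set_alt_word[of p "1 - p" n] by (intro free_elem_closed) auto

declare alt_word_closed [unfolded One_nat_def, simp]

lemma K_col_eq:
  assumes "p < 2"
  shows "K_col l \<mu> \<tau> p n = cls (free_word (alt_word p (1 - p) n) * (free_refl l (l + p) * free_e p - free_e p))"
  using assms l_pos by (simp add: K_col_def B_alg_eq B_word_cls B_s_cls B_e_cls)

lemma K_col_closed: "p < 2 \<Longrightarrow> K_col l \<mu> \<tau> p n \<in> carrier Q"
  using l_pos by (simp add: K_col_eq)

text \<open>Since \<open>s_(l + p) = r^l s_p\<close>, the starting element is
  \<open>(r^l - 1) e_p\<close>; hence both the constant \<open>c\<close> and the sign are
  \<open>-1\<close>.\<close>

lemma coord_K_col:
  assumes p: "p < 2" and a: "a \<in> parity_labels l p"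
  shows "coord (K_col l \<mu> \<tau> p (a div 2)) = fam (- 1) (- 1) p (wK p) a p"
proof -
  have e: "opG (Ref (int l + int p)) (opE (int p) unit) = opG (Rot (int l)) (opE (int p) unit)"
  proof -
    have "opG (Ref (int l + int p)) (opE (int p) unit) = opG (gmul (Rot (int l)) (Ref (int p))) (opE (int p) unit)" by simp
    also have "\<dots> = opG (Rot (int l)) (opE (int p) unit)"
      unfolding opG_gmul opG_Ref_opE[OF periodic_unit] ..
    finally show ?thesis .
  qed
  have neg: "fscale (- 1) (f + fscale (- 1) h) = h - f" for f h :: "idx \<Rightarrow> complex"
    by (simp add: fvs.scale_right_distrib fvs.scale_scale)
  have "coord (K_col l \<mu> \<tau> p (a div 2)) = opG (wK p a) (opG (Rot (int l)) (opE (int p) unit) - opE (int p) unit)"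
    using p l_pos
    by (simp add: K_col_eq coord_cls act_mult act_word act_diff_left act_refl act_e periodic_opE e wK_def)
  also have "\<dots> = fam (- 1) (- 1) p (wK p) a p"
    by (simp add: fam_def wK_base[OF p] seed_def neg opE_diff opE_half)
  finally show ?thesis .
qed

text \<open>The anti-involution turns the first column into the first row. As \<open>w_p\<close> is
  the identity, multiplying the first row by \<open>w_a\<close> from the left gives row
  \<open>a\<close>.\<close>

lemma C_K_fam:
  assumes p: "p < 2" and ab: "a \<in> parity_labels l p" "b \<in> parity_labels l p"
  shows "C_K l \<mu> \<tau> p a b \<in> carrier Q" "coord (C_K l \<mu> \<tau> p a b) = fam (- 1) (- 1) p (wK p) a b"
proof -
  have star_closed: "star q \<in> carrier Q" if "q \<in> carrier Q" for q
    using that by (elim carrier_Q_E) (simp add: star_cls)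
  note col = K_col_closed[OF p] coord_K_col[OF p]
  have row: "coord (star (K_col l \<mu> \<tau> p (b div 2))) = fam (- 1) (- 1) p (wK p) p b"
    by (rule star_fam[OF col(1) col(2)[OF ab(2)]])
  have fam_a: "opG (wK p a) (fam (- 1) (- 1) p (wK p) p b) = fam (- 1) (- 1) p (wK p) a b"
    by (simp add: fam_def wK_base[OF p])
  have w: "free_word (alt_word p (1 - p) (a div 2)) \<in> free_carrier l" using p by simp
  interpret Q: ring Q by (rule ring_Q)
  consider "b = p" | "b \<noteq> p" "a = p" | "b \<noteq> p" "a \<noteq> p" by blast
  then have "C_K l \<mu> \<tau> p a b \<in> carrier Q \<and> coord (C_K l \<mu> \<tau> p a b) = fam (- 1) (- 1) p (wK p) a b"
  proof cases
    case 1
    then show ?thesis using col ab by (simp add: C_K_def)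
  next
    case 2
    then show ?thesis using col row star_closed by (simp add: C_K_def B_star_eq)
  next
    case 3
    have "coord (cls (free_word (alt_word p (1 - p) (a div 2))) \<otimes>\<^bsub>Q\<^esub> star (K_col l \<mu> \<tau> p (b div 2))) =
      opG (wK p a) (fam (- 1) (- 1) p (wK p) p b)"
      by (subst coord_mult[OF w star_closed[OF col(1)]]) (simp add: row act_word wK_def)
    then show ?thesis using 3 col(1) star_closed w fam_a by (simp add: C_K_def B_star_eq B_alg_eq B_word_cls)
  qed
  then show "C_K l \<mu> \<tau> p a b \<in> carrier Q" "coord (C_K l \<mu> \<tau> p a b) = fam (- 1) (- 1) p (wK p) a b"
    by simp_all
qed

text \<open>A coset of \<open>{1, s_b}\<close> holds one rotation and one reflection. Its rotation
  determines it, so cosets can be compared through \<open>k\<close>.\<close>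

lemma coset_eq:
  assumes "2 * k = gact g (int b) - int b"
  shows "gmap (2 * l) g <#\<^bsub>dihedral (2 * l)\<^esub> {\<one>\<^bsub>dihedral (2 * l)\<^esub>, plane_refl (2 * l) b} =
    {gmap (2 * l) (Rot k), gmap (2 * l) (Ref (k + int b))}"
proof (cases g)
  case (Rot k')
  with assms have "k' = k" by simp
  with Rot show ?thesis by (simp add: l_coset_def dihedral_simps plane_refl_eq_gmap insert_commute)
next
  case (Ref q)
  with assms have "q = k + int b" by simp
  with Ref show ?thesis by (simp add: l_coset_def dihedral_simps plane_refl_eq_gmap insert_commute)
qed

lemma coset_eq_iff:
  assumes "2 * k = gact g (int b) - int b" "2 * k' = gact h (int b) - int b"
  shows "gmap (2 * l) g <#\<^bsub>dihedral (2 * l)\<^esub> {\<one>\<^bsub>dihedral (2 * l)\<^esub>, plane_refl (2 * l) b} =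
    gmap (2 * l) h <#\<^bsub>dihedral (2 * l)\<^esub> {\<one>\<^bsub>dihedral (2 * l)\<^esub>, plane_refl (2 * l) b} \<longleftrightarrow> m dvd k - k'"
  unfolding coset_eq[OF assms(1)] coset_eq[OF assms(2)]
  by (auto simp: doubleton_eq_iff gmap_cong_iff)

text \<open>The selection condition inside \<open>C_Kr\<close>, named in order to reason about the
  pair chosen there.\<close>

definition Kr_pair :: "nat \<Rightarrow> nat \<Rightarrow> (real^2 \<Rightarrow> real^2) \<Rightarrow> (real^2 \<Rightarrow> real^2) \<Rightarrow> bool"
  where "Kr_pair a b w1 w2 \<longleftrightarrow> (let G = dihedral (2 * l); s = plane_refl (2 * l); H = {\<one>\<^bsub>G\<^esub>, s b} in
    w1 \<in> carrier G \<and> w2 \<in> carrier G \<and> w1 <#\<^bsub>G\<^esub> H \<noteq> w2 <#\<^bsub>G\<^esub> H \<and>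
    w1 \<otimes>\<^bsub>G\<^esub> s b \<otimes>\<^bsub>G\<^esub> inv\<^bsub>G\<^esub> w1 = s a \<and> w2 \<otimes>\<^bsub>G\<^esub> s b \<otimes>\<^bsub>G\<^esub> inv\<^bsub>G\<^esub> w2 = s a)"

lemma Kr_pair_gmap:
  assumes "2 * k1 = gact g1 (int b) - int b" "2 * k2 = gact g2 (int b) - int b"
  shows "Kr_pair a b (gmap (2 * l) g1) (gmap (2 * l) g2) \<longleftrightarrow>
    \<not> m dvd k1 - k2 \<and> m dvd gact g1 (int b) - int a \<and> m dvd gact g2 (int b) - int a"
  by (simp add: Kr_pair_def Let_def coset_eq_iff[OF assms] conj_gmap_iff) (simp add: dihedral_simps)

text \<open>Exactly two cosets conjugate \<open>s_b\<close> to \<open>s_a\<close>, those of the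
  rotations \<open>k0\<close> and \<open>k0 + l\<close>. The chosen pair represents them in one
  order or the other, and the sum does not depend on the order.\<close>

lemma C_Kr_fam:
  assumes p: "p < 2" and ab: "a \<in> parity_labels l p" "b \<in> parity_labels l p"
  shows "C_Kr l \<mu> \<tau> a b \<in> carrier Q" "coord (C_Kr l \<mu> \<tau> a b) = fam (1 / 2) 1 p (wR p) a b"
proof -
  obtain k0 where k0: "2 * k0 = int a - int b"
    "fam (1 / 2) 1 p (wR p) a b = fscale (1 / 2) (dE k0 (int b) + dE (k0 + int l) (int b))"
    using fam_eq[of "wR p" a p b "1 / 2" 1] gact_wR[OF p ab(1)] gact_wR[OF p ab(2)] by auto
  have b: "b < 2 * l" using p ab by (simp add: parity_labels_iff)
  define P where "P = (SOME (w1, w2). Kr_pair a b w1 w2)"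
  \<comment> \<open>A pair of the required kind exists, so the choice in \<open>C_Kr\<close> has its
    defining property.\<close>
  have "Kr_pair a b (gmap (2 * l) (Rot k0)) (gmap (2 * l) (Rot (k0 + int l)))"
    using k0 l_not_dvd[of 0]
    by (subst Kr_pair_gmap[of k0 _ _ "k0 + int l"]) auto
  then have "\<exists>P. case P of (w1, w2) \<Rightarrow> Kr_pair a b w1 w2" by auto
  then have P: "Kr_pair a b (fst P) (snd P)"
    unfolding P_def by (rule someI2_ex) (simp add: split_beta)
  then obtain g1 g2 where g: "fst P = gmap (2 * l) g1" "snd P = gmap (2 * l) g2"
    by (auto simp: Kr_pair_def Let_def dihedral_simps)
  obtain k1 where k1: "2 * k1 = gact g1 (int b) - int b" "opG g1 (opE (int b) unit) = dE k1 (int b)"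
    using opG_opE_unit by blast
  obtain k2 where k2: "2 * k2 = gact g2 (int b) - int b" "opG g2 (opE (int b) unit) = dE k2 (int b)"
    using opG_opE_unit by blast
  have C: "C_Kr l \<mu> \<tau> a b = cls (scal (1 / 2) * ((free_grp l (fst P) + free_grp l (snd P)) * free_e b))"
    unfolding C_Kr_def Let_def B_alg_eq P_def Kr_pair_def
    using b g unfolding P_def Kr_pair_def Let_def by (simp add: split_beta B_grp_cls B_e_cls)
  show "C_Kr l \<mu> \<tau> a b \<in> carrier Q" using b by (simp add: C g)
  have "\<not> m dvd k1 - k2" "m dvd gact g1 (int b) - int a" "m dvd gact g2 (int b) - int a"
    using P unfolding g Kr_pair_gmap[OF k1(1) k2(1)] by auto
  moreover have "gact g1 (int b) - int a = 2 * (k1 - k0)" "gact g2 (int b) - int a = 2 * (k2 - k0)"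
    using k0 k1 k2 by auto
  ultimately have k: "\<not> m dvd k1 - k2" "m dvd k1 - k0 \<or> m dvd k1 - k0 - int l" "m dvd k2 - k0 \<or> m dvd k2 - k0 - int l"
    using m_dvd_double[of "k1 - k0"] m_dvd_double[of "k2 - k0"] by argo+
  have diff: "m dvd k1 - k2" if "m dvd k1 - d" "m dvd k2 - d" for d
    using dvd_diff[OF that] by simp
  have "dE k1 (int b) + dE k2 (int b) = dE k0 (int b) + dE (k0 + int l) (int b)"
    using k diff[of k0] diff[of "k0 + int l"] dE_cong[of k1 k0] dE_cong[of k1 "k0 + int l"]
      dE_cong[of k2 k0] dE_cong[of k2 "k0 + int l"]
    by (auto simp: diff_diff_eq add.commute)
  then show "coord (C_Kr l \<mu> \<tau> a b) = fam (1 / 2) 1 p (wR p) a b"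
    using b k1 k2
    by (simp add: C g coord_cls act_scal act_mult act_add_left act_grp act_e act_scal_1 periodic_opE k0)
qed

end

section \<open>The extended index set and its order\<close>

definition new_cells :: "'i bar set" where "new_cells = {LKr 0, LKr 1, LK 0, LK 1}"

definition cell_parity :: "'i bar \<Rightarrow> nat" where "cell_parity \<kappa> = (case \<kappa> of LKr p \<Rightarrow> p | LK p \<Rightarrow> p | Old _ \<Rightarrow> 0)"
text \<open>The eigenvalue of \<open>r^l\<close> on a new cell.\<close>

definition cell_sign :: "'i bar \<Rightarrow> complex" where "cell_sign \<kappa> = (case \<kappa> of LKr _ \<Rightarrow> 1 | _ \<Rightarrow> - 1)"
text \<open>The constant \<open>c\<close> of \<open>fam\<close>: \<open>1 / 2\<close> is the factor
  in the elements of \<open>Kr\<close>, and \<open>- 1\<close> arises because those of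
  \<open>K\<close> start from \<open>(r^l - 1) e_p\<close>.\<close>

definition cell_scale :: "'i bar \<Rightarrow> complex" where "cell_scale \<kappa> = (case \<kappa> of LKr _ \<Rightarrow> 1 / 2 | _ \<Rightarrow> - 1)"

lemma bar_index_eq: "bar_index \<Lambda> = Old ` \<Lambda> \<union> new_cells"
  by (auto simp: bar_index_def new_cells_def)

lemma new_cells_props:
  assumes "\<kappa> \<in> new_cells"
  shows "cell_parity \<kappa> < 2" "cell_sign \<kappa> * cell_sign \<kappa> = 1" "cell_sign \<kappa> \<noteq> 0" "cell_scale \<kappa> \<noteq> 0"
    "bar_M l M \<kappa> = Inr ` parity_labels l (cell_parity \<kappa>)" "\<kappa> \<noteq> Old x"
  using assms by (auto simp: new_cells_def cell_parity_def cell_sign_def cell_scale_def)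

lemma new_cells_eqI:
  assumes "\<kappa> \<in> new_cells" "\<kappa>' \<in> new_cells" "1 + cell_sign \<kappa> * cell_sign \<kappa>' \<noteq> 0" "cell_parity \<kappa> = cell_parity \<kappa>'"
  shows "\<kappa> = \<kappa>'"
  using assms by (auto simp: new_cells_def cell_parity_def cell_sign_def)

lemma finite_new_cells [simp]: "finite new_cells"
  by (simp add: new_cells_def)

lemma bar_order_iff:
  "(x, y) \<in> bar_order \<Lambda> ord \<longleftrightarrow> (case x of
    Old a \<Rightarrow> (case y of Old b \<Rightarrow> (a, b) \<in> ord \<or> a = b \<and> a \<in> \<Lambda> | _ \<Rightarrow> False)
  | LKr p \<Rightarrow> p \<in> {0, 1} \<and> (case y of Old b \<Rightarrow> b \<in> \<Lambda> | LKr q \<Rightarrow> p = q | LK q \<Rightarrow> False)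
  | LK p \<Rightarrow> p \<in> {0, 1} \<and> (case y of Old b \<Rightarrow> b \<in> \<Lambda> | LKr q \<Rightarrow> q \<in> {0, 1} | LK q \<Rightarrow> p = q))"
  by (cases x; cases y) (auto simp: bar_order_def bar_index_def)

lemma partial_order_bar:
  assumes "partial_order_on \<Lambda> ord"
  shows "partial_order_on (bar_index \<Lambda>) (bar_order \<Lambda> ord)"
proof -
  have sub: "ord \<subseteq> \<Lambda> \<times> \<Lambda>" and t: "trans ord" and a: "antisym ord"
    using assms by (simp_all add: partial_order_on_def preorder_on_def)
  have ord_closed: "x \<in> \<Lambda>" "y \<in> \<Lambda>" if "(x, y) \<in> ord" for x y using sub that by auto
  have "x \<in> bar_index \<Lambda>" "y \<in> bar_index \<Lambda>" if "(x, y) \<in> bar_order \<Lambda> ord" for x y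
    using that ord_closed by (cases x; cases y; auto simp: bar_order_iff bar_index_def)+
  then have "bar_order \<Lambda> ord \<subseteq> bar_index \<Lambda> \<times> bar_index \<Lambda>" by auto
  moreover have "(x, x) \<in> bar_order \<Lambda> ord" if "x \<in> bar_index \<Lambda>" for x
    using that by (auto simp: bar_order_def)
  then have "refl_on (bar_index \<Lambda>) (bar_order \<Lambda> ord)"
    by (simp add: refl_on_def)
  moreover have "trans (bar_order \<Lambda> ord)"
  proof (rule transI)
    fix x y z assume xyz: "(x, y) \<in> bar_order \<Lambda> ord" "(y, z) \<in> bar_order \<Lambda> ord"
    show "(x, z) \<in> bar_order \<Lambda> ord"
    proof (cases y)
      case (Old b)
      \<comment> \<open>Above an old index there are only old ones.\<close>
      from xyz(2) Old obtain c where c: "z = Old c" "(b, c) \<in> ord \<or> b = c" "c \<in> \<Lambda>"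
        using ord_closed by (cases z) (auto simp: bar_order_iff)
      show ?thesis
      proof (cases x)
        case (Old a)
        with xyz(1) \<open>y = Old b\<close> c show ?thesis
          using transD[OF t, of a b c] by (auto simp: bar_order_iff)
      qed (use xyz(1) c in \<open>auto simp: bar_order_iff\<close>)
    next
      case (LKr q)
      with xyz show ?thesis by (cases x; cases z) (auto simp: bar_order_iff)
    next
      case (LK q)
      with xyz show ?thesis by (cases x; cases z) (auto simp: bar_order_iff)
    qed
  qed
  moreover have "antisym (bar_order \<Lambda> ord)"
  proof (rule antisymI)
    fix x y assume "(x, y) \<in> bar_order \<Lambda> ord" "(y, x) \<in> bar_order \<Lambda> ord"
    then show "x = y"
      using antisymD[OF a] by (cases x; cases y) (auto simp: bar_order_iff)
  qed
  ultimately show ?thesis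
    by (simp add: partial_order_on_def preorder_on_def)
qed

section \<open>Old and new vectors together form a basis; the cell axioms\<close>

context dihedral_brauer
begin

definition cell_rep :: "'i bar \<Rightarrow> nat \<Rightarrow> gcode"
  where "cell_rep \<kappa> = (case \<kappa> of LKr p \<Rightarrow> wR p | LK p \<Rightarrow> wK p | Old _ \<Rightarrow> (\<lambda>_. Rot 0))"

definition new_labels :: "('i bar \<times> nat \<times> nat) set"
  where "new_labels = (SIGMA \<kappa>:new_cells. parity_labels l (cell_parity \<kappa>) \<times> parity_labels l (cell_parity \<kappa>))"

fun cell_vector :: "'i bar \<times> nat \<times> nat \<Rightarrow> idx \<Rightarrow> complex"
  where "cell_vector (\<kappa>, a, b) = fam (cell_scale \<kappa>) (cell_sign \<kappa>) (cell_parity \<kappa>) (cell_rep \<kappa>) a b"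

definition new_vectors :: "'i itself \<Rightarrow> (idx \<Rightarrow> complex) set"
  where "new_vectors _ = cell_vector ` (new_labels :: ('i bar \<times> nat \<times> nat) set)"

lemma new_labels_iff: "(\<kappa>, a, b) \<in> new_labels \<longleftrightarrow>
    \<kappa> \<in> new_cells \<and> a \<in> parity_labels l (cell_parity \<kappa>) \<and> b \<in> parity_labels l (cell_parity \<kappa>)"
  by (simp add: new_labels_def)

lemma finite_new_labels [simp]: "finite new_labels"
  unfolding new_labels_def by (intro finite_SigmaI finite_cartesian_product) auto

lemma new_vectorsI: "(y :: 'i bar \<times> nat \<times> nat) \<in> new_labels \<Longrightarrow> cell_vector y \<in> new_vectors TYPE('i)"
  by (simp add: new_vectors_def)

lemma separating_cell_rep: "\<kappa> \<in> new_cells \<Longrightarrow> separating (cell_parity \<kappa>) (cell_rep \<kappa>)"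
  using separating_wR separating_wK by (auto simp: new_cells_def cell_parity_def cell_rep_def)

lemma bar_C_new:
  assumes "(\<kappa>, a, b) \<in> new_labels"
  shows "bar_C l \<mu> \<tau> C \<kappa> (Inr a) (Inr b) \<in> carrier Q"
    "coord (bar_C l \<mu> \<tau> C \<kappa> (Inr a) (Inr b)) = cell_vector (\<kappa>, a, b)"
  using assms C_K_fam[of "cell_parity \<kappa>" a b] C_Kr_fam[of "cell_parity \<kappa>" a b]
  by (auto simp: new_labels_iff new_cells_def cell_parity_def cell_sign_def cell_scale_def cell_rep_def)

text \<open>The form reads the two normal forms belonging to the labels of \<open>y\<close>,
  weighted by the sign of its cell. Other labels have disjoint support, the opposite sign is
  cancelled, and the group algebra has no coefficients there.\<close>

lemma dual_functional:
  assumes y: "y \<in> new_labels"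
  obtains \<phi> where "Modules.module_hom fscale (*) \<phi>" "\<phi> (cell_vector y) \<noteq> 0" "\<And>f. \<phi> (incl f) = 0"
    "\<And>z. \<lbrakk>z \<in> new_labels; z \<noteq> y\<rbrakk> \<Longrightarrow> \<phi> (cell_vector z) = 0"
proof -
  obtain \<kappa> a b where y_eq: "y = (\<kappa>, a, b)" by (cases y)
  with y have \<kappa>: "\<kappa> \<in> new_cells" and ab: "a \<in> parity_labels l (cell_parity \<kappa>)" "b \<in> parity_labels l (cell_parity \<kappa>)"
    by (auto simp: new_labels_iff)
  let ?A = "gact (cell_rep \<kappa> a) (int (cell_parity \<kappa>))" and ?B = "gact (cell_rep \<kappa> b) (int (cell_parity \<kappa>))"
  obtain k where k: "2 * k = ?A - ?B"
    by (rule fam_eq[of "cell_rep \<kappa>" a "cell_parity \<kappa>" b 1 1])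
  let ?\<phi> = "functional (cell_sign \<kappa>) k ?B"
  note props = new_cells_props[OF \<kappa>]
  show ?thesis
  proof (rule that[of ?\<phi>])
    show "Modules.module_hom fscale (*) ?\<phi>" by (rule functional_linear)
    show "?\<phi> (cell_vector y) \<noteq> 0"
      using k props by (simp add: y_eq functional_fam fam_nonzero)
    show "?\<phi> (incl f) = 0" for f by (simp add: functional_def)
    fix z assume z: "z \<in> new_labels" "z \<noteq> y"
    obtain \<kappa>' a' b' where z_eq: "z = (\<kappa>', a', b')" by (cases z)
    with z have \<kappa>': "\<kappa>' \<in> new_cells" and ab': "a' \<in> parity_labels l (cell_parity \<kappa>')" "b' \<in> parity_labels l (cell_parity \<kappa>')"
      by (auto simp: new_labels_iff)
    let ?A' = "gact (cell_rep \<kappa>' a') (int (cell_parity \<kappa>'))" and ?B' = "gact (cell_rep \<kappa>' b') (int (cell_parity \<kappa>'))"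
    show "?\<phi> (cell_vector z) = 0"
    proof (rule ccontr)
      assume "?\<phi> (cell_vector z) \<noteq> 0"
      then have *: "1 + cell_sign \<kappa> * cell_sign \<kappa>' \<noteq> 0" "m dvd ?B - ?B'" "m dvd 2 * k - (?A' - ?B')"
        using props new_cells_props[OF \<kappa>'] by (auto simp: z_eq functional_fam fam_nonzero)
      \<comment> \<open>Conjugation preserves the parity of an index, so cells with a common index
        in their supports have equal parity.\<close>
      have "even (int (cell_parity \<kappa>) - int (cell_parity \<kappa>'))"
        using m_dvd_even[OF *(2)] even_gact[of "cell_rep \<kappa> b" "int (cell_parity \<kappa>)"] even_gact[of "cell_rep \<kappa>' b'" "int (cell_parity \<kappa>')"]
        by auto
      then have "cell_parity \<kappa> = cell_parity \<kappa>'"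
        using props(1) new_cells_props(1)[OF \<kappa>'] by presburger
      then have eq: "\<kappa>' = \<kappa>" using new_cells_eqI[OF \<kappa> \<kappa>' *(1)] by simp
      have b: "b = b'"
        using separating_cell_rep[OF \<kappa>] ab' ab *(2) unfolding separating_def eq by blast
      have "2 * k - (?A' - ?B') = ?A - ?A'" using k b eq by simp
      then have "a = a'"
        using separating_cell_rep[OF \<kappa>] ab' ab *(3) unfolding separating_def eq by metis
      with z(2) b eq show False by (simp add: y_eq z_eq)
    qed
  qed
qed

lemma cell_vector_inj: "inj_on cell_vector (new_labels :: ('i bar \<times> nat \<times> nat) set)"
proof (rule inj_onI)
  fix y z :: "'i bar \<times> nat \<times> nat" assume yz: "y \<in> new_labels" "z \<in> new_labels" "cell_vector y = cell_vector z"
  then show "y = z" using dual_functional[OF yz(1)] by metis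
qed

lemma cell_vector_neq_incl: "y \<in> new_labels \<Longrightarrow> cell_vector y \<noteq> incl f"
  using dual_functional by metis

lemma new_vectors_independent:
  assumes "fvs.independent (incl ` F)"
  shows "fvs.independent (incl ` F \<union> new_vectors TYPE('i))"
proof (rule independent_Un_functionals[OF assms])
  show "finite (new_vectors TYPE('i))" by (simp add: new_vectors_def)
  fix t assume "t \<in> new_vectors TYPE('i)"
  then obtain y :: "'i bar \<times> nat \<times> nat" where y: "y \<in> new_labels" "t = cell_vector y"
    by (auto simp: new_vectors_def)
  obtain \<phi> where \<phi>: "Modules.module_hom fscale (*) \<phi>" "\<phi> (cell_vector y) \<noteq> 0" "\<And>f. \<phi> (incl f) = 0"
    "\<And>z. \<lbrakk>z \<in> new_labels; z \<noteq> y\<rbrakk> \<Longrightarrow> \<phi> (cell_vector z) = 0"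
    using dual_functional[OF y(1)] by blast
  then have "\<forall>x\<in>incl ` F \<union> new_vectors TYPE('i) - {t}. \<phi> x = 0"
    using y by (auto simp: new_vectors_def)
  then show "\<exists>\<phi>. Modules.module_hom fscale (*) \<phi> \<and> \<phi> t \<noteq> 0 \<and> (\<forall>x\<in>incl ` F \<union> new_vectors TYPE('i) - {t}. \<phi> x = 0)"
    using \<phi>(1,2) y(2) by blast
qed

text \<open>Surjectivity provides \<open>b\<close> with index \<open>j\<close> and \<open>a\<close>
  with index \<open>j + 2 * k\<close>. The rotation in that cell vector is \<open>k\<close> or
  \<open>k + l\<close> modulo \<open>m\<close>, and the difference \<open>r^l\<close> only
  multiplies the vector by its sign.\<close>

lemma eigenvector_in_span:
  fixes \<kappa> :: "'i bar"
  assumes \<kappa>: "\<kappa> \<in> new_cells" and j: "even (j - int (cell_parity \<kappa>))"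
  shows "dE k j + fscale (cell_sign \<kappa>) (dE (k + int l) j) \<in> fvs.span (new_vectors TYPE('i))"
proof -
  note props = new_cells_props[OF \<kappa>]
  let ?p = "int (cell_parity \<kappa>)"
  obtain b where b: "b \<in> parity_labels l (cell_parity \<kappa>)" "m dvd gact (cell_rep \<kappa> b) ?p - j"
    using separating_surj[OF props(1) separating_cell_rep[OF \<kappa>] j] by blast
  have "even (j + 2 * k - ?p)" using j by simp
  then obtain a where a: "a \<in> parity_labels l (cell_parity \<kappa>)" "m dvd gact (cell_rep \<kappa> a) ?p - (j + 2 * k)"
    using separating_surj[OF props(1) separating_cell_rep[OF \<kappa>]] by blast
  obtain k1 where k1: "2 * k1 = gact (cell_rep \<kappa> a) ?p - gact (cell_rep \<kappa> b) ?p"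
    "cell_vector (\<kappa>, a, b) = fscale (cell_scale \<kappa>) (dE k1 (gact (cell_rep \<kappa> b) ?p) + fscale (cell_sign \<kappa>) (dE (k1 + int l) (gact (cell_rep \<kappa> b) ?p)))"
    unfolding cell_vector.simps using fam_eq .
  have "dE k (gact (cell_rep \<kappa> b) ?p) = dE k j" for k
    unfolding dE_def by (rule arg_cong[OF opE_cong[OF b(2)]])
  with k1 have v: "cell_vector (\<kappa>, a, b) = fscale (cell_scale \<kappa>) (dE k1 j + fscale (cell_sign \<kappa>) (dE (k1 + int l) j))" by simp
  have "cell_vector (\<kappa>, a, b) \<in> new_vectors TYPE('i)" using \<kappa> a b by (intro new_vectorsI) (simp add: new_labels_iff)
  then have "fscale (inverse (cell_scale \<kappa>)) (cell_vector (\<kappa>, a, b)) \<in> fvs.span (new_vectors TYPE('i))"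
    by (intro fvs.span_scale fvs.span_base)
  then have e1: "dE k1 j + fscale (cell_sign \<kappa>) (dE (k1 + int l) j) \<in> fvs.span (new_vectors TYPE('i))"
    using props(4) by (simp add: v del: cell_vector.simps)
  have "m dvd (gact (cell_rep \<kappa> a) ?p - (j + 2 * k)) - (gact (cell_rep \<kappa> b) ?p - j)"
    using a(2) b(2) by (rule dvd_diff)
  moreover have "(gact (cell_rep \<kappa> a) ?p - (j + 2 * k)) - (gact (cell_rep \<kappa> b) ?p - j) = 2 * (k1 - k)"
    using k1(1) by simp
  ultimately have "m dvd 2 * (k1 - k)" by (simp only:)
  then have "m dvd k1 - k \<or> m dvd k1 - k - int l" by (simp only: m_dvd_double)
  then show ?thesis
  proof
    assume "m dvd k1 - k"
    then have "dE k1 j = dE k j" "dE (k1 + int l) j = dE (k + int l) j" by (auto intro: dE_cong)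
    then show ?thesis using e1 by simp
  next
    assume *: "m dvd k1 - k - int l"
    then have 1: "dE k1 j = dE (k + int l) j" by (intro dE_cong) (simp add: diff_diff_eq)
    have "m dvd (k1 - k - int l) + m" by (rule dvd_add[OF * dvd_refl])
    also have "(k1 - k - int l) + m = k1 + int l - k" by simp
    finally have 2: "dE (k1 + int l) j = dE k j" by (rule dE_cong)
    have "fscale (cell_sign \<kappa>) (dE k1 j + fscale (cell_sign \<kappa>) (dE (k1 + int l) j)) \<in> fvs.span (new_vectors TYPE('i))"
      using e1 by (rule fvs.span_scale)
    then show ?thesis using props(2) by (simp add: 1 2 fvs.scale_right_distrib add.commute)
  qed
qed

text \<open>Half the sum of \<open>(1 + r^l) r^k e_j\<close> and \<open>(1 - r^l) r^k e_j\<close>,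
  taken from the two kinds of cells of the parity of \<open>j\<close>.\<close>

lemma dE_in_span: "dE k j \<in> fvs.span (new_vectors TYPE('i))"
proof -
  define p where "p = nat (j mod 2)"
  have p: "p = 0 \<or> p = 1" "even (j - int p)" by (auto simp: p_def)
  have "LKr p \<in> (new_cells :: 'i bar set)" "LK p \<in> (new_cells :: 'i bar set)"
    using p by (auto simp: new_cells_def)
  moreover have "cell_parity (LKr p :: 'i bar) = p" "cell_parity (LK p :: 'i bar) = p" "cell_sign (LKr p :: 'i bar) = 1" "cell_sign (LK p :: 'i bar) = - 1"
    by (simp_all add: cell_parity_def cell_sign_def)
  ultimately have "dE k j + fscale 1 (dE (k + int l) j) \<in> fvs.span (new_vectors TYPE('i))"
    "dE k j + fscale (- 1) (dE (k + int l) j) \<in> fvs.span (new_vectors TYPE('i))"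
    using eigenvector_in_span[of "LKr p :: 'i bar" j k] eigenvector_in_span[of "LK p :: 'i bar" j k] p(2)
    by metis+
  then have "(dE k j + fscale 1 (dE (k + int l) j)) + (dE k j + fscale (- 1) (dE (k + int l) j)) \<in> fvs.span (new_vectors TYPE('i))"
    by (rule fvs.span_add)
  then have "fscale (1 / 2) ((dE k j + fscale 1 (dE (k + int l) j)) + (dE k j + fscale (- 1) (dE (k + int l) j))) \<in> fvs.span (new_vectors TYPE('i))"
    by (rule fvs.span_scale)
  also have "fscale (1 / 2) ((dE k j + fscale 1 (dE (k + int l) j)) + (dE k j + fscale (- 1) (dE (k + int l) j))) = dE k j"
    by (rule ext) (simp add: fscale_apply plus_fun_apply)
  finally show ?thesis .
qed

lemma ideal_part_in_span:
  assumes "f \<in> ideal_part" shows "f \<in> fvs.span (new_vectors TYPE('i))"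
proof -
  have f: "periodic f" "f (Gi g) = 0" for g using assms by (auto simp: ideal_part_def)
  have pick: "(\<Sum>k\<in>{0..<m}. F k * of_bool (m dvd k' - k)) = F (k' mod m)" for F :: "int \<Rightarrow> complex" and k'
  proof -
    have "(\<Sum>k\<in>{0..<m}. F k * of_bool (m dvd k' - k)) = (\<Sum>k\<in>{0..<m}. if k = k' mod m then F k else 0)"
    proof (intro sum.cong refl)
      fix k assume "k \<in> {0..<m}"
      then have "m dvd k' - k \<longleftrightarrow> k = k' mod m" by (auto simp flip: mod_eq_dvd_iff)
      then show "F k * of_bool (m dvd k' - k) = (if k = k' mod m then F k else 0)" by simp
    qed
    also have "\<dots> = F (k' mod m)" using l_pos by simp
    finally show ?thesis .
  qed
  have "f = (\<Sum>j\<in>{0..<m}. \<Sum>k\<in>{0..<m}. fscale (f (Ei k j)) (dE k j))"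
  proof
    fix x
    have app: "(\<Sum>i\<in>I. h i) y = (\<Sum>i\<in>I. h i y)" for I y and h :: "int \<Rightarrow> idx \<Rightarrow> complex"
      by (induction I rule: infinite_finite_induct) (auto simp: plus_fun_apply zero_fun_apply)
    show "f x = (\<Sum>j\<in>{0..<m}. \<Sum>k\<in>{0..<m}. fscale (f (Ei k j)) (dE k j)) x"
    proof (cases x)
      case (Gi g)
      then show ?thesis by (simp add: f app fscale_apply)
    next
      case (Ei k' j')
      have "(\<Sum>j\<in>{0..<m}. \<Sum>k\<in>{0..<m}. fscale (f (Ei k j)) (dE k j)) x =
        (\<Sum>j\<in>{0..<m}. (\<Sum>k\<in>{0..<m}. f (Ei k j) * of_bool (m dvd k' - k)) * of_bool (m dvd j' - j))"
        by (simp only: app Ei fscale_apply dE_simps of_bool_conj sum_distrib_right mult.assoc)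
      also have "\<dots> = f (Ei (k' mod m) (j' mod m))" by (simp only: pick)
      also have "\<dots> = f (Ei k' (j' mod m))"
        by (rule periodicD(3)[OF f(1)]) (simp flip: mod_eq_dvd_iff)
      also have "\<dots> = f (Ei k' j')"
        by (rule periodicD(4)[OF f(1)]) (simp flip: mod_eq_dvd_iff)
      finally show ?thesis using Ei by simp
    qed
  qed
  then show ?thesis
    by (metis (no_types, lifting) fvs.span_sum fvs.span_scale dE_in_span)
qed

lemma star_closed: "q \<in> carrier Q \<Longrightarrow> star q \<in> carrier Q"
  by (elim carrier_Q_E) (simp add: star_cls)


text \<open>Everything is compared in coordinates. For (C3), new cells are closed under left
  multiplication. On old cells the given coefficients work up to an error in the ideal, and the
  ideal is spanned by vectors of lower cells.\<close>

theorem cellular_extension: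
  fixes \<Lambda> :: "'i set" and M :: "'i \<Rightarrow> 'm set"
  assumes cs: "cellular_structure CG \<Lambda> ord M C (inversion_star (dihedral (2 * l)))"
  shows "cellular_structure (B_alg l \<mu> \<tau>) (bar_index \<Lambda>) (bar_order \<Lambda> ord) (bar_M l M)
    (bar_C l \<mu> \<tau> C) (B_star l \<mu> \<tau>)"
proof -
  let ?C = "bar_C l \<mu> \<tau> C" and ?M = "bar_M l M"
  let ?X = "SIGMA \<kappa>:\<Lambda>. M \<kappa> \<times> M \<kappa>"
  let ?Y = "SIGMA \<kappa>:bar_index \<Lambda>. ?M \<kappa> \<times> ?M \<kappa>"
  let ?F = "(\<lambda>(\<kappa>, S, T). C \<kappa> S T) ` ?X"
  have alg: "complex_algebra CG" and po: "partial_order_on \<Lambda> ord"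
    and fin: "\<And>\<kappa>. \<kappa> \<in> \<Lambda> \<Longrightarrow> finite (M \<kappa>)"
    and inj: "inj_on (\<lambda>(\<kappa>, S, T). C \<kappa> S T) ?X"
    and basis: "vectorspace.basis complex_field CG ?F"
    and star_C: "\<And>\<kappa> S T. \<lbrakk>\<kappa> \<in> \<Lambda>; S \<in> M \<kappa>; T \<in> M \<kappa>\<rbrakk> \<Longrightarrow> inversion_star (dihedral (2 * l)) (C \<kappa> S T) = C \<kappa> T S"
    and C3: "\<And>a \<kappa>. \<lbrakk>a \<in> carrier CG; \<kappa> \<in> \<Lambda>\<rbrakk> \<Longrightarrow> \<exists>r :: 'm \<Rightarrow> 'm \<Rightarrow> complex. \<forall>S\<in>M \<kappa>. \<forall>T\<in>M \<kappa>.
      (a \<otimes>\<^bsub>CG\<^esub> C \<kappa> S T) \<ominus>\<^bsub>CG\<^esub> (\<Oplus>\<^bsub>CG\<^esub>S'\<in>M \<kappa>. r S' S \<odot>\<^bsub>CG\<^esub> C \<kappa> S' T) \<in> cell_lower CG \<Lambda> ord M C \<kappa>"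
    using cs unfolding cellular_structure_def by blast+
  interpret G: coordinate_map CG incl by (rule coordinate_map_incl[OF alg])
  interpret CG: ring CG using alg by (simp add: complex_algebra_def)
  have C_closed: "C \<kappa> S T \<in> carrier CG" if "\<kappa> \<in> \<Lambda>" "S \<in> M \<kappa>" "T \<in> M \<kappa>" for \<kappa> S T
    using basis that by (force simp: G.basis_def)
  have F_closed: "?F \<subseteq> carrier CG" using C_closed by auto
  have old_closed: "?C (Old \<kappa>) (Inl S) (Inl T) \<in> carrier Q"
    and old_coord: "coord (?C (Old \<kappa>) (Inl S) (Inl T)) = incl (C \<kappa> S T)"
    if "\<kappa> \<in> \<Lambda>" "S \<in> M \<kappa>" "T \<in> M \<kappa>" for \<kappa> S T
    using C_closed[OF that] by (simp_all add: B_incl_closed coord_B_incl)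
  let ?old = "\<lambda>(\<kappa>, S, T). (Old \<kappa> :: 'i bar, Inl S :: 'm + nat, Inl T :: 'm + nat)"
  let ?new = "\<lambda>(\<kappa> :: 'i bar, a, b). (\<kappa>, Inr a :: 'm + nat, Inr b :: 'm + nat)"
  let ?D = "\<lambda>(\<kappa>, S, T). ?C \<kappa> S T"
  have Y: "?Y = ?old ` ?X \<union> ?new ` new_labels"
  proof -
    have "?old ` ?X = (SIGMA \<kappa>:Old ` \<Lambda>. ?M \<kappa> \<times> ?M \<kappa>)" by (force simp: image_iff)
    moreover have "?new ` new_labels = (SIGMA \<kappa>:new_cells. ?M \<kappa> \<times> ?M \<kappa>)"
      by (force simp: image_iff new_labels_def new_cells_props(5))
    ultimately show ?thesis by (auto simp: bar_index_eq)
  qed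
  have D_old: "?D (?old y) \<in> carrier Q" "coord (?D (?old y)) = incl ((\<lambda>(\<kappa>, S, T). C \<kappa> S T) y)" if "y \<in> ?X" for y
    using that old_closed old_coord by (auto simp del: bar_C.simps)
  have D_new: "?D (?new y) \<in> carrier Q" "coord (?D (?new y)) = cell_vector y" if "y \<in> new_labels" for y
    using that by (cases y; simp add: bar_C_new del: cell_vector.simps)+
  have D_closed: "?D y \<in> carrier Q" if "y \<in> ?Y" for y
    using that D_old(1) D_new(1) unfolding Y by blast
  have closed: "?C \<kappa> S T \<in> carrier Q" if "\<kappa> \<in> bar_index \<Lambda>" "S \<in> ?M \<kappa>" "T \<in> ?M \<kappa>" for \<kappa> S T
    using that D_closed[of "(\<kappa>, S, T)"] by simp
  have image: "coord ` ?D ` ?Y = incl ` ?F \<union> new_vectors TYPE('i)"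
    unfolding Y image_Un image_image new_vectors_def using D_old(2) D_new(2) by (simp cong: image_cong)
  have Y_closed: "?D ` ?Y \<subseteq> carrier Q" using D_closed by blast
  have indep_F: "fvs.independent (incl ` ?F)" and span_F: "fvs.span (incl ` ?F) = incl ` carrier CG"
    using basis G.basis_iff[OF F_closed] by auto

  have "inj_on ?D ?Y"
  proof (rule inj_onI)
    fix y z assume y: "y \<in> ?Y" and z: "z \<in> ?Y" and "?D y = ?D z"
    then have eq: "coord (?D y) = coord (?D z)" by simp
    have old_inj: "y' = z'" if "y' \<in> ?X" "z' \<in> ?X" "incl ((\<lambda>(\<kappa>, S, T). C \<kappa> S T) y') = incl ((\<lambda>(\<kappa>, S, T). C \<kappa> S T) z')" for y' z'
      using inj_onD[OF comp_inj_on[OF inj inj_on_subset[OF incl_inject F_closed]]] that by simp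
    from y z show "y = z" unfolding Y
    proof (elim UnE imageE)
      fix y' z' assume yz: "y = ?old y'" "z = ?old z'" and mem: "y' \<in> ?X" "z' \<in> ?X"
      have "coord (?D (?old y')) = coord (?D (?old z'))" using eq unfolding yz .
      then show ?thesis
        using old_inj[of y' z'] mem unfolding yz D_old(2)[OF mem(1)] D_old(2)[OF mem(2)] by simp
    next
      fix y' z' assume yz: "y = ?old y'" "z = ?new z'" and mem: "y' \<in> ?X" "z' \<in> new_labels"
      have "coord (?D (?old y')) = coord (?D (?new z'))" using eq unfolding yz .
      then show ?thesis
        using cell_vector_neq_incl[of z', symmetric] mem unfolding yz D_old(2)[OF mem(1)] D_new(2)[OF mem(2)] by simp
    next
      fix y' z' assume yz: "y = ?new y'" "z = ?old z'" and mem: "y' \<in> new_labels" "z' \<in> ?X"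
      have "coord (?D (?new y')) = coord (?D (?old z'))" using eq unfolding yz .
      then show ?thesis
        using cell_vector_neq_incl[of y'] mem unfolding yz D_new(2)[OF mem(1)] D_old(2)[OF mem(2)] by simp
    next
      fix y' z' assume yz: "y = ?new y'" "z = ?new z'" and mem: "y' \<in> new_labels" "z' \<in> new_labels"
      have "coord (?D (?new y')) = coord (?D (?new z'))" using eq unfolding yz .
      then show ?thesis
        using inj_onD[OF cell_vector_inj, of y' z'] mem unfolding yz D_new(2)[OF mem(1)] D_new(2)[OF mem(2)] by simp
    qed
  qed

  moreover have "vectorspace.basis complex_field Q (?D ` ?Y)"
  proof -
    have "coord ` carrier Q \<subseteq> fvs.span (incl ` ?F \<union> new_vectors TYPE('i))"
    proof
      fix v assume "v \<in> coord ` carrier Q"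
      then obtain x where x: "x \<in> free_carrier l" "v = act x unit" by (auto simp: carrier_Q coord_cls)
      obtain g where g: "g \<in> carrier CG" "\<forall>f\<in>carrier CG. act x (incl f) - incl (g \<otimes>\<^bsub>CG\<^esub> f) \<in> ideal_part"
        using act_incl[OF alg x(1)] by blast
      \<comment> \<open>Applied to the unit of the group algebra, \<open>act_incl\<close> splits
        \<open>v\<close> into the group part \<open>incl g\<close> and a remainder in the
        ideal.\<close>
      have "incl \<one>\<^bsub>CG\<^esub> = unit" by (simp add: CG_simps(5) incl_single)
      then have "v - incl g \<in> ideal_part"
        using g(2)[rule_format, OF CG.one_closed] g(1) x(2) by simp
      then have "v - incl g \<in> fvs.span (incl ` ?F \<union> new_vectors TYPE('i))"
        using ideal_part_in_span fvs.span_mono[of "new_vectors TYPE('i)" "incl ` ?F \<union> new_vectors TYPE('i)"] by blast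
      moreover have "incl g \<in> fvs.span (incl ` ?F \<union> new_vectors TYPE('i))"
        using span_F g(1) fvs.span_mono[of "incl ` ?F" "incl ` ?F \<union> new_vectors TYPE('i)"] by blast
      ultimately have "(v - incl g) + incl g \<in> fvs.span (incl ` ?F \<union> new_vectors TYPE('i))"
        by (rule fvs.span_add)
      then show "v \<in> fvs.span (incl ` ?F \<union> new_vectors TYPE('i))" by simp
    qed
    moreover have "fvs.span (incl ` ?F \<union> new_vectors TYPE('i)) \<subseteq> coord ` carrier Q"
    proof -
      have "B.span (?D ` ?Y) \<subseteq> carrier Q"
        using Y_closed by (auto simp: B.span_def)
      then show ?thesis unfolding image[symmetric] B.h_span[OF Y_closed, symmetric] by blast
    qed
    ultimately show ?thesis
      unfolding B.basis_iff[OF Y_closed] image using new_vectors_independent[OF indep_F] by blast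
  qed

  moreover have "star (?C \<kappa> S T) = ?C \<kappa> T S" if \<kappa>: "\<kappa> \<in> bar_index \<Lambda>" "S \<in> ?M \<kappa>" "T \<in> ?M \<kappa>" for \<kappa> S T
  proof (cases "\<kappa> \<in> new_cells")
    case True
    then obtain a b where ab: "a \<in> parity_labels l (cell_parity \<kappa>)" "b \<in> parity_labels l (cell_parity \<kappa>)" "S = Inr a" "T = Inr b"
      using \<kappa> new_cells_props(5)[OF True, of l M] by auto
    then have "(\<kappa>, a, b) \<in> new_labels" "(\<kappa>, b, a) \<in> new_labels" using True by (simp_all add: new_labels_iff)
    note new = bar_C_new[OF this(1), of C] bar_C_new[OF this(2), of C]
    have "coord (star (?C \<kappa> S T)) = coord (?C \<kappa> T S)"
      using star_fam[OF new(1) new(2)[unfolded cell_vector.simps]] new(4) ab by simp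
    then show ?thesis using new ab by (subst (asm) coord_eq_iff) (auto intro: star_closed)
  next
    case False
    then obtain x S' T' where x: "\<kappa> = Old x" "x \<in> \<Lambda>" "S = Inl S'" "T = Inl T'" "S' \<in> M x" "T' \<in> M x"
      using \<kappa> by (auto simp: bar_index_eq)
    then show ?thesis using star_B_incl[OF C_closed] star_C by simp
  qed

  moreover have "\<exists>r :: 'm + nat \<Rightarrow> 'm + nat \<Rightarrow> complex. \<forall>S\<in>?M \<kappa>. \<forall>T\<in>?M \<kappa>.
      (q \<otimes>\<^bsub>Q\<^esub> ?C \<kappa> S T) \<ominus>\<^bsub>Q\<^esub> (\<Oplus>\<^bsub>Q\<^esub>S'\<in>?M \<kappa>. r S' S \<odot>\<^bsub>Q\<^esub> ?C \<kappa> S' T)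
        \<in> cell_lower Q (bar_index \<Lambda>) (bar_order \<Lambda> ord) ?M ?C \<kappa>"
    if q: "q \<in> carrier Q" and \<kappa>: "\<kappa> \<in> bar_index \<Lambda>" for q \<kappa>
  proof -
    obtain x where x: "x \<in> free_carrier l" "q = cls x" using q by (rule carrier_Q_E)
    interpret Q: ring Q by (rule ring_Q)
    let ?L = "{?C \<nu> S T | \<nu> S T. \<nu> \<in> bar_index \<Lambda> \<and> (\<nu>, \<kappa>) \<in> bar_order \<Lambda> ord \<and> \<nu> \<noteq> \<kappa> \<and> S \<in> ?M \<nu> \<and> T \<in> ?M \<nu>}"
    have L: "?L \<subseteq> carrier Q" using closed by auto
    have lower: "cell_lower Q (bar_index \<Lambda>) (bar_order \<Lambda> ord) ?M ?C \<kappa> = B.span ?L"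
      by (simp add: cell_lower_def)
    have sum_closed: "(\<lambda>S'. r S' \<odot>\<^bsub>Q\<^esub> ?C \<kappa> S' T) \<in> ?M \<kappa> \<rightarrow> carrier Q" if "T \<in> ?M \<kappa>" for T and r :: "'m + nat \<Rightarrow> complex"
      using closed[OF \<kappa>] that by auto
    have diff: "(q \<otimes>\<^bsub>Q\<^esub> ?C \<kappa> S T) \<ominus>\<^bsub>Q\<^esub> (\<Oplus>\<^bsub>Q\<^esub>S'\<in>?M \<kappa>. r S' \<odot>\<^bsub>Q\<^esub> ?C \<kappa> S' T) \<in> B.span ?L \<longleftrightarrow>
      act x (coord (?C \<kappa> S T)) - (\<Sum>S'\<in>?M \<kappa>. fscale (r S') (coord (?C \<kappa> S' T))) \<in> fvs.span (coord ` ?L)"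
      if ST: "S \<in> ?M \<kappa>" "T \<in> ?M \<kappa>" for S T and r :: "'m + nat \<Rightarrow> complex"
    proof -
      have c: "q \<otimes>\<^bsub>Q\<^esub> ?C \<kappa> S T \<in> carrier Q" "(\<Oplus>\<^bsub>Q\<^esub>S'\<in>?M \<kappa>. r S' \<odot>\<^bsub>Q\<^esub> ?C \<kappa> S' T) \<in> carrier Q"
        using q closed[OF \<kappa> ST] sum_closed[OF ST(2), of r] by auto
      have "coord (\<Oplus>\<^bsub>Q\<^esub>S'\<in>?M \<kappa>. r S' \<odot>\<^bsub>Q\<^esub> ?C \<kappa> S' T) = (\<Sum>S'\<in>?M \<kappa>. fscale (r S') (coord (?C \<kappa> S' T)))"
        unfolding B.h_finsum[OF sum_closed[OF ST(2)]]
        by (intro sum.cong refl B.smult closed[OF \<kappa>] ST)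
      then show ?thesis
        using c closed[OF \<kappa> ST]
        by (subst B.mem_span_iff[OF L]) (auto simp: B.h_minus x coord_mult)
    qed
    show ?thesis
    proof (cases "\<kappa> \<in> new_cells")
      case True
      note props = new_cells_props[OF True]
      \<comment> \<open>On a new cell the congruence in (C3) is an equality, so the difference to be
        placed in the lower span is zero.\<close>
      obtain r where r: "\<And>a b. \<lbrakk>a \<in> parity_labels l (cell_parity \<kappa>); b \<in> parity_labels l (cell_parity \<kappa>)\<rbrakk> \<Longrightarrow>
        act x (cell_vector (\<kappa>, a, b)) = (\<Sum>a'\<in>parity_labels l (cell_parity \<kappa>). fscale (r a' a) (cell_vector (\<kappa>, a', b)))"
        unfolding cell_vector.simps using act_fam[OF props(1) separating_cell_rep[OF True] x(1) props(2)] by metis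
      show ?thesis unfolding lower
      proof (intro exI[of _ "\<lambda>S' S. r (projr S') (projr S)"] ballI)
        fix S T assume ST: "S \<in> ?M \<kappa>" "T \<in> ?M \<kappa>"
        then obtain a b where ab: "a \<in> parity_labels l (cell_parity \<kappa>)" "b \<in> parity_labels l (cell_parity \<kappa>)" "S = Inr a" "T = Inr b"
          using new_cells_props(5)[OF True, of l M] by auto
        have "(\<Sum>S'\<in>?M \<kappa>. fscale (r (projr S') (projr S)) (coord (?C \<kappa> S' T))) =
          (\<Sum>a'\<in>parity_labels l (cell_parity \<kappa>). fscale (r a' a) (cell_vector (\<kappa>, a', b)))"
          unfolding props(5) using ab True by (simp add: sum.reindex bar_C_new(2) new_labels_iff del: cell_vector.simps)
        then show "(q \<otimes>\<^bsub>Q\<^esub> ?C \<kappa> S T) \<ominus>\<^bsub>Q\<^esub> (\<Oplus>\<^bsub>Q\<^esub>S'\<in>?M \<kappa>. r (projr S') (projr S) \<odot>\<^bsub>Q\<^esub> ?C \<kappa> S' T) \<in> B.span ?L"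
          unfolding diff[OF ST] using ab True r by (simp add: bar_C_new(2) new_labels_iff fvs.span_zero del: cell_vector.simps)
      qed
    next
      case False
      then obtain y where y: "\<kappa> = Old y" "y \<in> \<Lambda>" using \<kappa> by (auto simp: bar_index_eq)
      \<comment> \<open>The coefficients for \<open>x\<close> are those that the old structure
        provides for the image \<open>g\<close> of \<open>x\<close> in the group algebra.\<close>
      obtain g where g: "g \<in> carrier CG" "\<And>f. f \<in> carrier CG \<Longrightarrow> act x (incl f) - incl (g \<otimes>\<^bsub>CG\<^esub> f) \<in> ideal_part"
        using act_incl[OF alg x(1)] by blast
      let ?LG = "{C \<nu> S T | \<nu> S T. \<nu> \<in> \<Lambda> \<and> (\<nu>, y) \<in> ord \<and> \<nu> \<noteq> y \<and> S \<in> M \<nu> \<and> T \<in> M \<nu>}"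
      have LG: "?LG \<subseteq> carrier CG" using C_closed by auto
      from C3[OF g(1) y(2)] obtain r where "\<forall>S\<in>M y. \<forall>T\<in>M y.
        (g \<otimes>\<^bsub>CG\<^esub> C y S T) \<ominus>\<^bsub>CG\<^esub> (\<Oplus>\<^bsub>CG\<^esub>S'\<in>M y. r S' S \<odot>\<^bsub>CG\<^esub> C y S' T) \<in> cell_lower CG \<Lambda> ord M C y" ..
      then have r: "(g \<otimes>\<^bsub>CG\<^esub> C y S T) \<ominus>\<^bsub>CG\<^esub> (\<Oplus>\<^bsub>CG\<^esub>S'\<in>M y. r S' S \<odot>\<^bsub>CG\<^esub> C y S' T) \<in> G.span ?LG"
        if "S \<in> M y" "T \<in> M y" for S T
        using that by (simp only: cell_lower_def)
      have "incl ` ?LG \<subseteq> coord ` ?L"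
      proof
        fix v assume "v \<in> incl ` ?LG"
        then obtain \<nu> S T where \<nu>: "\<nu> \<in> \<Lambda>" "(\<nu>, y) \<in> ord" "\<nu> \<noteq> y" "S \<in> M \<nu>" "T \<in> M \<nu>" "v = incl (C \<nu> S T)" by auto
        then have "v = coord (?C (Old \<nu>) (Inl S) (Inl T))" by (simp add: old_coord del: bar_C.simps)
        moreover have "?C (Old \<nu>) (Inl S) (Inl T) \<in> ?L"
          using \<nu> y by (intro CollectI exI[of _ "Old \<nu>"] exI[of _ "Inl S"] exI[of _ "Inl T"])
            (auto simp: bar_index_eq bar_order_def)
        ultimately show "v \<in> coord ` ?L" by blast
      qed
      then have span_LG: "fvs.span (incl ` ?LG) \<subseteq> fvs.span (coord ` ?L)" by (rule fvs.span_mono)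
      \<comment> \<open>Each new index lies strictly below each old one, so the whole ideal is
        available as lower terms.\<close>
      have "new_vectors TYPE('i) \<subseteq> coord ` ?L"
      proof
        fix v assume "v \<in> new_vectors TYPE('i)"
        then obtain \<nu> :: "'i bar" and a b where \<nu>: "(\<nu>, a, b) \<in> new_labels" "v = cell_vector (\<nu>, a, b)"
          by (auto simp: new_vectors_def simp del: cell_vector.simps)
        then have new: "\<nu> \<in> new_cells" and "v = coord (?C \<nu> (Inr a) (Inr b))"
          by (simp_all add: bar_C_new(2) new_labels_iff del: cell_vector.simps)
        moreover have "?C \<nu> (Inr a) (Inr b) \<in> ?L"
        proof -
          have "(\<nu>, \<kappa>) \<in> bar_order \<Lambda> ord" using new y by (auto simp: new_cells_def bar_order_def)
          then show ?thesis using \<nu>(1) y new new_cells_props(5)[OF new, of l M] new_cells_props(6)[OF new, of y]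
            by (intro CollectI exI[of _ \<nu>] exI[of _ "Inr a"] exI[of _ "Inr b"]) (auto simp: bar_index_eq new_labels_iff)
        qed
        ultimately show "v \<in> coord ` ?L" by blast
      qed
      then have span_new: "fvs.span (new_vectors TYPE('i)) \<subseteq> fvs.span (coord ` ?L)" by (rule fvs.span_mono)
      show ?thesis unfolding lower
      proof (intro exI[of _ "\<lambda>S' S. r (projl S') (projl S)"] ballI)
        fix S T assume ST: "S \<in> ?M \<kappa>" "T \<in> ?M \<kappa>"
        then obtain s t where st: "s \<in> M y" "t \<in> M y" "S = Inl s" "T = Inl t"
          using y by auto
        have sum: "(\<Sum>S'\<in>?M \<kappa>. fscale (r (projl S') (projl S)) (coord (?C \<kappa> S' T))) =
          (\<Sum>s'\<in>M y. fscale (r s' s) (incl (C y s' t)))"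
          using st y by (simp add: sum.reindex old_coord del: bar_C.simps)
        have cl: "(\<lambda>s'. r s' s \<odot>\<^bsub>CG\<^esub> C y s' t) \<in> M y \<rightarrow> carrier CG" using C_closed y st by auto
        have "incl ((g \<otimes>\<^bsub>CG\<^esub> C y s t) \<ominus>\<^bsub>CG\<^esub> (\<Oplus>\<^bsub>CG\<^esub>s'\<in>M y. r s' s \<odot>\<^bsub>CG\<^esub> C y s' t)) =
          incl (g \<otimes>\<^bsub>CG\<^esub> C y s t) - (\<Sum>s'\<in>M y. fscale (r s' s) (incl (C y s' t)))"
          using g(1) C_closed y st cl
          by (subst G.h_minus) (auto simp: G.h_finsum G.smult intro!: sum.cong)
        moreover have "incl ((g \<otimes>\<^bsub>CG\<^esub> C y s t) \<ominus>\<^bsub>CG\<^esub> (\<Oplus>\<^bsub>CG\<^esub>s'\<in>M y. r s' s \<odot>\<^bsub>CG\<^esub> C y s' t)) \<in> fvs.span (incl ` ?LG)"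
          using r[OF st(1,2)] G.h_span[OF LG] by blast
        ultimately have 1: "incl (g \<otimes>\<^bsub>CG\<^esub> C y s t) - (\<Sum>s'\<in>M y. fscale (r s' s) (incl (C y s' t))) \<in> fvs.span (coord ` ?L)"
          using span_LG by auto
        have 2: "act x (incl (C y s t)) - incl (g \<otimes>\<^bsub>CG\<^esub> C y s t) \<in> fvs.span (coord ` ?L)"
          using ideal_part_in_span[OF g(2)[OF C_closed[OF y(2) st(1,2)]]] span_new by blast
        have "act x (incl (C y s t)) - (\<Sum>s'\<in>M y. fscale (r s' s) (incl (C y s' t))) \<in> fvs.span (coord ` ?L)"
          using fvs.span_add[OF 2 1] by simp
        then show "(q \<otimes>\<^bsub>Q\<^esub> ?C \<kappa> S T) \<ominus>\<^bsub>Q\<^esub> (\<Oplus>\<^bsub>Q\<^esub>S'\<in>?M \<kappa>. r (projl S') (projl S) \<odot>\<^bsub>Q\<^esub> ?C \<kappa> S' T) \<in> B.span ?L"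
          unfolding diff[OF ST] sum using st y by (simp add: old_coord del: bar_C.simps)
      qed
    qed
  qed

  moreover have "finite (?M \<kappa>)" if "\<kappa> \<in> bar_index \<Lambda>" for \<kappa>
    using that fin new_cells_props(5)[of \<kappa> l M] by (auto simp: bar_index_eq)
  ultimately show ?thesis
    unfolding cellular_structure_def B_alg_eq B_star_eq
    using complex_algebra_Q partial_order_bar[OF po] star_props(1) by blast
qed

end

theorem proposition5p2:
  fixes l :: nat and \<mu>0 \<mu>1 \<tau>0 \<tau>1 :: complex and \<mu> \<tau> :: "nat \<Rightarrow> complex"
    and \<Lambda> :: "'i set" and ord :: "'i rel" and M :: "'i \<Rightarrow> 'm set"
    and C :: "'i \<Rightarrow> 'm \<Rightarrow> 'm \<Rightarrow> ((real^2 \<Rightarrow> real^2) \<Rightarrow>\<^sub>0 complex)"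
  assumes "l \<ge> 1"
    and "\<And>i. \<mu> i = (if even i then \<mu>0 else \<mu>1)"
    and "\<And>i. \<tau> i = (if even i then \<tau>0 else \<tau>1)"
    and "cellular_structure (monoid_algebra (dihedral (2 * l))) \<Lambda> ord M C
      (inversion_star (dihedral (2 * l)))"
  shows "cellular_structure (B_alg l \<mu> \<tau>) (bar_index \<Lambda>) (bar_order \<Lambda> ord) (bar_M l M)
    (bar_C l \<mu> \<tau> C) (B_star l \<mu> \<tau>)"
proof -
  interpret dihedral_brauer l \<mu> \<tau>
    using assms(1-3) by unfold_locales auto
  show ?thesis using assms(4) by (rule cellular_extension)
qed

end
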